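(* Let $G\rightrightarrows X$ be a proper locally compact groupoid, $\boldsymbol A$ a Banach algebra, and $\sigma$ an $\boldsymbol A$-valued multiplier for $G$ satisfying $|\sigma(g,h)^{-1}|=1/|\sigma(g,h)|$. Let $x\in X$ and let $S:G(x)\to\mathrm{GL}_{\boldsymbol A}(\boldsymbol E)$ be a uniformly continuous $\sigma$-representation of the isotropy group $G(x)$ on a Banach $\boldsymbol A$-module $\boldsymbol E$. Then there exist an open neighborhood $V$ of $x$ in $X$ and a uniformly continuous $\sigma$-representation $R:G|V\to\mathrm{GL}_{\boldsymbol A}(\boldsymbol E)$ of $G|V\rightrightarrows V$ with $R(k)=S(k)$ for all $k\in G(x)$.
   Context: A locally compact groupoid is a topological groupoid $G\rightrightarrows X$ (source $s$, target $t$, units $1x$, composable pairs $G\times_{s,t}G=\{(g,h):sg=th\}$) with locally compact Hausdorff arrow space and a continuous left Haar system $\{\mu^x\}$ (Radon measures with support $t^{-1}(x)$, left invariant, $x\mapsto\int\varphi\,d\mu^x$ continuous for $\varphi\in C_c(G)$). A cutoff function is a continuous $c:X\to\mathbb R_{\ge0}$ with $\mathrm{supp}(c\circ s)\cap t^{-1}(C)$ compact for compact $C\subset X$ and every orbit meeting $\{c>0\}$; $G$ is proper if one exists. $G(x)=s^{-1}(x)\cap t^{-1}(x)$; $G|V=s^{-1}(V)\cap t^{-1}(V)$. Banach algebras are unital with $|ab|\le|a||b|$, $|1|=1$. An $\boldsymbol A$-valued multiplier is a continuous map $\sigma:G\times_{s,t}G\to\boldsymbol A^\times$ with values in the center of $\boldsymbol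 A$, $\sigma(g,h)=1$ if $g$ or $h$ is a unit, and $\sigma(g,h)\sigma(gh,k)=\sigma(h,k)\sigma(g,hk)$. A Banach $\boldsymbol A$-module $\boldsymbol E$ satisfies $|ae|\le|a||e|$, $1e=e$; $\mathrm{GL}_{\boldsymbol A}(\boldsymbol E)$ is the group of invertible bounded $\boldsymbol A$-linear operators. For a subgroupoid $H$ of $G$ (such as $G(x)$ or $G|V$), a uniformly continuous $\sigma$-representation of $H$ on $\boldsymbol E$ is a map $R:H\to\mathrm{GL}_{\boldsymbol A}(\boldsymbol E)$ continuous for the operator-norm topology with $R(1y)=\mathrm{id}$ for units and $\sigma(g,h)R(gh)=R(g)R(h)$ for composable $(g,h)$ in $H$. *)

theory Defs
  imports "HOL-Analysis.Analysis"
begin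

text \<open>A groupoid with arrow space 'g and object space 'x, given by source s, target t,
  unit map u, partial multiplication m (meaningful only on composable pairs, i.e. s g = t h)
  and inversion i.\<close>

definition composable :: "('g \<Rightarrow> 'x) \<Rightarrow> ('g \<Rightarrow> 'x) \<Rightarrow> ('g \<times> 'g) set" where
  "composable s t = {(g, h). s g = t h}"

definition groupoid ::
  "('g \<Rightarrow> 'x) \<Rightarrow> ('g \<Rightarrow> 'x) \<Rightarrow> ('x \<Rightarrow> 'g) \<Rightarrow> ('g \<Rightarrow> 'g \<Rightarrow> 'g) \<Rightarrow> ('g \<Rightarrow> 'g) \<Rightarrow> bool" where
  "groupoid s t u m i \<longleftrightarrow>
     (\<forall>x. s (u x) = x \<and> t (u x) = x) \<and>
     (\<forall>g h. s g = t h \<longrightarrow> s (m g h) = s h \<and> t (m g h) = t g) \<and>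
     (\<forall>g h k. s g = t h \<and> s h = t k \<longrightarrow> m (m g h) k = m g (m h k)) \<and>
     (\<forall>g. m g (u (s g)) = g \<and> m (u (t g)) g = g) \<and>
     (\<forall>g. s (i g) = t g \<and> t (i g) = s g \<and> m g (i g) = u (t g) \<and> m (i g) g = u (s g))"

definition topological_groupoid ::
  "('g::topological_space \<Rightarrow> 'x::topological_space) \<Rightarrow> ('g \<Rightarrow> 'x) \<Rightarrow> ('x \<Rightarrow> 'g)
   \<Rightarrow> ('g \<Rightarrow> 'g \<Rightarrow> 'g) \<Rightarrow> ('g \<Rightarrow> 'g) \<Rightarrow> bool" where
  "topological_groupoid s t u m i \<longleftrightarrow> groupoid s t u m i \<and>
     continuous_on UNIV s \<and> continuous_on UNIV t \<and> continuous_on UNIV u \<and>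
     continuous_on UNIV i \<and> continuous_on (composable s t) (\<lambda>(g, h). m g h)"

definition radon_measure :: "'g::topological_space measure \<Rightarrow> bool" where
  "radon_measure M \<longleftrightarrow> sets M = sets borel \<and>
     (\<forall>K. compact K \<longrightarrow> emeasure M K < \<infinity>) \<and>
     (\<forall>A \<in> sets borel. emeasure M A = (INF U \<in> {U. open U \<and> A \<subseteq> U}. emeasure M U)) \<and>
     (\<forall>U. open U \<longrightarrow> emeasure M U = (SUP K \<in> {K. compact K \<and> K \<subseteq> U}. emeasure M K))"

definition measure_support :: "'g::topological_space measure \<Rightarrow> 'g set" where
  "measure_support M = {g. \<forall>U. open U \<and> g \<in> U \<longrightarrow> emeasure M U \<noteq> 0}"

definition Cc :: "('g::topological_space \<Rightarrow> real) set" where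
  "Cc = {\<phi>. continuous_on UNIV \<phi> \<and> compact (closure {g. \<phi> g \<noteq> 0})}"

definition left_haar_system ::
  "('g::topological_space \<Rightarrow> 'x::topological_space) \<Rightarrow> ('g \<Rightarrow> 'x) \<Rightarrow> ('g \<Rightarrow> 'g \<Rightarrow> 'g)
   \<Rightarrow> ('x \<Rightarrow> 'g measure) \<Rightarrow> bool" where
  "left_haar_system s t m \<mu> \<longleftrightarrow>
     (\<forall>x. radon_measure (\<mu> x) \<and> measure_support (\<mu> x) = t -` {x}) \<and>
     (\<forall>g. \<forall>\<phi> \<in> Cc. (\<integral>h. \<phi> (m g h) \<partial>\<mu> (s g)) = (\<integral>h. \<phi> h \<partial>\<mu> (t g))) \<and>
     (\<forall>\<phi> \<in> Cc. continuous_on UNIV (\<lambda>x. \<integral>h. \<phi> h \<partial>\<mu> x))"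

definition locally_compact_groupoid ::
  "('g::t2_space \<Rightarrow> 'x::topological_space) \<Rightarrow> ('g \<Rightarrow> 'x) \<Rightarrow> ('x \<Rightarrow> 'g)
   \<Rightarrow> ('g \<Rightarrow> 'g \<Rightarrow> 'g) \<Rightarrow> ('g \<Rightarrow> 'g) \<Rightarrow> ('x \<Rightarrow> 'g measure) \<Rightarrow> bool" where
  "locally_compact_groupoid s t u m i \<mu> \<longleftrightarrow>
     topological_groupoid s t u m i \<and>
     locally_compact_space (euclidean :: 'g topology) \<and>
     left_haar_system s t m \<mu>"

definition cutoff_function ::
  "('g::topological_space \<Rightarrow> 'x::topological_space) \<Rightarrow> ('g \<Rightarrow> 'x) \<Rightarrow> ('x \<Rightarrow> real) \<Rightarrow> bool" where
  "cutoff_function s t c \<longleftrightarrow> continuous_on UNIV c \<and> (\<forall>x. c x \<ge> 0) \<and>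
     (\<forall>C. compact C \<longrightarrow> compact (closure {g. c (s g) \<noteq> 0} \<inter> t -` C)) \<and>
     (\<forall>x. \<exists>g. s g = x \<and> c (t g) > 0)"

definition proper_groupoid ::
  "('g::topological_space \<Rightarrow> 'x::topological_space) \<Rightarrow> ('g \<Rightarrow> 'x) \<Rightarrow> bool" where
  "proper_groupoid s t \<longleftrightarrow> (\<exists>c. cutoff_function s t c)"

definition multiplier ::
  "('g::topological_space \<Rightarrow> 'x) \<Rightarrow> ('g \<Rightarrow> 'x) \<Rightarrow> ('x \<Rightarrow> 'g) \<Rightarrow> ('g \<Rightarrow> 'g \<Rightarrow> 'g)
   \<Rightarrow> ('g \<Rightarrow> 'g \<Rightarrow> 'a::{real_normed_algebra_1, banach}) \<Rightarrow> bool" where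
  "multiplier s t u m \<sigma> \<longleftrightarrow>
     continuous_on (composable s t) (\<lambda>(g, h). \<sigma> g h) \<and>
     (\<forall>g h. s g = t h \<longrightarrow> (\<exists>b. \<sigma> g h * b = 1 \<and> b * \<sigma> g h = 1)) \<and>
     (\<forall>g h. s g = t h \<longrightarrow> (\<forall>a. \<sigma> g h * a = a * \<sigma> g h)) \<and>
     (\<forall>g h. s g = t h \<and> (g \<in> range u \<or> h \<in> range u) \<longrightarrow> \<sigma> g h = 1) \<and>
     (\<forall>g h k. s g = t h \<and> s h = t k \<longrightarrow>
        \<sigma> g h * \<sigma> (m g h) k = \<sigma> h k * \<sigma> g (m h k))"

definition banach_module :: "('a::{real_normed_algebra_1, banach} \<Rightarrow> 'e::banach \<Rightarrow> 'e) \<Rightarrow> bool" where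
  "banach_module act \<longleftrightarrow>
     (\<forall>a b e. act (a + b) e = act a e + act b e) \<and>
     (\<forall>a e f. act a (e + f) = act a e + act a f) \<and>
     (\<forall>r a e. act (r *\<^sub>R a) e = r *\<^sub>R act a e) \<and>
     (\<forall>r a e. act a (r *\<^sub>R e) = r *\<^sub>R act a e) \<and>
     (\<forall>a b e. act (a * b) e = act a (act b e)) \<and>
     (\<forall>e. act 1 e = e) \<and>
     (\<forall>a e. norm (act a e) \<le> norm a * norm e)"

definition GL_A :: "('a::{real_normed_algebra_1, banach} \<Rightarrow> 'e::banach \<Rightarrow> 'e) \<Rightarrow> ('e \<Rightarrow>\<^sub>L 'e) set" where
  "GL_A act = {T. (\<forall>a e. blinfun_apply T (act a e) = act a (blinfun_apply T e)) \<and>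
     (\<exists>T'. T o\<^sub>L T' = id_blinfun \<and> T' o\<^sub>L T = id_blinfun)}"

definition isotropy :: "('g \<Rightarrow> 'x) \<Rightarrow> ('g \<Rightarrow> 'x) \<Rightarrow> 'x \<Rightarrow> 'g set" where
  "isotropy s t x = s -` {x} \<inter> t -` {x}"

definition restrict_groupoid :: "('g \<Rightarrow> 'x) \<Rightarrow> ('g \<Rightarrow> 'x) \<Rightarrow> 'x set \<Rightarrow> 'g set" where
  "restrict_groupoid s t V = s -` V \<inter> t -` V"

text \<open>Uniformly continuous sigma-representation of the subgroupoid H (with unit space Y)
  on E: continuous for the operator-norm topology.\<close>

definition uc_sigma_rep ::
  "('g::topological_space \<Rightarrow> 'x) \<Rightarrow> ('g \<Rightarrow> 'x) \<Rightarrow> ('x \<Rightarrow> 'g) \<Rightarrow> ('g \<Rightarrow> 'g \<Rightarrow> 'g)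
   \<Rightarrow> ('g \<Rightarrow> 'g \<Rightarrow> 'a::{real_normed_algebra_1, banach}) \<Rightarrow> ('a \<Rightarrow> 'e::banach \<Rightarrow> 'e)
   \<Rightarrow> 'g set \<Rightarrow> 'x set \<Rightarrow> ('g \<Rightarrow> ('e \<Rightarrow>\<^sub>L 'e)) \<Rightarrow> bool" where
  "uc_sigma_rep s t u m \<sigma> act H Y R \<longleftrightarrow>
     (\<forall>g \<in> H. R g \<in> GL_A act) \<and>
     continuous_on H R \<and>
     (\<forall>y \<in> Y. R (u y) = id_blinfun) \<and>
     (\<forall>g \<in> H. \<forall>h \<in> H. s g = t h \<longrightarrow>
        (\<forall>e. act (\<sigma> g h) (blinfun_apply (R (m g h)) e) = blinfun_apply (R g) (blinfun_apply (R h) e)))"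

end

(* Given a continuous near representation T of G|V, averaging sigma(g,k) T(gk) T(k)^-1 over k in
   t^-1(s g) against a normalized invariant Haar mean (weighted by a cutoff supported in V) yields a
   new near representation whose defect is, up to a constant, the square of the old one; the iterates
   converge uniformly to a representation close to T. Applied to a crude continuous extension of S, which
   is nearly multiplicative near the compact group G(x), this gives a representation R of some G|V with
   R close to S on G(x). Two nearby representations of G(x) are conjugate by an operator B close
   to the identity, and B R B^-1 is the extension sought. B is a limit of means of T(k) B_n R(k)^-1 over
   t^-1(x) with weights concentrating near G(x), so no Haar measure on G(x) is needed. *)

theory Submission
  imports Defs
begin

text \<open>Even an exact continuous extension of S would not survive the averaging: the mean at x
  runs over arrows that end at x and start anywhere in V, not only over G(x), so the values on G(x)
  move. The iteration can therefore only deliver R near S, and the conjugation is what restores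
  equality. The weight has to vanish off V because T is controlled on G|V alone; a bounded integrand
  times a weight tending to zero at the edge of V is still continuous on the whole fibre. Properness
  is used in one local form: over a small neighbourhood of x, the arrows ending in a compact set lie
  in a compact set. This makes G(x) compact, gives weights with compact fibre supports, and lets
  open conditions on pairs in G(x) spread to G|V. Arrow and object spaces need be neither metrizable
  nor second countable, so continuity is argued with neighbourhoods and finite covers, and
  integrands are approximated by finite combinations of compactly supported functions with vector
  coefficients.\<close>

section \<open>Integration of vector-valued functions without second countability\<close>

text \<open>The library's Bochner integral demands second countable values, which operator spaces do not
  have. Errors are measured by an integrable majorant \<open>r\<close>, so that no measurability of \<open>f\<close> is needed.\<close>
definition has_vint :: "'g measure \<Rightarrow> ('g \<Rightarrow> 'b::real_normed_vector) \<Rightarrow> 'b \<Rightarrow> bool" where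
  "has_vint M f I \<longleftrightarrow> (\<forall>e>0. \<exists>w r. Bochner_Integration.simple_bochner_integrable M w \<and> integrable M r \<and>
     (AE x in M. norm (f x - w x) \<le> r x) \<and> (\<integral>x. r x \<partial>M) \<le> (e::real) \<and>
     norm (Bochner_Integration.simple_bochner_integral M w - I) \<le> e)"

lemma simple_norm_integrable:
  assumes "Bochner_Integration.simple_bochner_integrable M w"
  shows "integrable M (\<lambda>x. norm (w x))"
    and "norm (Bochner_Integration.simple_bochner_integral M w) \<le> (\<integral>x. norm (w x) \<partial>M)"
proof -
  have 1: "Bochner_Integration.simple_bochner_integrable M (\<lambda>x. norm (w x))"
    using simple_bochner_integrable_compose2[where p="\<lambda>a b. norm a", OF _ assms assms] by simp
  then show "integrable M (\<lambda>x. norm (w x))"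
    using has_bochner_integral_simple_bochner_integrable integrable.intros by blast
  show "norm (Bochner_Integration.simple_bochner_integral M w) \<le> (\<integral>x. norm (w x) \<partial>M)"
    using simple_bochner_integral_norm_bound[OF assms] simple_bochner_integrable_eq_integral[OF 1]
    by simp
qed

text \<open>The simple approximant has norm at most \<open>g + r\<close> almost everywhere, and
  \<open>r\<close> has arbitrarily small integral. With linearity, this bound gives uniqueness and
  every later comparison of integrals.\<close>

lemma has_vint_norm_le:
  assumes "has_vint M f I" "integrable M g" "AE x in M. norm (f x) \<le> g x"
  shows "norm I \<le> (\<integral>x. g x \<partial>M)"
proof (rule field_le_epsilon)
  fix e :: real assume "e > 0"
  then obtain w r where w: "Bochner_Integration.simple_bochner_integrable M w" "integrable M r"
     "AE x in M. norm (f x - w x) \<le> r x" "(\<integral>x. r x \<partial>M) \<le> e/2"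
     "norm (Bochner_Integration.simple_bochner_integral M w - I) \<le> e/2"
    using assms(1) unfolding has_vint_def by (meson half_gt_zero)
  have "norm I \<le> norm (Bochner_Integration.simple_bochner_integral M w) + e/2"
    using w(5) norm_triangle_sub[of I "Bochner_Integration.simple_bochner_integral M w"] by (simp add: norm_minus_commute)
  also have "norm (Bochner_Integration.simple_bochner_integral M w) \<le> (\<integral>x. norm (w x) \<partial>M)"
    using simple_norm_integrable(2)[OF w(1)] .
  also have "(\<integral>x. norm (w x) \<partial>M) \<le> (\<integral>x. g x + r x \<partial>M)"
  proof (rule integral_mono_AE)
    show "AE x in M. norm (w x) \<le> g x + r x"
      using w(3) assms(3)
    proof eventually_elim
      fix x assume "norm (f x - w x) \<le> r x" "norm (f x) \<le> g x"
      then show "norm (w x) \<le> g x + r x"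
        using norm_triangle_sub[of "w x" "f x"] by (simp add: norm_minus_commute)
    qed
  qed (use assms w simple_norm_integrable(1)[OF w(1)] in auto)
  also have "(\<integral>x. g x + r x \<partial>M) = (\<integral>x. g x \<partial>M) + (\<integral>x. r x \<partial>M)"
    using assms w by simp
  finally show "norm I \<le> (\<integral>x. g x \<partial>M) + e" using w(4) by simp
qed

lemma has_vint_add:
  assumes "has_vint M f I" "has_vint M g J"
  shows "has_vint M (\<lambda>x. f x + g x) (I + J)"
  unfolding has_vint_def
proof (intro allI impI)
  fix e :: real assume "e > 0"
  then obtain w r where w: "Bochner_Integration.simple_bochner_integrable M w" "integrable M r"
     "AE x in M. norm (f x - w x) \<le> r x" "(\<integral>x. r x \<partial>M) \<le> e/2"
     "norm (Bochner_Integration.simple_bochner_integral M w - I) \<le> e/2"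
    using assms(1) unfolding has_vint_def by (meson half_gt_zero)
  from \<open>e > 0\<close> obtain w' r' where w': "Bochner_Integration.simple_bochner_integrable M w'" "integrable M r'"
     "AE x in M. norm (g x - w' x) \<le> r' x" "(\<integral>x. r' x \<partial>M) \<le> e/2"
     "norm (Bochner_Integration.simple_bochner_integral M w' - J) \<le> e/2"
    using assms(2) unfolding has_vint_def by (meson half_gt_zero)
  show "\<exists>w r. Bochner_Integration.simple_bochner_integrable M w \<and> integrable M r \<and>
     (AE x in M. norm (f x + g x - w x) \<le> r x) \<and> (\<integral>x. r x \<partial>M) \<le> e \<and>
     norm (Bochner_Integration.simple_bochner_integral M w - (I + J)) \<le> e"
  proof (intro exI conjI)
    show "Bochner_Integration.simple_bochner_integrable M (\<lambda>x. w x + w' x)"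
      using simple_bochner_integrable_compose2[where p="(+)", OF _ w(1) w'(1)] by simp
    show "integrable M (\<lambda>x. r x + r' x)" using w w' by simp
    show "AE x in M. norm (f x + g x - (w x + w' x)) \<le> r x + r' x"
      using w(3) w'(3)
      by eventually_elim (rule norm_diff_triangle_ineq[THEN order_trans], simp)
    show "(\<integral>x. r x + r' x \<partial>M) \<le> e" using w w' by simp
    have eq: "Bochner_Integration.simple_bochner_integral M (\<lambda>x. w x + w' x) - (I + J)
       = (Bochner_Integration.simple_bochner_integral M w - I) + (Bochner_Integration.simple_bochner_integral M w' - J)"
      by (simp add: simple_bochner_integral_add[OF w(1) w'(1)])
    show "norm (Bochner_Integration.simple_bochner_integral M (\<lambda>x. w x + w' x) - (I + J)) \<le> e"
      unfolding eq using norm_triangle_mono[OF w(5) w'(5)] by simp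
  qed
qed

lemma has_vint_linear:
  assumes L: "bounded_linear L" and f: "has_vint M f I"
  shows "has_vint M (\<lambda>x. L (f x)) (L I)"
proof -
  obtain K where K: "K > 0" "\<And>x. norm (L x) \<le> norm x * K"
    using bounded_linear.pos_bounded[OF L] by blast
  have lin: "linear L" using L by (simp add: bounded_linear.linear)
  show ?thesis
    unfolding has_vint_def
  proof (intro allI impI)
    fix e :: real assume "e > 0"
    with K have "e / K > 0" by simp
    then obtain w r where w: "Bochner_Integration.simple_bochner_integrable M w" "integrable M r"
       "AE x in M. norm (f x - w x) \<le> r x" "(\<integral>x. r x \<partial>M) \<le> e/K"
       "norm (Bochner_Integration.simple_bochner_integral M w - I) \<le> e/K"
      using f unfolding has_vint_def by meson
    have Ld: "L a - L b = L (a - b)" for a b using linear_diff[OF lin, of a b] by simp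
    show "\<exists>w r. Bochner_Integration.simple_bochner_integrable M w \<and> integrable M r \<and>
       (AE x in M. norm (L (f x) - w x) \<le> r x) \<and> (\<integral>x. r x \<partial>M) \<le> e \<and>
       norm (Bochner_Integration.simple_bochner_integral M w - L I) \<le> e"
    proof (intro exI conjI)
      show "Bochner_Integration.simple_bochner_integrable M (\<lambda>x. L (w x))"
        using simple_bochner_integrable_compose2[where p="\<lambda>a b. L a", OF _ w(1) w(1)] linear_0[OF lin] by simp
      show "integrable M (\<lambda>x. r x * K)" using w by simp
      show "AE x in M. norm (L (f x) - L (w x)) \<le> r x * K"
        using w(3)
      proof eventually_elim
        fix x assume "norm (f x - w x) \<le> r x"
        then show "norm (L (f x) - L (w x)) \<le> r x * K"
          unfolding Ld using K(2)[of "f x - w x"] K(1) mult_right_mono[of "norm (f x - w x)" "r x" K] by linarith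
      qed
      show "(\<integral>x. r x * K \<partial>M) \<le> e" using w(2,4) K(1) by (simp add: field_simps)
      have "Bochner_Integration.simple_bochner_integral M (\<lambda>x. L (w x)) - L I = L (Bochner_Integration.simple_bochner_integral M w - I)"
        by (simp add: simple_bochner_integral_linear[OF lin w(1)] Ld)
      then show "norm (Bochner_Integration.simple_bochner_integral M (\<lambda>x. L (w x)) - L I) \<le> e"
        using K(2)[of "Bochner_Integration.simple_bochner_integral M w - I"] w(5) K(1)
        by (smt (verit) mult_right_mono nonzero_eq_divide_eq)
    qed
  qed
qed

lemma has_vint_diff:
  assumes "has_vint M f I" "has_vint M g J"
  shows "has_vint M (\<lambda>x. f x - g x) (I - J)"
  using has_vint_add[OF assms(1) has_vint_linear[OF bounded_linear_minus[OF bounded_linear_ident] assms(2)]]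
  by simp

lemma has_vint_0: "has_vint M (\<lambda>x. 0) 0"
  unfolding has_vint_def
proof (intro allI impI exI conjI)
  fix e::real assume "e > 0"
  show "Bochner_Integration.simple_bochner_integrable M (\<lambda>x. 0)" by (rule simple_bochner_integrable.intros) auto
  show "integrable M (\<lambda>x. 0::real)" by simp
  show "norm (Bochner_Integration.simple_bochner_integral M (\<lambda>x. 0) - 0) \<le> e"
    using \<open>e > 0\<close> by (auto simp: simple_bochner_integral_def image_constant_conv)
qed (auto simp: less_imp_le)

lemma has_vint_sum:
  assumes "finite J" "\<And>j. j \<in> J \<Longrightarrow> has_vint M (f j) (I j)"
  shows "has_vint M (\<lambda>x. \<Sum>j\<in>J. f j x) (\<Sum>j\<in>J. I j)"
  using assms by (induction J rule: finite_induct) (auto intro: has_vint_0 has_vint_add)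

lemma has_vint_approx:
  assumes "has_vint M f I" "has_vint M g J" "integrable M r" "AE x in M. norm (f x - g x) \<le> r x"
  shows "norm (I - J) \<le> (\<integral>x. r x \<partial>M)"
  using has_vint_norm_le[OF has_vint_diff[OF assms(1,2)] assms(3,4)] .

lemma has_vint_unique:
  assumes "has_vint M f I" "has_vint M g J" "AE x in M. f x = g x"
  shows "I = J"
proof -
  have "norm (I - J) \<le> (\<integral>x. 0 \<partial>M)"
    by (rule has_vint_approx[OF assms(1,2)]) (use assms(3) in auto)
  then show ?thesis by simp
qed

lemma has_vint_cong_AE:
  assumes "AE x in M. f x = g x" "has_vint M f I"
  shows "has_vint M g I"
  unfolding has_vint_def
proof (intro allI impI)
  fix e :: real assume "e > 0"
  then obtain w r where w: "Bochner_Integration.simple_bochner_integrable M w" "integrable M r"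
     "AE x in M. norm (f x - w x) \<le> r x" "(\<integral>x. r x \<partial>M) \<le> e"
     "norm (Bochner_Integration.simple_bochner_integral M w - I) \<le> e"
    using assms(2) unfolding has_vint_def by meson
  moreover have "AE x in M. norm (g x - w x) \<le> r x"
    using w(3) assms(1) by eventually_elim simp
  ultimately show "\<exists>w r. Bochner_Integration.simple_bochner_integrable M w \<and> integrable M r \<and>
     (AE x in M. norm (g x - w x) \<le> r x) \<and> (\<integral>x. r x \<partial>M) \<le> e \<and>
     norm (Bochner_Integration.simple_bochner_integral M w - I) \<le> e"
    by blast
qed

text \<open>For real values the Bochner integral already supplies simple functions converging in
  mean, and \<open>norm (f x - w x)\<close> is itself an integrable majorant.\<close>

lemma has_vint_real:
  fixes f :: "'g \<Rightarrow> real"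
  assumes "integrable M f"
  shows "has_vint M f (\<integral>x. f x \<partial>M)"
  unfolding has_vint_def
proof (intro allI impI)
  fix e :: real assume "e > 0"
  have hb: "has_bochner_integral M f (\<integral>x. f x \<partial>M)"
    using assms by (rule has_bochner_integral_integrable)
  then obtain w where w: "\<And>i. Bochner_Integration.simple_bochner_integrable M (w i)"
    "(\<lambda>i. \<integral>\<^sup>+x. norm (f x - w i x) \<partial>M) \<longlonglongrightarrow> 0"
    by (cases rule: has_bochner_integral.cases) blast
  have "\<forall>\<^sub>F i in sequentially. (\<integral>\<^sup>+x. norm (f x - w i x) \<partial>M) < ennreal e"
    using order_tendstoD(2)[OF w(2), of "ennreal e"] \<open>e > 0\<close> by simp
  then obtain i where i: "(\<integral>\<^sup>+x. norm (f x - w i x) \<partial>M) < ennreal e"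
    using eventually_happens trivial_limit_sequentially by blast
  have wi: "integrable M (w i)"
    using has_bochner_integral_simple_bochner_integrable[OF w(1)] by (rule integrable.intros)
  have r: "integrable M (\<lambda>x. norm (f x - w i x))" using assms wi by simp
  have "ennreal (\<integral>x. norm (f x - w i x) \<partial>M) < ennreal e"
    using i by (subst nn_integral_eq_integral[OF r, symmetric]) auto
  then have le: "(\<integral>x. norm (f x - w i x) \<partial>M) \<le> e"
    using \<open>e > 0\<close> by (metis ennreal_less_iff integral_nonneg_AE norm_ge_zero AE_I2 less_imp_le)
  have "norm (Bochner_Integration.simple_bochner_integral M (w i) - (\<integral>x. f x \<partial>M)) = norm (\<integral>x. f x - w i x \<partial>M)"
    using assms wi by (simp add: simple_bochner_integrable_eq_integral[OF w(1)] abs_minus_commute)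
  also have "\<dots> \<le> (\<integral>x. norm (f x - w i x) \<partial>M)" by (rule integral_norm_bound)
  finally have le2: "norm (Bochner_Integration.simple_bochner_integral M (w i) - (\<integral>x. f x \<partial>M)) \<le> e" using le by simp
  show "\<exists>w r. Bochner_Integration.simple_bochner_integrable M w \<and> integrable M r \<and>
     (AE x in M. norm (f x - w x) \<le> r x) \<and> (\<integral>x. r x \<partial>M) \<le> e \<and>
     norm (Bochner_Integration.simple_bochner_integral M w - (\<integral>x. f x \<partial>M)) \<le> e"
    by (intro exI[of _ "w i"] exI[of _ "\<lambda>x. norm (f x - w i x)"]) (use w(1) r le le2 in auto)
qed

lemma has_vint_scaleR_const:
  fixes f :: "'g \<Rightarrow> real"
  assumes "integrable M f"
  shows "has_vint M (\<lambda>x. f x *\<^sub>R v) ((\<integral>x. f x \<partial>M) *\<^sub>R v)"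
  using has_vint_linear[OF bounded_linear_scaleR_left has_vint_real[OF assms]] .

text \<open>Completeness of the target space enters here: with approximation errors
  \<open>1 / 2 ^ n\<close> the integrals of the approximants form a Cauchy sequence, whose limit is
  the integral of \<open>f\<close>.\<close>

lemma has_vint_limit:
  fixes f :: "'g \<Rightarrow> 'b::banach"
  assumes "\<And>e. e > 0 \<Longrightarrow> \<exists>h I r. has_vint M h I \<and> integrable M r \<and>
       (AE x in M. norm (f x - h x) \<le> r x) \<and> (\<integral>x. r x \<partial>M) \<le> (e::real)"
  shows "\<exists>I. has_vint M f I"
proof -
  have "\<forall>n. \<exists>h I r. has_vint M h I \<and> integrable M r \<and>
       (AE x in M. norm (f x - h x) \<le> r x) \<and> (\<integral>x. r x \<partial>M) \<le> 1 / 2 ^ n"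
    using assms[of "1/2^n" for n] by simp
  then obtain h I r where h: "\<And>n. has_vint M (h n) (I n)" "\<And>n. integrable M (r n)"
      "\<And>n. AE x in M. norm (f x - h n x) \<le> r n x" "\<And>n::nat. (\<integral>x. r n x \<partial>M) \<le> 1 / 2 ^ n"
    by metis
  have d: "norm (I k - I n) \<le> 1 / 2 ^ k + 1 / 2 ^ n" for k n
  proof -
    have "norm (I k - I n) \<le> (\<integral>x. r k x + r n x \<partial>M)"
    proof (rule has_vint_approx[OF h(1) h(1)])
      show "AE x in M. norm (h k x - h n x) \<le> r k x + r n x"
        using h(3)[of k] h(3)[of n]
      proof eventually_elim
        fix x assume "norm (f x - h k x) \<le> r k x" "norm (f x - h n x) \<le> r n x"
        then show "norm (h k x - h n x) \<le> r k x + r n x"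
          using norm_triangle_ineq4[of "f x - h n x" "f x - h k x"] by simp
      qed
    qed (use h(2) in auto)
    also have "\<dots> = (\<integral>x. r k x \<partial>M) + (\<integral>x. r n x \<partial>M)"
      using h(2) by simp
    finally show ?thesis using h(4)[of k] h(4)[of n] by linarith
  qed
  have half: "(\<lambda>n. 1 / 2 ^ n :: real) \<longlonglongrightarrow> 0"
    using LIMSEQ_realpow_zero[of "1/2"] by (simp add: power_divide)
  have "Cauchy I"
    unfolding Cauchy_def
  proof (intro allI impI)
    fix e :: real assume "e > 0"
    then obtain N where N: "1 / 2 ^ N < e/2"
      using order_tendstoD(2)[OF half, of "e/2"] by (auto simp: eventually_sequentially)
    show "\<exists>N. \<forall>k\<ge>N. \<forall>n\<ge>N. dist (I k) (I n) < e"
    proof (intro exI[of _ N] allI impI)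
      fix k n assume "k \<ge> N" "n \<ge> N"
      then have "1 / 2 ^ k \<le> (1 / 2 ^ N :: real)" "1 / 2 ^ n \<le> (1 / 2 ^ N :: real)"
        by (auto intro!: divide_left_mono)
      then show "dist (I k) (I n) < e" unfolding dist_norm using d[of k n] N by linarith
    qed
  qed
  then obtain J where J: "I \<longlonglongrightarrow> J" using Cauchy_convergent convergent_def by blast
  have "has_vint M f J"
    unfolding has_vint_def
  proof (intro allI impI)
    fix e :: real assume "e > 0"
    have "\<forall>\<^sub>F n in sequentially. norm (I n - J) < e/2 \<and> 1 / 2 ^ n < e/2"
      using tendstoD[OF J, of "e/2"] order_tendstoD(2)[OF half, of "e/2"] \<open>e > 0\<close>
      by (auto simp: dist_norm eventually_conj_iff)
    then obtain n where n: "norm (I n - J) < e/2" "1 / 2 ^ n < e/2"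
      using eventually_happens trivial_limit_sequentially by blast
    from h(1)[of n] \<open>e > 0\<close> obtain w q where w: "Bochner_Integration.simple_bochner_integrable M w" "integrable M q"
       "AE x in M. norm (h n x - w x) \<le> q x" "(\<integral>x. q x \<partial>M) \<le> e/2"
       "norm (Bochner_Integration.simple_bochner_integral M w - I n) \<le> e/2"
      unfolding has_vint_def by (meson half_gt_zero)
    show "\<exists>w r. Bochner_Integration.simple_bochner_integrable M w \<and> integrable M r \<and>
     (AE x in M. norm (f x - w x) \<le> r x) \<and> (\<integral>x. r x \<partial>M) \<le> e \<and>
     norm (Bochner_Integration.simple_bochner_integral M w - J) \<le> e"
    proof (intro exI conjI)
      show "Bochner_Integration.simple_bochner_integrable M w" by fact
      show "integrable M (\<lambda>x. r n x + q x)" using h w by simp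
      show "AE x in M. norm (f x - w x) \<le> r n x + q x"
        using w(3) h(3)[of n]
      proof eventually_elim
        fix x assume "norm (h n x - w x) \<le> q x" "norm (f x - h n x) \<le> r n x"
        then show "norm (f x - w x) \<le> r n x + q x"
          using norm_triangle_ineq[of "f x - h n x" "h n x - w x"] by simp
      qed
      show "(\<integral>x. r n x + q x \<partial>M) \<le> e" using h(2,4)[of n] w(2,4) n(2) by simp
      show "norm (Bochner_Integration.simple_bochner_integral M w - J) \<le> e"
        using w(5) n(1) norm_triangle_ineq[of "Bochner_Integration.simple_bochner_integral M w - I n" "I n - J"] by simp
    qed
  qed
  then show ?thesis ..
qed

text \<open>Justified by \<open>has_vint_unique\<close>; the value is unspecified when no integral
  exists.\<close>

definition vint :: "'g measure \<Rightarrow> ('g \<Rightarrow> 'b::real_normed_vector) \<Rightarrow> 'b" where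
  "vint M f = (THE I. has_vint M f I)"

lemma vint_eqI: "has_vint M f I \<Longrightarrow> vint M f = I"
  unfolding vint_def by (rule the_equality) (auto intro: has_vint_unique)

section \<open>Haar systems on locally compact groupoids\<close>

locale lc_groupoid =
  fixes s t :: "'g::t2_space \<Rightarrow> 'x::topological_space"
    and u :: "'x \<Rightarrow> 'g" and m :: "'g \<Rightarrow> 'g \<Rightarrow> 'g" and i :: "'g \<Rightarrow> 'g"
    and \<mu> :: "'x \<Rightarrow> 'g measure"
  assumes lcg: "locally_compact_groupoid s t u m i \<mu>"
begin

lemma gpd: "groupoid s t u m i" and tgpd: "topological_groupoid s t u m i"
  and haar: "left_haar_system s t m \<mu>" and lcs: "locally_compact_space (euclidean :: 'g topology)"
  using lcg unfolding locally_compact_groupoid_def topological_groupoid_def by auto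

lemma s_u [simp]: "s (u y) = y" and t_u [simp]: "t (u y) = y"
  and s_m [simp]: "s g = t h \<Longrightarrow> s (m g h) = s h" and t_m [simp]: "s g = t h \<Longrightarrow> t (m g h) = t g"
  and m_assoc: "s g = t h \<Longrightarrow> s h = t k \<Longrightarrow> m (m g h) k = m g (m h k)"
  and m_u_right [simp]: "m g (u (s g)) = g" and m_u_left [simp]: "m (u (t g)) g = g"
  and s_i [simp]: "s (i g) = t g" and t_i [simp]: "t (i g) = s g"
  and m_i_right [simp]: "m g (i g) = u (t g)" and m_i_left [simp]: "m (i g) g = u (s g)"
  using gpd unfolding groupoid_def by blast+

section \<open>Continuity of the structure maps and separation of the object space\<close>

lemma continuous_s [continuous_intros]: "continuous_on A f \<Longrightarrow> continuous_on A (\<lambda>z. s (f z))"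
  and continuous_t [continuous_intros]: "continuous_on A f \<Longrightarrow> continuous_on A (\<lambda>z. t (f z))"
  and continuous_i [continuous_intros]: "continuous_on A f \<Longrightarrow> continuous_on A (\<lambda>z. i (f z))"
  using tgpd unfolding topological_groupoid_def
  by (auto intro: continuous_on_compose2[where t=UNIV])

lemma continuous_u [continuous_intros]: "continuous_on A f \<Longrightarrow> continuous_on A (\<lambda>z. u (f z))"
  using tgpd unfolding topological_groupoid_def
  by (auto intro: continuous_on_compose2[where t=UNIV])

lemma continuous_m [continuous_intros]:
  assumes "continuous_on A f" "continuous_on A h" "\<And>z. z \<in> A \<Longrightarrow> s (f z) = t (h z)"
  shows "continuous_on A (\<lambda>z. m (f z) (h z))"
proof -
  have "continuous_on (composable s t) (\<lambda>(g, h). m g h)"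
    using tgpd unfolding topological_groupoid_def by auto
  from continuous_on_compose2[OF this continuous_on_Pair[OF assms(1,2)]]
  show ?thesis using assms(3) by (auto simp: composable_def)
qed

lemma open_vimage_s: "open U \<Longrightarrow> open (s -` U)" and open_vimage_t: "open U \<Longrightarrow> open (t -` U)"
  and open_vimage_u: "open V \<Longrightarrow> open (u -` V)"
  using continuous_s[OF continuous_on_id[of UNIV]] continuous_t[OF continuous_on_id[of UNIV]]
    continuous_u[OF continuous_on_id[of UNIV]]
  by (auto simp: continuous_on_open_vimage[OF open_UNIV])

text \<open>The identity \<open>s (u y) = y\<close> makes the unit map injective, so the object
  space inherits the Hausdorff property from the arrow space although its type carries only a
  topology.\<close>

lemma separation_X:
  fixes y z :: 'x
  assumes "y \<noteq> z" obtains U V where "open U" "open V" "y \<in> U" "z \<in> V" "U \<inter> V = {}"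
proof -
  have "u y \<noteq> u z" using assms by (metis s_u)
  then obtain U V where "open U" "open V" "u y \<in> U" "u z \<in> V" "U \<inter> V = {}"
    by (meson hausdorff)
  then show thesis by (intro that[of "u -` U" "u -` V"]) (auto intro: open_vimage_u)
qed

text \<open>Equality of objects is tested after applying the injective unit map, in the Hausdorff
  arrow space.\<close>

lemma closed_equalizer:
  fixes a b :: "'z::topological_space \<Rightarrow> 'x"
  assumes "continuous_on UNIV a" "continuous_on UNIV b"
  shows "closed {z. a z = b z}"
proof -
  have "{z. a z = b z} = {z. u (a z) = u (b z)}" by (metis s_u)
  then show ?thesis using assms by (auto intro!: closed_Collect_eq continuous_intros)
qed

lemma closed_fiber: "closed (t -` {y})"
  using closed_equalizer[of t "\<lambda>_. y"] continuous_t[OF continuous_on_id] by (simp add: vimage_def)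

lemma compact_nhd: obtains U K where "open U" "compact K" "g \<in> U" "U \<subseteq> (K :: 'g set)"
  using lcs unfolding locally_compact_space_def
  by (metis UNIV_I compactin_euclidean_iff open_openin topspace_euclidean)

section \<open>Compactly supported functions, bumps and partitions of unity\<close>

lemma Cc_compact: "\<phi> \<in> Cc \<Longrightarrow> compact (closure {g. \<phi> g \<noteq> 0})"
  and Cc_continuous: "\<phi> \<in> Cc \<Longrightarrow> continuous_on UNIV \<phi>"
  by (auto simp: Cc_def)

lemma CcI:
  fixes \<phi> :: "'g \<Rightarrow> real"
  assumes "continuous_on UNIV \<phi>" "compact K" "\<And>g. \<phi> g \<noteq> 0 \<Longrightarrow> g \<in> K"
  shows "\<phi> \<in> Cc"
proof -
  have "closure {g. \<phi> g \<noteq> 0} \<subseteq> K"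
    using assms by (intro closure_minimal compact_imp_closed) auto
  then have "closure {g. \<phi> g \<noteq> 0} = K \<inter> closure {g. \<phi> g \<noteq> 0}" by auto
  then show ?thesis
    using compact_Int_closed[OF assms(2) closed_closure[of "{g. \<phi> g \<noteq> 0}"]] assms(1)
    by (simp add: Cc_def)
qed

lemma Cc_mult: 
  fixes \<phi> :: "'g \<Rightarrow> real" 
  assumes "\<phi> \<in> Cc" "continuous_on UNIV f" shows "(\<lambda>g. f g * \<phi> g) \<in> Cc"
proof (rule CcI[OF _ Cc_compact[OF assms(1)]])
  show "continuous_on UNIV (\<lambda>g. f g * \<phi> g)"
    by (intro continuous_intros Cc_continuous assms)
  show "g \<in> closure {g. \<phi> g \<noteq> 0}" if "f g * \<phi> g \<noteq> 0" for g
    using that closure_subset[of "{g. \<phi> g \<noteq> 0}"] by auto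
qed

text \<open>Locally compact Hausdorff spaces are completely regular; cutting \<open>U\<close> down
  by a relatively compact neighbourhood \<open>W\<close> forces compact support. Truncation of
  \<open>1 - f\<close> at zero gives nonnegativity, but no upper bound is recorded.\<close>

lemma bump:
  assumes "open U" "g \<in> U"
  obtains \<psi> where "\<psi> \<in> Cc" "\<And>h. 0 \<le> \<psi> h" "\<psi> g = 1" "\<And>h::'g. h \<notin> U \<Longrightarrow> \<psi> h = (0::real)"
proof -
  obtain W K where W: "open W" "compact K" "g \<in> W" "W \<subseteq> K" using compact_nhd .
  have "Hausdorff_space (euclidean :: 'g topology)"
    unfolding Hausdorff_space_def disjnt_def using hausdorff by auto
  then have "completely_regular_space (euclidean :: 'g topology)"
    using locally_compact_regular_imp_completely_regular_space[OF lcs] by blast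
  then obtain f where f: "continuous_map euclidean euclideanreal f" "f g = 0" "f ` (- (U \<inter> W)) \<subseteq> {1}"
    unfolding completely_regular_space_alt' using W assms
    by (metis Compl_eq_Diff_UNIV IntI open_Int open_openin topspace_euclidean)
  have fc: "continuous_on UNIV f" using f(1) by simp
  have 0: "h \<notin> U \<inter> W \<Longrightarrow> f h = 1" for h using f(3) by blast
  show thesis
  proof
    show "(\<lambda>h. max 0 (1 - f h)) \<in> Cc"
    proof (rule CcI[OF _ W(2)])
      show "continuous_on UNIV (\<lambda>h. max 0 (1 - f h))" by (intro continuous_intros fc)
      show "h \<in> K" if "max 0 (1 - f h) \<noteq> 0" for h
        using that 0[of h] W(4) by (cases "h \<in> U \<inter> W") auto
    qed
  qed (use f 0 in auto)
qed

lemma partition_of_unity: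
  assumes "compact K" "\<And>k. k \<in> K \<Longrightarrow> open (U k) \<and> k \<in> U k"
  obtains J :: "'g set" and \<phi> :: "'g \<Rightarrow> 'g \<Rightarrow> real" where "finite J" "J \<subseteq> K" "\<And>j. \<phi> j \<in> Cc" "\<And>j h. 0 \<le> \<phi> j h"
    "\<And>j h. j \<in> J \<Longrightarrow> h \<notin> U j \<Longrightarrow> \<phi> j h = 0" "\<And>h. (\<Sum>j\<in>J. \<phi> j h) \<le> 1"
    "\<And>h. h \<in> K \<Longrightarrow> (\<Sum>j\<in>J. \<phi> j h) = 1"
proof -
  have "\<forall>k. \<exists>\<psi>. k \<in> K \<longrightarrow> \<psi> \<in> Cc \<and> (\<forall>h. 0 \<le> \<psi> h) \<and> \<psi> k = (1::real) \<and> (\<forall>h. h \<notin> U k \<longrightarrow> \<psi> h = 0)"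
    using assms(2) bump by metis
  then obtain \<psi> where \<psi>: "\<And>k. k \<in> K \<Longrightarrow> \<psi> k \<in> Cc" "\<And>k h. k \<in> K \<Longrightarrow> 0 \<le> \<psi> k h"
    "\<And>k. k \<in> K \<Longrightarrow> \<psi> k k = (1::real)" "\<And>k h. k \<in> K \<Longrightarrow> h \<notin> U k \<Longrightarrow> \<psi> k h = 0"
    by metis
  have op: "open {h. \<psi> k h > 1/2}" if "k \<in> K" for k
    using Cc_continuous[OF \<psi>(1)[OF that]] by (intro open_Collect_less continuous_intros)
  obtain J where J: "J \<subseteq> K" "finite J" "K \<subseteq> (\<Union>k\<in>J. {h. \<psi> k h > 1/2})"
    using compactE_image[OF assms(1), of K "\<lambda>k. {h. \<psi> k h > 1/2}"] op \<psi>(3) by force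
  \<comment> \<open>The factor 2 makes \<open>S > 1\<close> on \<open>K\<close>, where some
    \<open>\<psi> j\<close> exceeds 1/2. Dividing by \<open>max 1 (S h)\<close> instead of
    \<open>S h\<close> keeps the quotients continuous where \<open>S\<close> vanishes, with total at
    most 1 everywhere and exactly 1 on \<open>K\<close>.\<close>
  define S where "S h = (\<Sum>j\<in>J. 2 * \<psi> j h)" for h
  define \<phi> where "\<phi> j h = (if j \<in> J then 2 * \<psi> j h / max 1 (S h) else 0)" for j h
  have Sc: "continuous_on UNIV S" unfolding S_def using J Cc_continuous \<psi>(1)
    by (intro continuous_intros) auto
  have sum: "(\<Sum>j\<in>J. \<phi> j h) = S h / max 1 (S h)" for h
    by (simp add: \<phi>_def S_def sum_divide_distrib)
  show thesis
  proof
    show "finite J" "J \<subseteq> K" by fact+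
    show "\<phi> j \<in> Cc" for j
    proof (cases "j \<in> J")
      case True
      have "(\<lambda>h. (2 / max 1 (S h)) * \<psi> j h) \<in> Cc"
        by (rule Cc_mult) (use \<psi>(1) True J in \<open>auto intro!: continuous_intros Sc\<close>)
      then show ?thesis using True by (simp add: \<phi>_def[abs_def])
    next
      case False
      then show ?thesis by (auto simp: \<phi>_def[abs_def] Cc_def)
    qed
    show "0 \<le> \<phi> j h" for j h using \<psi>(2) J by (auto simp: \<phi>_def)
    show "\<phi> j h = 0" if "j \<in> J" "h \<notin> U j" for j h using \<psi>(4) that J by (auto simp: \<phi>_def)
    show "(\<Sum>j\<in>J. \<phi> j h) \<le> 1" for h unfolding sum by (simp add: divide_le_eq)
    show "(\<Sum>j\<in>J. \<phi> j h) = 1" if hK: "h \<in> K" for h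
    proof -
      obtain j where j: "j \<in> J" "\<psi> j h > 1/2" using J(3) hK by blast
      have "2 * \<psi> j h \<le> S h" unfolding S_def
        using J j \<psi>(2) by (intro member_le_sum) auto
      then show ?thesis unfolding sum using j by simp
    qed
  qed
qed

lemma Cc_sum:
  fixes \<phi> :: "'j \<Rightarrow> 'g \<Rightarrow> real"
  assumes "finite J" "\<And>j. j \<in> J \<Longrightarrow> \<phi> j \<in> Cc" shows "(\<lambda>h. \<Sum>j\<in>J. \<phi> j h) \<in> Cc"
proof (rule CcI)
  show "continuous_on UNIV (\<lambda>h. \<Sum>j\<in>J. \<phi> j h)"
    using assms(2) by (intro continuous_on_sum Cc_continuous)
  show "compact (\<Union>j\<in>J. closure {g. \<phi> j g \<noteq> 0})"
    using assms by (intro compact_UN Cc_compact) auto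
  show "g \<in> (\<Union>j\<in>J. closure {g. \<phi> j g \<noteq> 0})" if "(\<Sum>j\<in>J. \<phi> j g) \<noteq> 0" for g
  proof -
    obtain j where "j \<in> J" "\<phi> j g \<noteq> 0" using sum.not_neutral_contains_not_neutral[OF \<open>_ \<noteq> 0\<close>] .
    then show ?thesis using closure_subset[of "{g. \<phi> j g \<noteq> 0}"] by blast
  qed
qed

lemma plateau:
  assumes "compact K"
  obtains \<eta> where "\<eta> \<in> Cc" "\<And>h. 0 \<le> \<eta> h" "\<And>h. h \<in> K \<Longrightarrow> \<eta> h = 1" "\<And>h::'g. \<eta> h \<le> (1::real)"
proof -
  obtain J and \<phi> :: "'g \<Rightarrow> 'g \<Rightarrow> real" where "finite J" "\<And>j. \<phi> j \<in> Cc" "\<And>j h. 0 \<le> \<phi> j h"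
    "\<And>h. (\<Sum>j\<in>J. \<phi> j h) \<le> 1" "\<And>h. h \<in> K \<Longrightarrow> (\<Sum>j\<in>J. \<phi> j h) = 1"
    using partition_of_unity[OF assms, of "\<lambda>_. UNIV"] by (metis UNIV_I open_UNIV)
  then show thesis by (intro that[of "\<lambda>h. \<Sum>j\<in>J. \<phi> j h"]) (auto intro: Cc_sum sum_nonneg)
qed

section \<open>Fibre measures, positivity, and openness of target and source\<close>

lemma radon: "radon_measure (\<mu> y)" and supp: "measure_support (\<mu> y) = t -` {y}"
  and sets_mu [simp]: "sets (\<mu> y) = sets borel"
  and haar_inv: "\<phi> \<in> Cc \<Longrightarrow> (\<integral>h. \<phi> (m g h) \<partial>\<mu> (s g)) = (\<integral>h. \<phi> h \<partial>\<mu> (t g))"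
  and haar_cont: "\<phi> \<in> Cc \<Longrightarrow> continuous_on UNIV (\<lambda>x. \<integral>h. \<phi> h \<partial>\<mu> x)"
proof -
  note h = haar[unfolded left_haar_system_def]
  note h1 = h[THEN conjunct1, rule_format, of y]
  show r: "radon_measure (\<mu> y)" using h1 by simp
  show "sets (\<mu> y) = sets borel" using r[unfolded radon_measure_def, THEN conjunct1] .
  show "measure_support (\<mu> y) = t -` {y}" using h1 by simp
  show "\<phi> \<in> Cc \<Longrightarrow> (\<integral>h. \<phi> (m g h) \<partial>\<mu> (s g)) = (\<integral>h. \<phi> h \<partial>\<mu> (t g))"
    using h[THEN conjunct2, THEN conjunct1] by simp
  show "\<phi> \<in> Cc \<Longrightarrow> continuous_on UNIV (\<lambda>x. \<integral>h. \<phi> h \<partial>\<mu> x)"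
    using h[THEN conjunct2, THEN conjunct2] by simp
qed

lemma compact_finite: "compact K \<Longrightarrow> emeasure (\<mu> y) K < \<infinity>"
  using radon[of y, unfolded radon_measure_def, THEN conjunct2, THEN conjunct1] by simp

lemma inner_regular: "open U \<Longrightarrow> emeasure (\<mu> y) U = (SUP K \<in> {K. compact K \<and> K \<subseteq> U}. emeasure (\<mu> y) K)"
  using radon[of y, unfolded radon_measure_def, THEN conjunct2, THEN conjunct2, THEN conjunct2] by simp

text \<open>Each point off the support has a null neighbourhood, but an uncountable union of these
  need not be null. Compact subsets of the complement are covered by finitely many, and inner
  regularity passes from compact sets to the open complement.\<close>

lemma AE_fiber: "AE k in \<mu> y. t k = y"
proof -
  define U where "U = - (t -` {y})"
  have U: "open U" unfolding U_def using closed_fiber by (simp add: open_Compl)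
  have "emeasure (\<mu> y) K = 0" if K: "compact K" "K \<subseteq> U" for K
  proof -
    have "\<forall>g\<in>K. \<exists>V. open V \<and> g \<in> V \<and> emeasure (\<mu> y) V = 0"
      using K supp[of y] unfolding U_def measure_support_def by blast
    then obtain V where V: "\<And>g. g \<in> K \<Longrightarrow> open (V g) \<and> g \<in> V g \<and> emeasure (\<mu> y) (V g) = 0" by metis
    obtain J where J: "J \<subseteq> K" "finite J" "K \<subseteq> (\<Union>g\<in>J. V g)"
      using compactE_image[OF K(1), of K V] V by blast
    have "(\<Union>g\<in>J. V g) \<in> null_sets (\<mu> y)"
      using J V by (intro null_sets.finite_UN) (auto simp: null_sets_def)
    then show ?thesis using J(3)
      by (metis emeasure_mono le_zero_eq null_setsD1 null_setsD2)
  qed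
  then have "(SUP K \<in> {K. compact K \<and> K \<subseteq> U}. emeasure (\<mu> y) K) \<le> 0"
    by (intro SUP_least) simp
  then have "emeasure (\<mu> y) U = 0" unfolding inner_regular[OF U, symmetric] by simp
  then have "U \<in> null_sets (\<mu> y)" using U by (auto simp: null_sets_def)
  then have "AE k in \<mu> y. k \<notin> U" by (rule AE_not_in)
  then show ?thesis by (simp add: U_def)
qed

text \<open>The functions to be integrated are often continuous on one fibre only; extension by zero
  off a closed set makes them Borel, and a compact set of finite measure carries them.\<close>

lemma fiber_integrable:
  fixes f :: "'g \<Rightarrow> real"
  assumes A: "closed A" and C: "compact C" and f: "continuous_on A f" "\<And>k. k \<in> A - C \<Longrightarrow> f k = 0"
  shows "integrable (\<mu> y) (\<lambda>k. indicator A k * f k)"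
proof -
  have "compact (f ` (C \<inter> A))"
    using A C by (intro compact_continuous_image continuous_on_subset[OF f(1)]) auto
  then obtain B where B: "\<And>k. k \<in> C \<inter> A \<Longrightarrow> norm (f k) \<le> B"
    using compact_imp_bounded[of "f ` (C \<inter> A)"] by (auto simp: bounded_iff)
  have fin: "emeasure (\<mu> y) C < \<infinity>" using compact_finite[OF C] .
  have meas: "(\<lambda>k. indicator A k *\<^sub>R f k) \<in> borel_measurable borel"
    using A f(1) by (intro borel_measurable_continuous_on_indicator) auto
  show ?thesis
  proof (rule integrableI_bounded_set)
    show "(\<lambda>k. indicator A k * f k) \<in> borel_measurable (\<mu> y)"
      using meas by (subst measurable_cong_sets[OF sets_mu refl]) simp
    show "C \<in> sets (\<mu> y)" using C by (simp add: borel_compact)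
    show "AE k in \<mu> y. k \<in> C \<longrightarrow> norm (indicator A k * f k) \<le> max 0 B"
    proof (intro AE_I2 impI)
      fix k assume "k \<in> C"
      then show "norm (indicator A k * f k) \<le> max 0 B"
        using B[of k] by (cases "k \<in> A") auto
    qed
    show "AE k in \<mu> y. k \<notin> C \<longrightarrow> indicator A k * f k = 0"
    proof (intro AE_I2 impI)
      fix k assume "k \<notin> C"
      then show "indicator A k * f k = 0"
        using f(2)[of k] by (cases "k \<in> A") auto
    qed
  qed (use fin in simp)
qed

lemma Cc_integrable:
  assumes "\<phi> \<in> Cc" shows "integrable (\<mu> y) \<phi>"
proof -
  have "integrable (\<mu> y) (\<lambda>k. indicator UNIV k * \<phi> k)"
  proof (rule fiber_integrable[OF closed_UNIV Cc_compact[OF assms] Cc_continuous[OF assms]])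
    show "\<phi> k = 0" if "k \<in> UNIV - closure {g. \<phi> g \<noteq> 0}" for k
      using that closure_subset[of "{g. \<phi> g \<noteq> 0}"] by blast
  qed
  then show ?thesis by simp
qed

text \<open>The fibre measure has full support on the fibre through \<open>g\<close>, so the open
  set where \<open>\<phi>\<close> exceeds half of \<open>\<phi> g\<close> is not null.\<close>

lemma haar_pos:
  assumes "\<phi> \<in> Cc" "\<And>h. 0 \<le> \<phi> h" "\<phi> g > 0"
  shows "(\<integral>h. \<phi> h \<partial>\<mu> (t g)) > 0"
proof -
  let ?U = "{h. \<phi> h > \<phi> g / 2}"
  have U: "open ?U" using Cc_continuous[OF assms(1)] by (intro open_Collect_less continuous_intros)
  have "g \<in> measure_support (\<mu> (t g))" unfolding supp by simp
  then have "emeasure (\<mu> (t g)) ?U \<noteq> 0"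
    using U assms(3) unfolding measure_support_def by auto
  moreover have "?U \<in> null_sets (\<mu> (t g))" if "AE h in \<mu> (t g). \<phi> h = 0"
  proof (rule AE_iff_null_sets[THEN iffD2])
    show "?U \<in> sets (\<mu> (t g))" using U by simp
    show "AE h in \<mu> (t g). h \<notin> ?U" using that by eventually_elim (use assms(3) in simp)
  qed
  ultimately have "\<not> (AE h in \<mu> (t g). \<phi> h = 0)" by (auto simp: null_sets_def)
  then have "(\<integral>h. \<phi> h \<partial>\<mu> (t g)) \<noteq> 0"
    using integral_nonneg_eq_0_iff_AE[OF Cc_integrable[OF assms(1), of "t g"]] assms(2) by simp
  moreover have "(\<integral>h. \<phi> h \<partial>\<mu> (t g)) \<ge> 0" using assms(2) by simp
  ultimately show ?thesis by linarith
qed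

text \<open>For a bump at \<open>g\<close> supported in \<open>U\<close>, its fibre integral depends
  continuously on the base point, is positive at \<open>t g\<close>, and vanishes at every base
  point whose fibre misses \<open>U\<close>. Positivity thus cuts out a neighbourhood of
  \<open>t g\<close> inside the image.\<close>

lemma open_map_t:
  assumes "open U" shows "open (t ` U)"
proof (subst open_subopen, safe)
  fix g assume g: "g \<in> U"
  obtain \<psi> where \<psi>: "\<psi> \<in> Cc" "\<And>h. 0 \<le> \<psi> h" "\<psi> g = 1" "\<And>h. h \<notin> U \<Longrightarrow> \<psi> h = (0::real)"
    using bump[OF assms g] by blast
  have "open {y. (\<integral>h. \<psi> h \<partial>\<mu> y) > 0}"
    using haar_cont[OF \<psi>(1)] by (intro open_Collect_less continuous_intros)
  moreover have "t g \<in> {y. (\<integral>h. \<psi> h \<partial>\<mu> y) > 0}" using haar_pos[OF \<psi>(1,2), of g] \<psi>(3) by simp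
  moreover have "{y. (\<integral>h. \<psi> h \<partial>\<mu> y) > 0} \<subseteq> t ` U"
  proof (safe, rule ccontr)
    fix y assume y: "(\<integral>h. \<psi> h \<partial>\<mu> y) > 0" "y \<notin> t ` U"
    have "AE h in \<mu> y. \<psi> h = 0" using AE_fiber[of y] by eventually_elim (use y \<psi>(4) in blast)
    then have "(\<integral>h. \<psi> h \<partial>\<mu> y) = (\<integral>h. 0 \<partial>\<mu> y)"
      using Cc_integrable[OF \<psi>(1), of y] by (intro integral_cong_AE) auto
    then show False using y by simp
  qed
  ultimately show "\<exists>T. open T \<and> t g \<in> T \<and> T \<subseteq> t ` U" by blast
qed

text \<open>Inversion is a homeomorphism exchanging source and target.\<close>

lemma open_map_s: assumes "open U" shows "open (s ` U)"
proof -
  have ii: "i (i g) = g" for g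
    by (metis m_assoc m_i_left m_u_left m_u_right s_i t_i m_i_right)
  have "open (i -` U)" using assms continuous_i[OF continuous_on_id[of UNIV]]
    by (auto simp: continuous_on_open_vimage[OF open_UNIV])
  then have "open (t ` (i -` U))" by (rule open_map_t)
  moreover have "t ` (i -` U) = s ` U"
  proof safe
    show "t g \<in> s ` U" if "i g \<in> U" for g using that by (metis s_i image_eqI)
    show "s g \<in> t ` (i -` U)" if "g \<in> U" for g
      using that by (intro image_eqI[of _ _ "i g"]) (auto simp: ii)
  qed
  ultimately show ?thesis by simp
qed

end

section \<open>Vector integrals along target fibres: existence, translation, dependence on the base
  point\<close>

context lc_groupoid
begin

text \<open>The partition of unity is subordinate to sets on which \<open>f\<close> oscillates by
  less than \<open>e/2\<close> and \<open>\<eta> > 1/2\<close>. Wherever some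
  \<open>\<phi> j\<close> is nonzero the error \<open>e/2\<close> is thus at most
  \<open>e * \<eta>\<close>, and elsewhere the combination and \<open>f\<close> both vanish.
  Measuring the error by \<open>\<eta>\<close> makes it integrable.\<close>

lemma fiber_approx:
  fixes f :: "'g \<Rightarrow> 'b::real_normed_vector"
  assumes f: "continuous_on (t -` {y}) f" and C: "compact C"
    and f0: "\<And>k. t k = y \<Longrightarrow> k \<notin> C \<Longrightarrow> f k = 0"
    and \<eta>: "\<eta> \<in> Cc" "\<And>h. 0 \<le> \<eta> h" "\<And>h. h \<in> C \<Longrightarrow> \<eta> h = (1::real)" and e: "e > 0"
  shows "\<exists>(J :: 'g set) \<phi> (v :: 'g \<Rightarrow> 'b). finite J \<and> (\<forall>j. \<phi> j \<in> Cc) \<and> (\<forall>j h. 0 \<le> \<phi> j h) \<and>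
    (\<forall>k. t k = y \<longrightarrow> norm (f k - (\<Sum>j\<in>J. \<phi> j k *\<^sub>R v j)) \<le> e * \<eta> k) \<and>
    (\<forall>j\<in>J. \<forall>k. \<eta> k = 0 \<longrightarrow> \<phi> j k = 0)"
proof -
  have "\<exists>U. open U \<and> k \<in> U \<and> (\<forall>h\<in>U. \<eta> h > 1/2 \<and> (t h = y \<longrightarrow> norm (f h - f k) < e/2))"
    if k: "k \<in> C \<inter> t -` {y}" for k
  proof -
    obtain T where T: "open T" "k \<in> T" "\<forall>h\<in>t -` {y} \<inter> T. dist (f h) (f k) < e/2"
      using f[unfolded continuous_on_topological, rule_format, of k "ball (f k) (e/2)"] k e
      by (auto simp: dist_commute)
    moreover have "open {h. \<eta> h > 1/2}"
      using Cc_continuous[OF \<eta>(1)] by (intro open_Collect_less continuous_intros)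
    ultimately show ?thesis
      using k \<eta>(3)[of k] by (intro exI[of _ "T \<inter> {h. \<eta> h > 1/2}"]) (auto simp: dist_norm)
  qed
  then obtain U where U: "\<And>k. k \<in> C \<inter> t -` {y} \<Longrightarrow> open (U k) \<and> k \<in> U k \<and>
      (\<forall>h\<in>U k. \<eta> h > 1/2 \<and> (t h = y \<longrightarrow> norm (f h - f k) < e/2))" by metis
  obtain J :: "'g set" and \<phi> :: "'g \<Rightarrow> 'g \<Rightarrow> real" where
    J: "finite J" "J \<subseteq> C \<inter> t -` {y}" "\<And>j. \<phi> j \<in> Cc" "\<And>j h. 0 \<le> \<phi> j h"
    "\<And>j h. j \<in> J \<Longrightarrow> h \<notin> U j \<Longrightarrow> \<phi> j h = 0" "\<And>h. (\<Sum>j\<in>J. \<phi> j h) \<le> 1"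
    "\<And>h. h \<in> C \<inter> t -` {y} \<Longrightarrow> (\<Sum>j\<in>J. \<phi> j h) = 1"
  proof (rule partition_of_unity[of "C \<inter> t -` {y}" U])
    show "compact (C \<inter> t -` {y})" using C closed_fiber by (rule compact_Int_closed)
  qed (use U in auto)
  have \<phi>0: "\<phi> j k = 0" if "j \<in> J" "\<eta> k = 0" for j k
    using J(5)[OF that(1), of k] U[of j] that J(2) by force
  show ?thesis
  proof (intro exI[of _ J] exI[of _ \<phi>] exI[of _ f] conjI allI impI ballI)
    show "norm (f k - (\<Sum>j\<in>J. \<phi> j k *\<^sub>R f j)) \<le> e * \<eta> k" if k: "t k = y" for k
    proof -
      have "(\<Sum>j\<in>J. \<phi> j k) *\<^sub>R f k = f k"
        using J(7)[of k] f0[of k] k by (cases "k \<in> C") auto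
      then have eq: "f k - (\<Sum>j\<in>J. \<phi> j k *\<^sub>R f j) = (\<Sum>j\<in>J. \<phi> j k *\<^sub>R (f k - f j))"
        by (simp add: scaleR_right_diff_distrib sum_subtractf scaleR_sum_left)
      have "norm (\<phi> j k *\<^sub>R (f k - f j)) \<le> \<phi> j k * (e/2)" if "j \<in> J" for j
      proof (cases "k \<in> U j")
        case True
        then have "norm (f k - f j) \<le> e/2" using U[of j] J(2) that k by (auto intro: less_imp_le)
        from mult_left_mono[OF this J(4)[of j k]] show ?thesis using J(4)[of j k] by simp
      qed (use J(5) that in simp)
      then have "norm (f k - (\<Sum>j\<in>J. \<phi> j k *\<^sub>R f j)) \<le> (\<Sum>j\<in>J. \<phi> j k * (e/2))"
        unfolding eq by (rule sum_norm_le)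
      also have "\<dots> = (\<Sum>j\<in>J. \<phi> j k) * (e/2)" by (simp add: sum_distrib_right)
      also have "\<dots> \<le> e * \<eta> k"
      proof (cases "\<exists>j\<in>J. k \<in> U j")
        case True
        then have "\<eta> k > 1/2" using U J(2) by blast
        then have "e * \<eta> k \<ge> e/2" using e by simp
        moreover have "(\<Sum>j\<in>J. \<phi> j k) * (e/2) \<le> e/2"
          using J(6)[of k] e mult_right_mono[of "\<Sum>j\<in>J. \<phi> j k" 1 "e/2"] by simp
        ultimately show ?thesis by linarith
      next
        case False
        then have "(\<Sum>j\<in>J. \<phi> j k) = 0" using J(5) by (intro sum.neutral) blast
        then show ?thesis using e \<eta>(2)[of k] by simp
      qed
      finally show ?thesis .
    qed
  qed (use J \<phi>0 in auto)
qed

lemma has_vint_Cc_sum: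
  assumes "finite J" "\<And>j. \<phi> j \<in> Cc"
  shows "has_vint (\<mu> y) (\<lambda>k. \<Sum>j\<in>J. \<phi> j k *\<^sub>R v j) (\<Sum>j\<in>J. (\<integral>k. \<phi> j k \<partial>\<mu> y) *\<^sub>R v j)"
  using assms(1) by (rule has_vint_sum) (rule has_vint_scaleR_const[OF Cc_integrable[OF assms(2)]])

text \<open>\<open>fiber_approx\<close> has the integrable majorant \<open>e' * \<eta>\<close>, so
  \<open>has_vint_limit\<close> applies.\<close>

lemma fiber_vint:
  fixes f :: "'g \<Rightarrow> 'b::banach"
  assumes f: "continuous_on (t -` {y}) f" and C: "compact C"
    and f0: "\<And>k. t k = y \<Longrightarrow> k \<notin> C \<Longrightarrow> f k = 0"
  shows "has_vint (\<mu> y) f (vint (\<mu> y) f)"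
proof -
  obtain \<eta> where \<eta>: "\<eta> \<in> Cc" "\<And>h. 0 \<le> \<eta> h" "\<And>h. h \<in> C \<Longrightarrow> \<eta> h = (1::real)"
    using plateau[OF C] by metis
  have I: "(\<integral>k. \<eta> k \<partial>\<mu> y) \<ge> 0" using \<eta>(2) by simp
  have "\<exists>I. has_vint (\<mu> y) f I"
  proof (rule has_vint_limit)
    fix e :: real assume "e > 0"
    \<comment> \<open>The summand 1 avoids a division by zero when \<open>\<eta>\<close> has
      integral zero on this fibre.\<close>
    define e' where "e' = e / (1 + (\<integral>k. \<eta> k \<partial>\<mu> y))"
    have e': "e' > 0" unfolding e'_def using \<open>e > 0\<close> I by simp
    obtain J :: "'g set" and \<phi> :: "'g \<Rightarrow> 'g \<Rightarrow> real" and v :: "'g \<Rightarrow> 'b"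
      where J: "finite J" "\<And>j. \<phi> j \<in> Cc"
        "\<And>k. t k = y \<Longrightarrow> norm (f k - (\<Sum>j\<in>J. \<phi> j k *\<^sub>R v j)) \<le> e' * \<eta> k"
      using fiber_approx[OF f C f0 \<eta> e'] by blast
    have "AE k in \<mu> y. norm (f k - (\<Sum>j\<in>J. \<phi> j k *\<^sub>R v j)) \<le> e' * \<eta> k"
      using AE_fiber[of y] by eventually_elim (rule J(3))
    moreover have "(\<integral>k. e' * \<eta> k \<partial>\<mu> y) \<le> e"
      unfolding e'_def using \<open>e > 0\<close> I by (simp add: field_simps)
    ultimately show "\<exists>h I r. has_vint (\<mu> y) h I \<and> integrable (\<mu> y) r \<and>
       (AE x in \<mu> y. norm (f x - h x) \<le> r x) \<and> (\<integral>x. r x \<partial>\<mu> y) \<le> e"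
      using has_vint_Cc_sum[OF J(1,2), where v=v] Cc_integrable[OF \<eta>(1), of y]
      by (intro exI[of _ "\<lambda>k. \<Sum>j\<in>J. \<phi> j k *\<^sub>R v j"] exI[of _ "\<Sum>j\<in>J. (\<integral>k. \<phi> j k \<partial>\<mu> y) *\<^sub>R v j"] exI[of _ "\<lambda>k. e' * \<eta> k"]) auto
  qed
  then show ?thesis using vint_eqI by metis
qed

text \<open>The indicator discards the pairs for which \<open>m g k\<close> carries no meaning.
  Nonnegativity of \<open>\<phi>\<close> settles the degenerate case: a vanishing integral forces
  \<open>\<phi>\<close> to vanish on the whole fibre.\<close>

lemma translate_integral:
  fixes \<phi> :: "'g \<Rightarrow> real" and g :: 'g
  assumes "\<phi> \<in> Cc" "\<And>h. 0 \<le> \<phi> h"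
  defines "\<psi> \<equiv> (\<lambda>k. indicator (t -` {s g}) k * \<phi> (m g k))"
  shows "integrable (\<mu> (s g)) \<psi>" and "(\<integral>k. \<psi> k \<partial>\<mu> (s g)) = (\<integral>k. \<phi> k \<partial>\<mu> (t g))"
proof -
  let ?C = "(\<lambda>k. m (i g) k) ` (closure {h. \<phi> h \<noteq> 0} \<inter> t -` {t g})"
  show int: "integrable (\<mu> (s g)) \<psi>"
    unfolding \<psi>_def
  proof (rule fiber_integrable[OF closed_fiber, of ?C])
    show "compact ?C"
      by (intro compact_continuous_image compact_Int_closed[OF Cc_compact[OF assms(1)] closed_fiber]
          continuous_intros) auto
    show "continuous_on (t -` {s g}) (\<lambda>k. \<phi> (m g k))"
      by (rule continuous_on_compose2[OF Cc_continuous[OF assms(1)]]) (auto intro!: continuous_intros)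
    fix k assume k: "k \<in> t -` {s g} - ?C"
    show "\<phi> (m g k) = 0"
    proof (rule ccontr)
      assume "\<phi> (m g k) \<noteq> 0"
      then have "m g k \<in> closure {h. \<phi> h \<noteq> 0} \<inter> t -` {t g}"
        using k closure_subset[of "{h. \<phi> h \<noteq> 0}"] by auto
      moreover have "k = m (i g) (m g k)" using k m_assoc[of "i g" g k] by (simp, metis m_u_left)
      ultimately show False using k by blast
    qed
  qed
  have AE: "AE k in \<mu> (s g). \<psi> k = \<phi> (m g k)"
    using AE_fiber[of "s g"] by eventually_elim (simp add: \<psi>_def)
  text \<open>The hypothesis on the Haar system mentions \<open>\<phi> (m g k)\<close> also for non-composable pairs, where it
    may fail to be measurable and its integral is then zero by convention.\<close>
  show "(\<integral>k. \<psi> k \<partial>\<mu> (s g)) = (\<integral>k. \<phi> k \<partial>\<mu> (t g))"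
  proof (cases "integrable (\<mu> (s g)) (\<lambda>k. \<phi> (m g k))")
    case True
    then have "(\<integral>k. \<psi> k \<partial>\<mu> (s g)) = (\<integral>k. \<phi> (m g k) \<partial>\<mu> (s g))"
      using AE int by (intro integral_cong_AE) auto
    then show ?thesis using haar_inv[OF assms(1)] by simp
  next
    case False
    then have 0: "(\<integral>k. \<phi> k \<partial>\<mu> (t g)) = 0"
      using haar_inv[OF assms(1), of g] by (simp add: not_integrable_integral_eq)
    have "\<phi> k = 0" if "t k = t g" for k
      using haar_pos[OF assms(1,2), of k] 0 that assms(2)[of k] by (cases "\<phi> k > 0") auto
    then have "\<psi> k = 0" for k by (auto simp: \<psi>_def indicator_def)
    then show ?thesis using 0 by simp
  qed
qed

text \<open>One finite combination approximates \<open>f\<close> on the target fibre and, after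
  translation, \<open>f (m g k)\<close> on the source fibre. Invariance for scalar functions equates
  the integrals of the two combinations and of the two error majorants.\<close>

lemma vint_translate:
  fixes f :: "'g \<Rightarrow> 'b::banach"
  assumes f: "continuous_on (t -` {t g}) f" and C: "compact C"
    and f0: "\<And>k. t k = t g \<Longrightarrow> k \<notin> C \<Longrightarrow> f k = 0"
  shows "vint (\<mu> (s g)) (\<lambda>k. f (m g k)) = vint (\<mu> (t g)) f"
proof -
  let ?I = "vint (\<mu> (s g)) (\<lambda>k. f (m g k))" and ?I' = "vint (\<mu> (t g)) f"
  let ?C = "(\<lambda>k. m (i g) k) ` (C \<inter> t -` {t g})"
  have I': "has_vint (\<mu> (t g)) f ?I'" by (rule fiber_vint[OF f C f0])
  have I: "has_vint (\<mu> (s g)) (\<lambda>k. f (m g k)) ?I"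
  proof (rule fiber_vint[of _ _ ?C])
    show "compact ?C"
      by (intro compact_continuous_image compact_Int_closed[OF C closed_fiber] continuous_intros) auto
    show "continuous_on (t -` {s g}) (\<lambda>k. f (m g k))"
      by (rule continuous_on_compose2[OF f]) (auto intro!: continuous_intros)
    fix k assume k: "t k = s g" "k \<notin> ?C"
    have "k = m (i g) (m g k)" using k m_assoc[of "i g" g k] by (simp, metis m_u_left)
    then have "m g k \<notin> C" using k by force
    then show "f (m g k) = 0" using f0 k by simp
  qed
  obtain \<eta> where \<eta>: "\<eta> \<in> Cc" "\<And>h. 0 \<le> \<eta> h" "\<And>h. h \<in> C \<Longrightarrow> \<eta> h = (1::real)"
    using plateau[OF C] by metis
  let ?A = "\<integral>k. \<eta> k \<partial>\<mu> (t g)"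
  have A: "?A \<ge> 0" using \<eta>(2) by simp
  have "norm (?I - ?I') \<le> 0 + e" if "e > 0" for e
  proof -
    define e' where "e' = e / (2 * (1 + ?A))"
    have e': "e' > 0" unfolding e'_def using that A by simp
    obtain J :: "'g set" and \<phi> :: "'g \<Rightarrow> 'g \<Rightarrow> real" and v :: "'g \<Rightarrow> 'b"
      where J: "finite J" "\<And>j. \<phi> j \<in> Cc" "\<And>j h. 0 \<le> \<phi> j h"
        "\<And>k. t k = t g \<Longrightarrow> norm (f k - (\<Sum>j\<in>J. \<phi> j k *\<^sub>R v j)) \<le> e' * \<eta> k"
      using fiber_approx[OF f C f0 \<eta> e'] by blast
    let ?\<Phi> = "\<Sum>j\<in>J. (\<integral>k. \<phi> j k \<partial>\<mu> (t g)) *\<^sub>R v j"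
    have "norm (?I' - ?\<Phi>) \<le> (\<integral>k. e' * \<eta> k \<partial>\<mu> (t g))"
    proof (rule has_vint_approx[OF I' has_vint_Cc_sum[OF J(1,2)]])
      show "AE k in \<mu> (t g). norm (f k - (\<Sum>j\<in>J. \<phi> j k *\<^sub>R v j)) \<le> e' * \<eta> k"
        using AE_fiber[of "t g"] by eventually_elim (rule J(4))
    qed (use Cc_integrable[OF \<eta>(1)] in simp)
    moreover have "norm (?I - ?\<Phi>) \<le> (\<integral>k. e' * (indicator (t -` {s g}) k * \<eta> (m g k)) \<partial>\<mu> (s g))"
    proof (rule has_vint_approx[OF I])
      have "has_vint (\<mu> (s g)) (\<lambda>k. \<Sum>j\<in>J. (indicator (t -` {s g}) k * \<phi> j (m g k)) *\<^sub>R v j)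
         (\<Sum>j\<in>J. (\<integral>k. indicator (t -` {s g}) k * \<phi> j (m g k) \<partial>\<mu> (s g)) *\<^sub>R v j)"
        using J(1) by (rule has_vint_sum) (rule has_vint_scaleR_const[OF translate_integral(1)[OF J(2,3)]])
      then show "has_vint (\<mu> (s g)) (\<lambda>k. \<Sum>j\<in>J. (indicator (t -` {s g}) k * \<phi> j (m g k)) *\<^sub>R v j) ?\<Phi>"
        using translate_integral(2)[OF J(2,3)] by simp
      show "AE k in \<mu> (s g). norm (f (m g k) - (\<Sum>j\<in>J. (indicator (t -` {s g}) k * \<phi> j (m g k)) *\<^sub>R v j))
          \<le> e' * (indicator (t -` {s g}) k * \<eta> (m g k))"
        using AE_fiber[of "s g"]
      proof eventually_elim
        fix k assume "t k = s g"
        then show "norm (f (m g k) - (\<Sum>j\<in>J. (indicator (t -` {s g}) k * \<phi> j (m g k)) *\<^sub>R v j))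
          \<le> e' * (indicator (t -` {s g}) k * \<eta> (m g k))" using J(4)[of "m g k"] by simp
      qed
    qed (use translate_integral(1)[OF \<eta>(1,2)] in simp)
    ultimately have "norm (?I' - ?\<Phi>) \<le> e' * ?A" "norm (?I - ?\<Phi>) \<le> e' * ?A"
      using translate_integral(2)[OF \<eta>(1,2)] by simp_all
    then have "norm (?I - ?I') \<le> 2 * (e' * ?A)"
      using norm_triangle_ineq4[of "?I - ?\<Phi>" "?I' - ?\<Phi>"] by simp
    also have "\<dots> \<le> e" unfolding e'_def using A that by (simp add: field_simps)
    finally show ?thesis by simp
  qed
  then have "norm (?I - ?I') \<le> 0" by (rule field_le_epsilon)
  then show ?thesis by simp
qed

text \<open>Uniformity in \<open>k\<close> comes from a tube-lemma argument over the compact support of a cutoff.\<close>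
lemma vint_continuous:
  fixes F :: "'z::topological_space \<Rightarrow> 'g \<Rightarrow> 'b::banach"
  assumes F: "continuous_on {(z, k). z \<in> Z \<and> t k = p z} (\<lambda>(z, k). F z k)"
    and p: "continuous_on Z p"
    and supp: "\<And>z. z \<in> Z \<Longrightarrow> \<exists>N C. open N \<and> z \<in> N \<and> compact C \<and>
                 (\<forall>w\<in>Z \<inter> N. \<forall>k. t k = p w \<longrightarrow> k \<notin> C \<longrightarrow> F w k = 0)"
  shows "continuous_on Z (\<lambda>z. vint (\<mu> (p z)) (F z))"
proof -
  have fib: "continuous_on (t -` {p z}) (F z)" if "z \<in> Z" for z
  proof -
    have "continuous_on (t -` {p z}) (\<lambda>k. (z, k))"
      by (intro continuous_on_Pair continuous_on_const continuous_on_id)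
    from continuous_on_compose2[OF F this] show ?thesis using that by auto
  qed
  show ?thesis
    unfolding continuous_on_topological
  proof (intro ballI allI impI)
    fix z0 B assume z0: "z0 \<in> Z" and B: "open B" "vint (\<mu> (p z0)) (F z0) \<in> B"
    obtain N C where N: "open N" "z0 \<in> N" and C: "compact C"
      and NC: "\<And>w k. w \<in> Z \<Longrightarrow> w \<in> N \<Longrightarrow> t k = p w \<Longrightarrow> k \<notin> C \<Longrightarrow> F w k = 0"
      using supp[OF z0] by blast
    have hv: "has_vint (\<mu> (p w)) (F w) (vint (\<mu> (p w)) (F w))" if "w \<in> Z \<inter> N" for w
      by (rule fiber_vint[OF fib C NC]) (use that in auto)
    obtain e where e: "e > 0" "ball (vint (\<mu> (p z0)) (F z0)) e \<subseteq> B"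
      using B open_contains_ball by blast
    obtain \<eta> where \<eta>: "\<eta> \<in> Cc" "\<And>h. 0 \<le> \<eta> h" "\<And>h. h \<in> C \<Longrightarrow> \<eta> h = (1::real)" "\<And>h. \<eta> h \<le> 1"
      using plateau[OF C] by metis
    let ?Q = "closure {h. \<eta> h \<noteq> 0}"
    have Q: "compact ?Q" using Cc_compact[OF \<eta>(1)] .
    \<comment> \<open>On its own support \<open>\<eta>\<close> has no positive lower bound, so it
      cannot dominate a constant error there; \<open>\<theta>\<close> equals 1 on that whole
      support.\<close>
    obtain \<theta> where \<theta>: "\<theta> \<in> Cc" "\<And>h. 0 \<le> \<theta> h" "\<And>h. h \<in> ?Q \<Longrightarrow> \<theta> h = (1::real)"
      using plateau[OF Q] by metis
    define A where "A y = (\<integral>k. \<theta> k \<partial>\<mu> y)" for y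
    have A: "A y \<ge> 0" for y unfolding A_def using \<theta>(2) by simp
    \<comment> \<open>Chosen so that \<open>2 * e1 * (2 * A (p z0) + 2) = e/2\<close>, which covers
      the approximation errors at \<open>w\<close> and \<open>z0\<close> once
      \<open>A (p w) < A (p z0) + 1\<close>.\<close>
    define e1 where "e1 = e / (4 * (2 * A (p z0) + 2))"
    have e1: "e1 > 0" unfolding e1_def using e A[of "p z0"] by simp
    obtain J :: "'g set" and \<phi> :: "'g \<Rightarrow> 'g \<Rightarrow> real" and v :: "'g \<Rightarrow> 'b"
      where J: "finite J" "\<And>j. \<phi> j \<in> Cc" "\<And>j h. 0 \<le> \<phi> j h"
        "\<And>k. t k = p z0 \<Longrightarrow> norm (F z0 k - (\<Sum>j\<in>J. \<phi> j k *\<^sub>R v j)) \<le> e1 * \<eta> k"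
        "\<And>j k. j \<in> J \<Longrightarrow> \<eta> k = 0 \<Longrightarrow> \<phi> j k = 0"
      using fiber_approx[OF fib[OF z0] C NC[OF z0 N(2)] \<eta>(1-3) e1] by blast
    define \<Phi> where "\<Phi> k = (\<Sum>j\<in>J. \<phi> j k *\<^sub>R v j)" for k
    define I where "I y = (\<Sum>j\<in>J. (\<integral>k. \<phi> j k \<partial>\<mu> y) *\<^sub>R v j)" for y
    have \<Phi>c: "continuous_on UNIV \<Phi>"
      unfolding \<Phi>_def using J(2) by (intro continuous_intros Cc_continuous)
    \<comment> \<open>On the fibre over \<open>p z0\<close> the error is at most \<open>e1\<close>,
      and the slack up to \<open>2 * e1\<close> makes the bound an open condition. Off that fibre,
      separation of objects makes \<open>t h = p w\<close> impossible nearby, so the condition is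
      void.\<close>
    have "\<exists>N' U. open N' \<and> z0 \<in> N' \<and> open U \<and> k \<in> U \<and>
       (\<forall>w\<in>Z \<inter> N'. \<forall>h\<in>U. t h = p w \<longrightarrow> norm (F w h - \<Phi> h) < 2 * e1)" for k
    proof (cases "t k = p z0")
      case True
      let ?D = "{(z, k). z \<in> Z \<and> t k = p z}"
      have "continuous_on ?D (\<lambda>w. (case w of (z, k) \<Rightarrow> F z k) - \<Phi> (snd w))"
        by (intro continuous_intros F continuous_on_compose2[OF \<Phi>c]) auto
      moreover have "norm (F z0 k - \<Phi> k) < 2 * e1"
      proof -
        have "e1 * \<eta> k \<le> e1" using \<eta>(4)[of k] e1 by simp
        then show ?thesis using J(4)[OF True] e1 unfolding \<Phi>_def by linarith
      qed
      ultimately obtain T where T: "open T" "(z0, k) \<in> T"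
        "\<forall>w\<in>?D. w \<in> T \<longrightarrow> (case w of (z, k) \<Rightarrow> F z k) - \<Phi> (snd w) \<in> ball 0 (2 * e1)"
        unfolding continuous_on_topological using True z0
        by (elim ballE[of _ _ "(z0, k)"] allE[of _ "ball 0 (2 * e1)"]) auto
      obtain N' U where "open N'" "open U" "z0 \<in> N'" "k \<in> U" "N' \<times> U \<subseteq> T"
        using open_prod_elim[OF T(1,2)] by (metis mem_Sigma_iff)
      then show ?thesis using T(3) by (intro exI[of _ N'] exI[of _ U]) auto
    next
      case False
      then obtain V W where VW: "open V" "open W" "t k \<in> V" "p z0 \<in> W" "V \<inter> W = {}"
        using separation_X by metis
      obtain N' where N': "open N'" "z0 \<in> N'" "\<forall>w\<in>Z. w \<in> N' \<longrightarrow> p w \<in> W"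
        using p z0 VW(2,4) unfolding continuous_on_topological by meson
      show ?thesis
        using VW N' open_vimage_t[OF VW(1)] by (intro exI[of _ N'] exI[of _ "t -` V"]) auto
    qed
    then obtain N' U where NU: "\<And>k. open (N' k) \<and> z0 \<in> N' k \<and> open (U k) \<and> k \<in> U k \<and>
       (\<forall>w\<in>Z \<inter> N' k. \<forall>h\<in>U k. t h = p w \<longrightarrow> norm (F w h - \<Phi> h) < 2 * e1)" by metis
    obtain L where L: "L \<subseteq> ?Q" "finite L" "?Q \<subseteq> (\<Union>k\<in>L. U k)"
      using compactE_image[OF Q, of ?Q U] NU by blast
    define N1 where "N1 = N \<inter> (\<Inter>k\<in>L. N' k)"
    have N1: "open N1" "z0 \<in> N1" unfolding N1_def using N L NU by (auto intro!: open_INT)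
    have close: "norm (vint (\<mu> (p w)) (F w) - I (p w)) \<le> 2 * e1 * A (p w)" if w: "w \<in> Z" "w \<in> N1" for w
    proof -
      have "norm (vint (\<mu> (p w)) (F w) - I (p w)) \<le> (\<integral>k. 2 * e1 * \<theta> k \<partial>\<mu> (p w))"
        unfolding I_def
      proof (rule has_vint_approx[OF hv has_vint_Cc_sum[OF J(1,2)]])
        show "w \<in> Z \<inter> N" using w by (auto simp: N1_def)
        show "AE k in \<mu> (p w). norm (F w k - (\<Sum>j\<in>J. \<phi> j k *\<^sub>R v j)) \<le> 2 * e1 * \<theta> k"
          using AE_fiber[of "p w"]
        proof eventually_elim
          fix k assume k: "t k = p w"
          show "norm (F w k - (\<Sum>j\<in>J. \<phi> j k *\<^sub>R v j)) \<le> 2 * e1 * \<theta> k"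
          proof (cases "k \<in> ?Q")
            case True
            then obtain l where "l \<in> L" "k \<in> U l" using L by blast
            then have "norm (F w k - \<Phi> k) < 2 * e1" using NU[of l] w k by (auto simp: N1_def)
            then show ?thesis using \<theta>(3)[OF True] by (simp add: \<Phi>_def)
          next
            \<comment> \<open>Outside the support of \<open>\<eta>\<close> both \<open>F w k\<close>
              and the approximating combination vanish, since \<open>\<eta> = 1\<close> on
              \<open>C\<close>.\<close>
            case False
            then have "\<eta> k = 0" using closure_subset[of "{h. \<eta> h \<noteq> 0}"] by blast
            then have "k \<notin> C" "\<And>j. j \<in> J \<Longrightarrow> \<phi> j k = 0" using \<eta>(3) J(5) by force+
            then show ?thesis using NC[OF w(1) _ k] w e1 \<theta>(2)[of k] by (simp add: N1_def)
          qed
        qed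
      qed (use Cc_integrable[OF \<theta>(1)] in simp)
      then show ?thesis by (simp add: A_def)
    qed
    have "continuous_on Z (\<lambda>z. A (p z))"
      unfolding A_def by (rule continuous_on_compose2[OF haar_cont[OF \<theta>(1)] p]) auto
    moreover have "A (p z0) \<in> {..<A (p z0) + 1}" by simp
    ultimately obtain N2 where N2: "open N2" "z0 \<in> N2" "\<forall>w\<in>Z. w \<in> N2 \<longrightarrow> A (p w) \<in> {..<A (p z0) + 1}"
      unfolding continuous_on_topological using z0 open_lessThan by meson
    have "continuous_on UNIV I"
      unfolding I_def by (intro continuous_intros haar_cont J(2))
    then have "continuous_on Z (\<lambda>z. I (p z))"
      by (rule continuous_on_compose2[OF _ p]) auto
    moreover have "I (p z0) \<in> ball (I (p z0)) (e/4)" using e by simp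
    ultimately obtain N3 where N3: "open N3" "z0 \<in> N3" "\<forall>w\<in>Z. w \<in> N3 \<longrightarrow> I (p w) \<in> ball (I (p z0)) (e/4)"
      unfolding continuous_on_topological using z0 open_ball by meson
    have "vint (\<mu> (p w)) (F w) \<in> B" if w: "w \<in> Z" "w \<in> N1 \<inter> N2 \<inter> N3" for w
    proof -
      let ?a = "vint (\<mu> (p w)) (F w)" and ?b = "vint (\<mu> (p z0)) (F z0)"
      have 1: "norm (?a - I (p w)) \<le> 2 * e1 * A (p w)" using close w by simp
      have 2: "norm (?b - I (p z0)) \<le> 2 * e1 * A (p z0)" using close z0 N1 by simp
      have 3: "norm (I (p z0) - I (p w)) < e/4" using N3 w by (auto simp: dist_norm)
      have "2 * e1 * A (p w) \<le> 2 * e1 * (A (p z0) + 1)"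
        using N2 w e1 by (intro mult_left_mono) (auto intro: less_imp_le)
      then have "2 * e1 * A (p w) + 2 * e1 * A (p z0) \<le> 2 * e1 * (2 * A (p z0) + 2)"
        using e1 by (simp add: algebra_simps)
      also have "\<dots> = e/2" unfolding e1_def using A[of "p z0"] by (simp add: field_simps)
      finally have 4: "2 * e1 * A (p w) + 2 * e1 * A (p z0) \<le> e/2" .
      have "?b - ?a = (?b - I (p z0)) + (I (p z0) - I (p w)) - (?a - I (p w))" by simp
      then have "norm (?b - ?a) \<le> norm (?b - I (p z0)) + norm (I (p z0) - I (p w)) + norm (?a - I (p w))"
        using norm_triangle_ineq4[of "(?b - I (p z0)) + (I (p z0) - I (p w))" "?a - I (p w)"]
          norm_triangle_ineq[of "?b - I (p z0)" "I (p z0) - I (p w)"] by simp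
      also have "\<dots> < e" using 1 2 3 4 e(1) by linarith
      finally show ?thesis using e(2) by (auto simp: dist_norm)
    qed
    then show "\<exists>T. open T \<and> z0 \<in> T \<and> (\<forall>w\<in>Z. w \<in> T \<longrightarrow> vint (\<mu> (p w)) (F w) \<in> B)"
      using N1 N2 N3 by (intro exI[of _ "N1 \<inter> N2 \<inter> N3"]) auto
  qed
qed

end

section \<open>Normalized invariant means\<close>

text \<open>Where \<open>h\<close> vanishes nothing is known about \<open>f\<close>; local
  boundedness of \<open>f\<close> on the set where \<open>h\<close> is nonzero still makes the
  product tend to zero. This lets operator fields controlled only on G|V be integrated over entire
  fibres.\<close>

lemma weighted_continuous:
  fixes f :: "'z::topological_space \<Rightarrow> 'b::real_normed_vector" and h :: "'z \<Rightarrow> real"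
  assumes h: "continuous_on A h" and f: "continuous_on {z \<in> A. h z \<noteq> 0} f"
    and bd: "\<And>z. z \<in> A \<Longrightarrow> \<exists>N B. open N \<and> z \<in> N \<and> (\<forall>w\<in>A \<inter> N. h w \<noteq> 0 \<longrightarrow> norm (f w) \<le> B)"
  shows "continuous_on A (\<lambda>z. h z *\<^sub>R f z)"
  unfolding continuous_on_def
proof
  fix z assume z: "z \<in> A"
  have hz: "(h \<longlongrightarrow> h z) (at z within A)" using h z by (simp add: continuous_on_def)
  show "((\<lambda>z. h z *\<^sub>R f z) \<longlongrightarrow> h z *\<^sub>R f z) (at z within A)"
  proof (cases "h z = 0")
    case True
    obtain N B where N: "open N" "z \<in> N" "\<And>w. w \<in> A \<inter> N \<Longrightarrow> h w \<noteq> 0 \<Longrightarrow> norm (f w) \<le> B"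
      using bd[OF z] by blast
    have "((\<lambda>w. h w *\<^sub>R f w) \<longlongrightarrow> 0) (at z within A)"
    proof (rule Lim_null_comparison)
      show "\<forall>\<^sub>F w in at z within A. norm (h w *\<^sub>R f w) \<le> \<bar>h w\<bar> * B"
        unfolding eventually_at_topological
      proof (intro exI[of _ N] conjI ballI impI N(1,2))
        fix w assume "w \<in> N" "w \<in> A"
        then show "norm (h w *\<^sub>R f w) \<le> \<bar>h w\<bar> * B"
          using N(3)[of w] by (cases "h w = 0") (auto intro: mult_left_mono)
      qed
      show "((\<lambda>w. \<bar>h w\<bar> * B) \<longlongrightarrow> 0) (at z within A)"
        using tendsto_mult_right[OF tendsto_rabs[OF hz], of B] True by simp
    qed
    then show ?thesis using True by simp
  next
    case False
    obtain S where S: "open S" "S \<inter> A = h -` (- {0}) \<inter> A"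
      using h open_Compl[OF closed_singleton[of "0::real"]] unfolding continuous_on_open_invariant by blast
    have "at z within A = at z within {z \<in> A. h z \<noteq> 0}"
      by (rule at_within_nhd[of z S]) (use S z False in auto)
    then have "(f \<longlongrightarrow> f z) (at z within A)" using f z False by (simp add: continuous_on_def)
    then show ?thesis by (intro tendsto_intros hz)
  qed
qed

text \<open>Both functions have the same candidates for an integral, so the equality persists even
  when there is none.\<close>

lemma vint_cong_AE: "AE x in M. f x = g x \<Longrightarrow> vint M f = vint M g"
proof -
  assume a: "AE x in M. f x = g x"
  then have b: "AE x in M. g x = f x" by eventually_elim simp
  have "has_vint M f = has_vint M g"
    using has_vint_cong_AE[OF a] has_vint_cong_AE[OF b] by blast
  then show ?thesis by (simp add: vint_def)
qed

text \<open>The target map is open and continuous, so it carries a compact neighbourhood of the unit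
  arrow to one of \<open>y\<close>.\<close>

lemma (in lc_groupoid) compact_nhd_X: 
  obtains U C where "open U" "compact C" "y \<in> U" "U \<subseteq> (C :: 'x set)"
proof -
  obtain U K where "open U" "compact K" "u y \<in> U" "U \<subseteq> K" using compact_nhd .
  then show thesis
    by (intro that[of "t ` U" "t ` K"] open_map_t compact_continuous_image continuous_intros)
      (auto simp: image_iff, metis t_u)
qed

text \<open>Unlike a cutoff function, \<open>c\<close> may vanish on whole orbits, so it can be
  supported in an arbitrarily small neighbourhood; compactness is demanded only of its trace on
  fibres over compact sets.\<close>

locale haar_mean = lc_groupoid s t u m i \<mu>
  for s t :: "'g::t2_space \<Rightarrow> 'x::topological_space"
    and u :: "'x \<Rightarrow> 'g" and m :: "'g \<Rightarrow> 'g \<Rightarrow> 'g" and i :: "'g \<Rightarrow> 'g"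
    and \<mu> :: "'x \<Rightarrow> 'g measure" +
  fixes c :: "'x \<Rightarrow> real"
  assumes c_cont: "continuous_on UNIV c" and c_nonneg: "c y \<ge> 0"
    and c_compact: "compact C \<Longrightarrow> \<exists>L. compact L \<and> {k. t k \<in> C \<and> c (s k) \<noteq> 0} \<subseteq> L"
begin

definition D :: "'x \<Rightarrow> 'g set" where "D y = {k. t k = y \<and> c (s k) \<noteq> 0}"

definition mass :: "'x \<Rightarrow> real" where "mass y = (\<integral>k. indicator (t -` {y}) k * c (s k) \<partial>\<mu> y)"

text \<open>Zero where \<open>mass y = 0\<close>, by the convention for division by zero;
  normalisation is claimed only under \<open>mass y > 0\<close>.\<close>

definition mean :: "'x \<Rightarrow> ('g \<Rightarrow> 'b::banach) \<Rightarrow> 'b" where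
  "mean y f = (1 / mass y) *\<^sub>R vint (\<mu> y) (\<lambda>k. c (s k) *\<^sub>R f k)"

text \<open>Continuity is required only where the weight is nonzero; boundedness is what keeps the
  weighted integrand continuous where the weight dies out.\<close>

definition adm :: "'x \<Rightarrow> ('g \<Rightarrow> 'b::banach) \<Rightarrow> bool" where
  "adm y f \<longleftrightarrow> continuous_on (D y) f \<and> bounded (f ` D y)"

lemma continuous_c [continuous_intros]: "continuous_on A f \<Longrightarrow> continuous_on A (\<lambda>z. c (f z))"
  by (rule continuous_on_compose2[OF c_cont]) auto

lemma fiber_c_continuous: "continuous_on A (\<lambda>k. c (s k))"
  by (intro continuous_intros)

lemma fiber_support: "\<exists>L. compact L \<and> (\<forall>k. t k = y \<longrightarrow> k \<notin> L \<longrightarrow> c (s k) = 0)"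
  using c_compact[of "{y}"] by auto

lemma adm_continuous:
  assumes "adm y f"
  shows "continuous_on (t -` {y}) (\<lambda>k. c (s k) *\<^sub>R f k)"
proof (rule weighted_continuous[OF fiber_c_continuous])
  have "{z \<in> t -` {y}. c (s z) \<noteq> 0} = D y" by (auto simp: D_def)
  then show "continuous_on {z \<in> t -` {y}. c (s z) \<noteq> 0} f" using assms by (simp add: adm_def)
  obtain B where "\<And>k. k \<in> D y \<Longrightarrow> norm (f k) \<le> B"
    using assms by (auto simp: adm_def bounded_iff)
  then show "\<exists>N B. open N \<and> z \<in> N \<and> (\<forall>w\<in>t -` {y} \<inter> N. c (s w) \<noteq> 0 \<longrightarrow> norm (f w) \<le> B)" for z
    by (intro exI[of _ UNIV] exI[of _ B]) (auto simp: D_def)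
qed

lemma adm_vint:
  assumes "adm y f"
  shows "has_vint (\<mu> y) (\<lambda>k. c (s k) *\<^sub>R f k) (vint (\<mu> y) (\<lambda>k. c (s k) *\<^sub>R f k))"
proof -
  obtain L where "compact L" "\<And>k. t k = y \<Longrightarrow> k \<notin> L \<Longrightarrow> c (s k) = 0" using fiber_support[of y] by blast
  then show ?thesis by (intro fiber_vint[OF adm_continuous[OF assms]]) auto
qed

lemma mass_integrable: "integrable (\<mu> y) (\<lambda>k. indicator (t -` {y}) k * c (s k))"
proof -
  obtain L where L: "compact L" "\<And>k. t k = y \<Longrightarrow> k \<notin> L \<Longrightarrow> c (s k) = 0" using fiber_support[of y] by blast
  show ?thesis by (rule fiber_integrable[OF closed_fiber L(1) fiber_c_continuous]) (use L(2) in auto)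
qed

lemma mass_vint: "has_vint (\<mu> y) (\<lambda>k. c (s k)) (mass y)"
proof (rule has_vint_cong_AE)
  show "has_vint (\<mu> y) (\<lambda>k. indicator (t -` {y}) k * c (s k)) (mass y)"
    unfolding mass_def by (rule has_vint_real[OF mass_integrable])
  show "AE k in \<mu> y. indicator (t -` {y}) k * c (s k) = c (s k)"
    using AE_fiber[of y] by eventually_elim simp
qed

lemma mass_eq: "mass y = vint (\<mu> y) (\<lambda>k. c (s k))"
  using vint_eqI[OF mass_vint] by simp

text \<open>The unit arrow at \<open>y\<close> lies in the fibre and has weight
  \<open>c y > 0\<close>. Since \<open>haar_pos\<close> needs compact support on the whole arrow
  space, the weight is multiplied by a bump, and the product is dominated by a multiple of the
  weight.\<close>

lemma mass_pos:
  assumes "c y \<noteq> 0" shows "mass y > 0"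
proof -
  have "open {k. c (s k) > 0}" by (intro open_Collect_less continuous_intros)
  moreover have "c (s (u y)) > 0" using assms c_nonneg[of y] by simp
  ultimately obtain \<psi> where \<psi>: "\<psi> \<in> Cc" "\<And>h. 0 \<le> \<psi> h" "\<psi> (u y) = 1"
    "\<And>h. h \<notin> {k. c (s k) > 0} \<Longrightarrow> \<psi> h = (0::real)"
    using bump[of "{k. c (s k) > 0}" "u y"] by auto
  have cc: "(\<lambda>k. c (s k) * \<psi> k) \<in> Cc"
    by (rule Cc_mult[OF \<psi>(1) fiber_c_continuous])
  \<comment> \<open>\<open>bump\<close> provides no upper bound, so one is drawn from compactness of
    the support.\<close>
  obtain K where K: "\<And>h. \<psi> h \<le> K" "K > 0"
  proof -
    have "compact (\<psi> ` closure {h. \<psi> h \<noteq> 0})"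
      by (intro compact_continuous_image Cc_compact \<psi>(1) continuous_on_subset[OF Cc_continuous[OF \<psi>(1)]]) auto
    then obtain B where B: "\<And>h. h \<in> closure {h. \<psi> h \<noteq> 0} \<Longrightarrow> \<bar>\<psi> h\<bar> \<le> B"
      using compact_imp_bounded[of "\<psi> ` closure {h. \<psi> h \<noteq> 0}"] by (auto simp: bounded_iff)
    show thesis
    proof (rule that[of "max 1 B"])
      show "\<psi> h \<le> max 1 B" for h
        using B[of h] closure_subset[of "{h. \<psi> h \<noteq> 0}"] by (cases "\<psi> h = 0") auto
    qed simp
  qed
  have "0 < (\<integral>k. c (s k) * \<psi> k \<partial>\<mu> (t (u y)))"
    by (rule haar_pos[OF cc]) (use \<psi> c_nonneg \<open>c (s (u y)) > 0\<close> in auto)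
  also have "\<dots> \<le> (\<integral>k. (indicator (t -` {y}) k * c (s k)) * K \<partial>\<mu> y)"
    unfolding t_u
  proof (rule integral_mono_AE[OF Cc_integrable[OF cc]])
    show "AE k in \<mu> y. c (s k) * \<psi> k \<le> (indicator (t -` {y}) k * c (s k)) * K"
      using AE_fiber[of y]
      by eventually_elim (use K(1) c_nonneg in \<open>auto intro: mult_left_mono\<close>)
  qed (use mass_integrable in simp)
  also have "\<dots> = mass y * K" by (simp add: mass_def)
  finally show ?thesis using K(2) by (simp add: zero_less_mult_iff)
qed

lemma mean_cong:
  assumes "\<And>k. k \<in> D y \<Longrightarrow> f k = g k" shows "mean y f = mean y g"
proof -
  have "AE k in \<mu> y. c (s k) *\<^sub>R f k = c (s k) *\<^sub>R g k"
    using AE_fiber[of y] by eventually_elim (use assms in \<open>auto simp: D_def\<close>)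
  then show ?thesis unfolding mean_def by (simp add: vint_cong_AE)
qed

lemma adm_const: "adm y (\<lambda>k. v)"
  by (auto simp: adm_def intro: finite_imp_bounded finite_subset[of _ "{v}"])

lemma adm_diff: "adm y f \<Longrightarrow> adm y g \<Longrightarrow> adm y (\<lambda>k. f k - g k)"
  unfolding adm_def by (auto intro!: continuous_intros bounded_minus_comp)

lemma mean_linear:
  assumes L: "bounded_linear L" and "adm y f"
  shows "mean y (\<lambda>k. L (f k)) = L (mean y f)"
  using vint_eqI[OF has_vint_linear[OF L adm_vint[OF assms(2)]]]
  by (simp add: mean_def linear_scale[OF bounded_linear.linear[OF L]])

lemma mean_diff:
  assumes "adm y f" "adm y g"
  shows "mean y (\<lambda>k. f k - g k) = mean y f - mean y g"
  using vint_eqI[OF has_vint_diff[OF adm_vint[OF assms(1)] adm_vint[OF assms(2)]]]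
  by (simp add: mean_def scaleR_right_diff_distrib)

lemma mean_const:
  assumes "mass y > 0" shows "mean y (\<lambda>k. v) = v"
  using vint_eqI[OF has_vint_linear[OF bounded_linear_scaleR_left mass_vint, of y v]] assms
  by (simp add: mean_def)

lemma mean_norm_le:
  assumes "mass y > 0" "adm y f" "\<And>k. k \<in> D y \<Longrightarrow> norm (f k) \<le> b"
  shows "norm (mean y f) \<le> b"
proof -
  have "norm (vint (\<mu> y) (\<lambda>k. c (s k) *\<^sub>R f k)) \<le> (\<integral>k. (indicator (t -` {y}) k * c (s k)) * b \<partial>\<mu> y)"
  proof (rule has_vint_norm_le[OF adm_vint[OF assms(2)]])
    show "AE k in \<mu> y. norm (c (s k) *\<^sub>R f k) \<le> (indicator (t -` {y}) k * c (s k)) * b"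
      using AE_fiber[of y]
    proof eventually_elim
      fix k assume "t k = y"
      then show "norm (c (s k) *\<^sub>R f k) \<le> (indicator (t -` {y}) k * c (s k)) * b"
        using assms(3)[of k] c_nonneg[of "s k"]
        by (cases "c (s k) = 0") (auto simp: D_def intro: mult_left_mono)
    qed
  qed (use mass_integrable in simp)
  also have "\<dots> = mass y * b" by (simp add: mass_def)
  finally show ?thesis using assms(1) by (simp add: mean_def field_simps)
qed

text \<open>Since \<open>s (m g k) = s k\<close>, the weight is unchanged by left translation. Hence
  both the mass and the normalised mean inherit invariance from the Haar system.\<close>

lemma mass_invariant: "mass (s g) = mass (t g)"
proof -
  obtain L where L: "compact L" "\<And>k. t k = t g \<Longrightarrow> k \<notin> L \<Longrightarrow> c (s k) = 0" using fiber_support[of "t g"] by blast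
  have "mass (s g) = vint (\<mu> (s g)) (\<lambda>k. c (s (m g k)))"
    unfolding mass_eq
  proof (rule vint_cong_AE)
    show "AE k in \<mu> (s g). c (s k) = c (s (m g k))"
      using AE_fiber[of "s g"] by eventually_elim simp
  qed
  also have "\<dots> = mass (t g)"
    unfolding mass_eq by (rule vint_translate[OF fiber_c_continuous L])
  finally show ?thesis .
qed

lemma mean_invariant:
  assumes "adm (t g) f" shows "mean (s g) (\<lambda>k. f (m g k)) = mean (t g) f"
proof -
  obtain L where L: "compact L" "\<And>k. t k = t g \<Longrightarrow> k \<notin> L \<Longrightarrow> c (s k) = 0" using fiber_support[of "t g"] by blast
  have "vint (\<mu> (s g)) (\<lambda>k. c (s k) *\<^sub>R f (m g k)) = vint (\<mu> (s g)) (\<lambda>k. c (s (m g k)) *\<^sub>R f (m g k))"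
  proof (rule vint_cong_AE)
    show "AE k in \<mu> (s g). c (s k) *\<^sub>R f (m g k) = c (s (m g k)) *\<^sub>R f (m g k)"
      using AE_fiber[of "s g"] by eventually_elim simp
  qed
  also have "\<dots> = vint (\<mu> (t g)) (\<lambda>k. c (s k) *\<^sub>R f k)"
    by (rule vint_translate[OF adm_continuous[OF assms] L(1)]) (use L(2) in auto)
  finally show ?thesis by (simp add: mean_def mass_invariant)
qed

lemma local_support:
  assumes p: "continuous_on Z p" and z: "z \<in> Z"
  shows "\<exists>N C. open N \<and> z \<in> N \<and> compact C \<and> (\<forall>w\<in>Z \<inter> N. \<forall>k. t k = p w \<longrightarrow> k \<notin> C \<longrightarrow> c (s k) = 0)"
proof -
  obtain U C where U: "open U" "compact C" "p z \<in> U" "U \<subseteq> C" using compact_nhd_X .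
  obtain L where L: "compact L" "{k. t k \<in> C \<and> c (s k) \<noteq> 0} \<subseteq> L" using c_compact[OF U(2)] by blast
  obtain N where N: "open N" "z \<in> N" "\<forall>w\<in>Z. w \<in> N \<longrightarrow> p w \<in> U"
    using p[unfolded continuous_on_topological, rule_format, OF z U(1,3)] by auto
  show ?thesis
  proof (intro exI[of _ N] exI[of _ L] conjI ballI allI impI)
    fix w k assume "w \<in> Z \<inter> N" "t k = p w" "k \<notin> L"
    then have "t k \<in> C" using N(3) U(4) by auto
    then show "c (s k) = 0" using L(2) \<open>k \<notin> L\<close> by auto
  qed (use N L in auto)
qed

lemma mass_continuous: "continuous_on UNIV mass"
  unfolding mass_eq[abs_def]
proof (rule vint_continuous)
  show "continuous_on {(z, k). z \<in> UNIV \<and> t k = z} (\<lambda>(z, k). c (s k))"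
    by (simp add: case_prod_unfold) (intro continuous_intros)
  show "\<exists>N C. open N \<and> z \<in> N \<and> compact C \<and>
     (\<forall>w\<in>UNIV \<inter> N. \<forall>k. t k = w \<longrightarrow> k \<notin> C \<longrightarrow> c (s k) = 0)" for z
    using local_support[OF continuous_on_id, of z UNIV] by simp
qed (rule continuous_on_id)

text \<open>The local bound on \<open>F\<close> serves \<open>weighted_continuous\<close>;
  compactness of the weight on fibres over a compact neighbourhood serves
  \<open>vint_continuous\<close>.\<close>

lemma mean_continuous:
  fixes F :: "'z::topological_space \<Rightarrow> 'g \<Rightarrow> 'b::banach"
  assumes F: "continuous_on {(z, k). z \<in> Z \<and> k \<in> D (p z)} (\<lambda>(z, k). F z k)"
    and p: "continuous_on Z p" and pos: "\<And>z. z \<in> Z \<Longrightarrow> mass (p z) > 0"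
    and bd: "\<And>z. z \<in> Z \<Longrightarrow> \<exists>N B. open N \<and> z \<in> N \<and> (\<forall>w\<in>Z \<inter> N. \<forall>k\<in>D (p w). norm (F w k) \<le> B)"
  shows "continuous_on Z (\<lambda>z. mean (p z) (F z))"
proof -
  let ?A = "{(z, k). z \<in> Z \<and> t k = p z}"
  have "continuous_on ?A (\<lambda>w. c (s (snd w)) *\<^sub>R (\<lambda>(z, k). F z k) w)"
  proof (rule weighted_continuous)
    show "continuous_on ?A (\<lambda>w. c (s (snd w)))" by (intro continuous_intros)
    have "{w \<in> ?A. c (s (snd w)) \<noteq> 0} = {(z, k). z \<in> Z \<and> k \<in> D (p z)}" by (auto simp: D_def)
    then show "continuous_on {w \<in> ?A. c (s (snd w)) \<noteq> 0} (\<lambda>(z, k). F z k)" using F by simp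
    fix w assume "w \<in> ?A"
    then obtain N B where N: "open N" "fst w \<in> N" "\<And>v k. v \<in> Z \<inter> N \<Longrightarrow> k \<in> D (p v) \<Longrightarrow> norm (F v k) \<le> B"
      using bd[of "fst w"] by (auto simp: case_prod_unfold)
    show "\<exists>N B. open N \<and> w \<in> N \<and> (\<forall>v\<in>?A \<inter> N. c (s (snd v)) \<noteq> 0 \<longrightarrow> norm ((\<lambda>(z, k). F z k) v) \<le> B)"
      by (intro exI[of _ "N \<times> UNIV"] exI[of _ B])
        (use N in \<open>auto simp: D_def open_Times mem_Times_iff\<close>)
  qed
  then have "continuous_on ?A (\<lambda>(z, k). c (s k) *\<^sub>R F z k)" by (simp add: case_prod_unfold)
  then have "continuous_on Z (\<lambda>z. vint (\<mu> (p z)) (\<lambda>k. c (s k) *\<^sub>R F z k))"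
  proof (rule vint_continuous[OF _ p])
    fix z assume "z \<in> Z"
    then show "\<exists>N C. open N \<and> z \<in> N \<and> compact C \<and>
       (\<forall>w\<in>Z \<inter> N. \<forall>k. t k = p w \<longrightarrow> k \<notin> C \<longrightarrow> c (s k) *\<^sub>R F w k = 0)"
      using local_support[OF p] by (metis scaleR_zero_left)
  qed
  moreover have "continuous_on Z (\<lambda>z. mass (p z))"
    by (rule continuous_on_compose2[OF mass_continuous p]) auto
  ultimately show ?thesis
    unfolding mean_def using pos by (intro continuous_intros) (auto simp: less_imp_neq[symmetric])
qed

end

section \<open>Invertible operators\<close>

lemma blinfun_compose_assoc: "(a o\<^sub>L b) o\<^sub>L c = a o\<^sub>L (b o\<^sub>L c)"
  by (rule blinfun_eqI) simp

lemma blinfun_compose_id [simp]: "id_blinfun o\<^sub>L a = a" "a o\<^sub>L id_blinfun = a"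
  by (rule blinfun_eqI, simp)+

lemmas blinfun_ring = bounded_bilinear.diff_left[OF bounded_bilinear_blinfun_compose]
  bounded_bilinear.diff_right[OF bounded_bilinear_blinfun_compose]
  bounded_bilinear.add_left[OF bounded_bilinear_blinfun_compose]
  bounded_bilinear.add_right[OF bounded_bilinear_blinfun_compose]

lemmas continuous_on_blinfun_compose [continuous_intros] =
  bounded_bilinear.continuous_on[OF bounded_bilinear_blinfun_compose]

lemmas tendsto_blinfun_compose [tendsto_intros] =
  bounded_bilinear.tendsto[OF bounded_bilinear_blinfun_compose]

definition binvertible :: "('e::real_normed_vector \<Rightarrow>\<^sub>L 'e) \<Rightarrow> bool" where
  "binvertible T \<longleftrightarrow> (\<exists>T'. T o\<^sub>L T' = id_blinfun \<and> T' o\<^sub>L T = id_blinfun)"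

definition binv :: "('e::real_normed_vector \<Rightarrow>\<^sub>L 'e) \<Rightarrow> ('e \<Rightarrow>\<^sub>L 'e)" where
  "binv T = (SOME T'. T o\<^sub>L T' = id_blinfun \<and> T' o\<^sub>L T = id_blinfun)"

lemma binv:
  assumes "binvertible T" shows "T o\<^sub>L binv T = id_blinfun" "binv T o\<^sub>L T = id_blinfun"
  using someI_ex[OF assms[unfolded binvertible_def]] unfolding binv_def by auto

lemma binv_cancel:
  assumes "binvertible T"
  shows "T o\<^sub>L (binv T o\<^sub>L a) = a" "binv T o\<^sub>L (T o\<^sub>L a) = a"
  using binv[OF assms] by (simp_all flip: blinfun_compose_assoc)

lemma binvI: "T o\<^sub>L T' = id_blinfun \<Longrightarrow> T' o\<^sub>L T = id_blinfun \<Longrightarrow> binvertible T"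
  unfolding binvertible_def by blast

lemma binv_unique:
  assumes "T o\<^sub>L T' = id_blinfun" "T' o\<^sub>L T = id_blinfun" shows "binv T = T'"
proof -
  have "binv T = (T' o\<^sub>L T) o\<^sub>L binv T" using assms by simp
  also have "\<dots> = T'" unfolding blinfun_compose_assoc using binv[OF binvI[OF assms]] by simp
  finally show ?thesis .
qed

lemma binvertible_id [simp]: "binvertible id_blinfun" and binv_id [simp]: "binv id_blinfun = id_blinfun"
  by (auto intro: binvI binv_unique)

lemma binvertible_compose:
  assumes "binvertible a" "binvertible b"
  shows "binvertible (a o\<^sub>L b)" and "binv (a o\<^sub>L b) = binv b o\<^sub>L binv a"
proof -
  have "(a o\<^sub>L b) o\<^sub>L (binv b o\<^sub>L binv a) = id_blinfun" "(binv b o\<^sub>L binv a) o\<^sub>L (a o\<^sub>L b) = id_blinfun"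
    using assms by (simp_all add: blinfun_compose_assoc binv_cancel binv)
  then show "binvertible (a o\<^sub>L b)" "binv (a o\<^sub>L b) = binv b o\<^sub>L binv a"
    by (rule binvI, rule binv_unique)
qed

lemma binvertible_binv: "binvertible a \<Longrightarrow> binvertible (binv a)"
  using binv binvI by blast

lemma neumann:
  fixes N :: "'e::banach \<Rightarrow>\<^sub>L 'e"
  assumes "norm N \<le> 1/2"
  obtains P where "(id_blinfun - N) o\<^sub>L P = id_blinfun" "P o\<^sub>L (id_blinfun - N) = id_blinfun" "norm P \<le> 2"
proof -
  define a where "a n = ((o\<^sub>L) N ^^ n) id_blinfun" for n
  have a0: "a 0 = id_blinfun" and aS: "a (Suc n) = N o\<^sub>L a n" for n by (simp_all add: a_def)
  have aS': "a (Suc n) = a n o\<^sub>L N" for n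
    by (induction n) (simp_all add: a0 aS[of 0], metis aS blinfun_compose_assoc)
  have norm: "norm (a n) \<le> norm (id_blinfun :: 'e \<Rightarrow>\<^sub>L 'e) * (1/2)^n" for n
  proof (induction n)
    case (Suc n)
    have "norm (a (Suc n)) \<le> norm N * norm (a n)" unfolding aS by (rule norm_blinfun_compose)
    also have "\<dots> \<le> (1/2) * (norm (id_blinfun :: 'e \<Rightarrow>\<^sub>L 'e) * (1/2)^n)"
      using assms Suc by (intro mult_mono) auto
    finally show ?case by simp
  qed (simp add: a0)
  have sum: "summable a"
    by (rule summable_comparison_test'[OF _ norm]) (intro summable_mult summable_geometric, simp)
  define P where "P = suminf a"
  have tl: "(\<Sum>n. a (Suc n)) = P - id_blinfun"
    using suminf_split_head[OF sum] by (simp add: P_def a0)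
  have "N o\<^sub>L P = (\<Sum>n. N o\<^sub>L a n)" unfolding P_def
    by (rule bounded_linear.suminf[OF bounded_bilinear.bounded_linear_right[OF bounded_bilinear_blinfun_compose] sum])
  then have NP: "N o\<^sub>L P = P - id_blinfun" using tl by (simp add: aS)
  have "P o\<^sub>L N = (\<Sum>n. a n o\<^sub>L N)" unfolding P_def
    by (rule bounded_linear.suminf[OF bounded_bilinear.bounded_linear_left[OF bounded_bilinear_blinfun_compose] sum])
  then have PN: "P o\<^sub>L N = P - id_blinfun" using tl by (simp add: aS')
  show thesis
  proof
    show "(id_blinfun - N) o\<^sub>L P = id_blinfun" "P o\<^sub>L (id_blinfun - N) = id_blinfun"
      by (simp_all add: blinfun_ring NP PN)
    \<comment> \<open>Read off the fixed-point equation \<open>P = id + N P\<close> instead of the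
      series: \<open>norm (P e)\<close> is at most \<open>norm e\<close> plus half of
      itself.\<close>
    show "norm P \<le> 2"
    proof (rule norm_blinfun_bound)
      fix e
      have "P e = e + N (P e)"
        using arg_cong[OF NP, of "\<lambda>T. blinfun_apply T e"] by (simp add: blinfun.diff_left)
      then have "norm (P e) \<le> norm e + norm (N (P e))" by (metis norm_triangle_ineq)
      also have "norm (N (P e)) \<le> norm N * norm (P e)" by (rule norm_blinfun)
      also have "norm N * norm (P e) \<le> 1/2 * norm (P e)" using assms by (intro mult_right_mono) auto
      finally show "norm (P e) \<le> 2 * norm e" by simp
    qed simp
  qed
qed

text \<open>Factor \<open>T\<close> as \<open>T0\<close> times \<open>id - N\<close> with
  \<open>N = binv T0 o\<^sub>L (T0 - T)\<close>, whose norm is at most 1/2, and invert by the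
  Neumann series.\<close>

lemma binvertible_perturb:
  fixes T :: "'e::banach \<Rightarrow>\<^sub>L 'e"
  assumes "binvertible T0" "norm (binv T0) \<le> b" "norm (T - T0) \<le> 1 / (2 * b)" "b > 0"
  shows "binvertible T" "norm (binv T) \<le> 2 * b"
proof -
  define N where "N = binv T0 o\<^sub>L (T0 - T)"
  have eq: "id_blinfun - N = binv T0 o\<^sub>L T" unfolding N_def by (simp add: blinfun_ring binv[OF assms(1)])
  have "norm N \<le> norm (binv T0) * norm (T0 - T)" unfolding N_def by (rule norm_blinfun_compose)
  also have "\<dots> \<le> b * (1 / (2 * b))" using assms by (intro mult_mono) (auto simp: norm_minus_commute)
  also have "\<dots> = 1/2" using assms by simp
  finally obtain P where P: "(binv T0 o\<^sub>L T) o\<^sub>L P = id_blinfun" "P o\<^sub>L (binv T0 o\<^sub>L T) = id_blinfun" "norm P \<le> 2"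
    using neumann unfolding eq[symmetric] by blast
  have "T o\<^sub>L (P o\<^sub>L binv T0) = T0 o\<^sub>L (((binv T0 o\<^sub>L T) o\<^sub>L P) o\<^sub>L binv T0)"
    by (simp add: blinfun_compose_assoc binv_cancel[OF assms(1)])
  then have 1: "T o\<^sub>L (P o\<^sub>L binv T0) = id_blinfun" unfolding P using binv[OF assms(1)] by simp
  have 2: "(P o\<^sub>L binv T0) o\<^sub>L T = id_blinfun" using P by (simp add: blinfun_compose_assoc)
  show "binvertible T" using 1 2 by (rule binvI)
  have "binv T = P o\<^sub>L binv T0" using 1 2 by (rule binv_unique)
  then have "norm (binv T) \<le> norm P * norm (binv T0)" by (simp add: norm_blinfun_compose)
  also have "\<dots> \<le> 2 * b" using P assms by (intro mult_mono) auto
  finally show "norm (binv T) \<le> 2 * b" .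
qed

lemma binv_diff:
  assumes "binvertible S" "binvertible T"
  shows "binv T - binv S = binv T o\<^sub>L ((S - T) o\<^sub>L binv S)"
  using assms by (simp add: blinfun_ring blinfun_compose_assoc binv binv_cancel)

text \<open>Near \<open>z\<close> the inverses are uniformly bounded by \<open>2 * b\<close>, which
  turns the resolvent identity \<open>binv_diff\<close> into an estimate linear in the difference.
  Adding 1 in \<open>b\<close> keeps it positive on the zero space.\<close>

lemma continuous_on_binv [continuous_intros]:
  fixes T :: "'z::topological_space \<Rightarrow> ('e::banach \<Rightarrow>\<^sub>L 'e)"
  assumes "continuous_on A T" "\<And>z. z \<in> A \<Longrightarrow> binvertible (T z)"
  shows "continuous_on A (\<lambda>z. binv (T z))"
  unfolding continuous_on_def
proof
  fix z assume z: "z \<in> A"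
  have Tz: "(T \<longlongrightarrow> T z) (at z within A)" using assms(1) z by (simp add: continuous_on_def)
  define b where "b = norm (binv (T z)) + 1"
  have b: "b > 0" "norm (binv (T z)) \<le> b" unfolding b_def by (auto intro: add_nonneg_pos)
  have "((\<lambda>w. binv (T w) - binv (T z)) \<longlongrightarrow> 0) (at z within A)"
  proof (rule Lim_null_comparison)
    have "\<forall>\<^sub>F w in at z within A. dist (T w) (T z) < 1 / (2 * b)"
      using tendstoD[OF Tz] b by simp
    moreover have "\<forall>\<^sub>F w in at z within A. w \<in> A" by (auto simp: eventually_at_topological)
    ultimately show "\<forall>\<^sub>F w in at z within A. norm (binv (T w) - binv (T z)) \<le> (2 * b) * (norm (T z - T w) * b)"
    proof eventually_elim
      fix w assume w: "dist (T w) (T z) < 1 / (2 * b)" "w \<in> A"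
      have n: "norm (binv (T w)) \<le> 2 * b"
        by (rule binvertible_perturb(2)[OF assms(2)[OF z] b(2) _ b(1)]) (use w in \<open>simp add: dist_norm\<close>)
      have "norm (binv (T w) - binv (T z)) \<le> norm (binv (T w)) * norm ((T z - T w) o\<^sub>L binv (T z))"
        unfolding binv_diff[OF assms(2)[OF z] assms(2)[OF w(2)]] by (rule norm_blinfun_compose)
      also have "\<dots> \<le> (2 * b) * (norm (T z - T w) * b)"
        using n b by (intro mult_mono order_trans[OF norm_blinfun_compose]) (auto intro: mult_left_mono)
      finally show "norm (binv (T w) - binv (T z)) \<le> (2 * b) * (norm (T z - T w) * b)" .
    qed
    have "((\<lambda>w. (2 * b) * (norm (T z - T w) * b)) \<longlongrightarrow> (2 * b) * (norm (T z - T z) * b)) (at z within A)"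
      by (intro tendsto_intros Tz)
    then show "((\<lambda>w. (2 * b) * (norm (T z - T w) * b)) \<longlongrightarrow> 0) (at z within A)" by simp
  qed
  then show "((\<lambda>z. binv (T z)) \<longlongrightarrow> binv (T z)) (at z within A)" by (simp add: LIM_zero_iff)
qed

section \<open>Banach modules and operators commuting with the action\<close>

locale banach_mod =
  fixes act :: "'a::{real_normed_algebra_1, banach} \<Rightarrow> 'e::banach \<Rightarrow> 'e"
  assumes bm: "banach_module act"
begin

definition op :: "'a \<Rightarrow> ('e \<Rightarrow>\<^sub>L 'e)" where "op a = Blinfun (act a)"

lemma act_add_left: "act (a + b) e = act a e + act b e"
  and act_add_right: "act a (e + f) = act a e + act a f"
  and act_scale_left: "act (r *\<^sub>R a) e = r *\<^sub>R act a e"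
  and act_scale_right: "act a (r *\<^sub>R e) = r *\<^sub>R act a e"
  and act_mult: "act (a * b) e = act a (act b e)"
  and act_one: "act 1 e = e"
  and act_norm: "norm (act a e) \<le> norm a * norm e"
  using bm unfolding banach_module_def by simp_all

lemma op_apply [simp]: "blinfun_apply (op a) e = act a e"
proof -
  have "bounded_linear (act a)"
    by (rule bounded_linear_intro[of _ "norm a"])
      (auto simp: act_add_right act_scale_right act_norm mult.commute)
  then show ?thesis by (simp add: op_def bounded_linear_Blinfun_apply)
qed

lemma bounded_linear_op: "bounded_linear op"
proof (rule bounded_linear_intro[of _ 1])
  show "norm (op a) \<le> norm a * 1" for a
    by (rule norm_blinfun_bound) (auto simp: act_norm)
qed (auto intro!: blinfun_eqI simp: act_add_left act_scale_left blinfun.add_left blinfun.scaleR_left)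

lemma op_mult: "op (a * b) = op a o\<^sub>L op b" and op_one: "op 1 = id_blinfun"
  by (auto intro!: blinfun_eqI simp: act_mult act_one)

text \<open>Linearity over the algebra phrased as commutation of operators, so that the scalars of
  the multiplier can be moved around inside compositions.\<close>

definition Alin :: "('e \<Rightarrow>\<^sub>L 'e) \<Rightarrow> bool" where
  "Alin T \<longleftrightarrow> (\<forall>a. T o\<^sub>L op a = op a o\<^sub>L T)"

lemma AlinD: "Alin T \<Longrightarrow> T o\<^sub>L op a = op a o\<^sub>L T" by (simp add: Alin_def)

lemma GL_A_iff: "T \<in> GL_A act \<longleftrightarrow> Alin T \<and> binvertible T"
proof -
  have "Alin T \<longleftrightarrow> (\<forall>a e. T (act a e) = act a (T e))"
    unfolding Alin_def by (auto simp: blinfun_eqI dest: arg_cong[of _ _ blinfun_apply] fun_cong)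
      (metis blinfun_apply_blinfun_compose op_apply)
  then show ?thesis by (simp add: GL_A_def binvertible_def)
qed

lemma Alin_id: "Alin id_blinfun" by (simp add: Alin_def)

lemma Alin_compose: "Alin S \<Longrightarrow> Alin T \<Longrightarrow> Alin (S o\<^sub>L T)"
  unfolding Alin_def by (simp add: blinfun_compose_assoc) (simp flip: blinfun_compose_assoc)

lemma Alin_add: "Alin S \<Longrightarrow> Alin T \<Longrightarrow> Alin (S + T)"
  and Alin_diff: "Alin S \<Longrightarrow> Alin T \<Longrightarrow> Alin (S - T)"
  by (simp_all add: Alin_def blinfun_ring)

lemma Alin_scaleR: "Alin T \<Longrightarrow> Alin (r *\<^sub>R T)"
  by (simp add: Alin_def bounded_bilinear.scaleR_left[OF bounded_bilinear_blinfun_compose]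
      bounded_bilinear.scaleR_right[OF bounded_bilinear_blinfun_compose])

lemma Alin_sum: "(\<And>j. j \<in> J \<Longrightarrow> Alin (T j)) \<Longrightarrow> Alin (\<Sum>j\<in>J. T j)"
proof (induction J rule: infinite_finite_induct)
  case (insert j J)
  then show ?case by (simp add: Alin_add)
qed (simp_all add: Alin_def)

lemma Alin_binv:
  assumes "Alin T" "binvertible T" shows "Alin (binv T)"
  unfolding Alin_def
proof
  fix a
  have "binv T o\<^sub>L op a = binv T o\<^sub>L (op a o\<^sub>L T) o\<^sub>L binv T"
    by (simp add: blinfun_compose_assoc binv[OF assms(2)])
  also have "\<dots> = op a o\<^sub>L binv T"
    by (simp add: blinfun_compose_assoc binv_cancel[OF assms(2)] flip: AlinD[OF assms(1)])
  finally show "binv T o\<^sub>L op a = op a o\<^sub>L binv T" .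
qed

lemma Alin_limit:
  assumes "X \<longlonglongrightarrow> T" "\<And>n. Alin (X n)" shows "Alin T"
  unfolding Alin_def
proof
  fix a
  have "(\<lambda>n. X n o\<^sub>L op a) \<longlonglongrightarrow> (T o\<^sub>L op a)" "(\<lambda>n. op a o\<^sub>L X n) \<longlonglongrightarrow> (op a o\<^sub>L T)"
    by (intro tendsto_intros assms)+
  then show "T o\<^sub>L op a = op a o\<^sub>L T"
    using LIMSEQ_unique assms(2) by (simp add: Alin_def)
qed

end

section \<open>Newton iteration for near representations\<close>

locale twisted = lc_groupoid s t u m i \<mu> + banach_mod act
  for s t :: "'g::t2_space \<Rightarrow> 'x::topological_space"
    and u :: "'x \<Rightarrow> 'g" and m :: "'g \<Rightarrow> 'g \<Rightarrow> 'g" and i :: "'g \<Rightarrow> 'g"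
    and \<mu> :: "'x \<Rightarrow> 'g measure"
    and act :: "'a::{real_normed_algebra_1, banach} \<Rightarrow> 'e::banach \<Rightarrow> 'e" +
  fixes \<sigma> :: "'g \<Rightarrow> 'g \<Rightarrow> 'a"
  assumes mult: "multiplier s t u m \<sigma>"
begin

lemmas multD = mult[unfolded multiplier_def]

lemma sigma_central: "s g = t h \<Longrightarrow> \<sigma> g h * a = a * \<sigma> g h"
  using multD[THEN conjunct2, THEN conjunct2, THEN conjunct1] by blast

lemma sigma_unit: "s g = t h \<Longrightarrow> g \<in> range u \<or> h \<in> range u \<Longrightarrow> \<sigma> g h = 1"
  using multD[THEN conjunct2, THEN conjunct2, THEN conjunct2, THEN conjunct1] by blast

lemma sigma_cocycle: "s g = t h \<Longrightarrow> s h = t k \<Longrightarrow> \<sigma> g h * \<sigma> (m g h) k = \<sigma> h k * \<sigma> g (m h k)"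
  using multD[THEN conjunct2, THEN conjunct2, THEN conjunct2, THEN conjunct2] by blast

definition \<rho> :: "'g \<Rightarrow> 'g \<Rightarrow> ('e \<Rightarrow>\<^sub>L 'e)" where "\<rho> g h = op (\<sigma> g h)"

abbreviation rg :: "'x set \<Rightarrow> 'g set" where "rg \<equiv> restrict_groupoid s t"

lemma rg_iff: "g \<in> rg V \<longleftrightarrow> s g \<in> V \<and> t g \<in> V"
  by (auto simp: restrict_groupoid_def)

lemma continuous_rho [continuous_intros]:
  assumes "continuous_on A f" "continuous_on A h" "\<And>z. z \<in> A \<Longrightarrow> s (f z) = t (h z)"
  shows "continuous_on A (\<lambda>z. \<rho> (f z) (h z))"
proof -
  have "continuous_on (composable s t) (\<lambda>(g, h). \<sigma> g h)"
    using multD by (rule conjunct1)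
  from continuous_on_compose2[OF this continuous_on_Pair[OF assms(1,2)]]
  have "continuous_on A (\<lambda>z. \<sigma> (f z) (h z))" using assms(3) by (auto simp: composable_def)
  then show ?thesis unfolding \<rho>_def by (rule bounded_linear.continuous_on[OF bounded_linear_op])
qed

lemma rho_binvertible: "s g = t h \<Longrightarrow> binvertible (\<rho> g h)"
proof -
  assume "s g = t h"
  then obtain b where "\<sigma> g h * b = 1" "b * \<sigma> g h = 1"
    using multD[THEN conjunct2, THEN conjunct1] by blast
  then have "op (\<sigma> g h) o\<^sub>L op b = id_blinfun" "op b o\<^sub>L op (\<sigma> g h) = id_blinfun"
    by (simp_all flip: op_mult add: op_one)
  then show ?thesis unfolding \<rho>_def by (rule binvI)
qed

lemma rho_commute: "Alin T \<Longrightarrow> T o\<^sub>L \<rho> g h = \<rho> g h o\<^sub>L T"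
  unfolding \<rho>_def by (rule AlinD)

text \<open>Here centrality of the multiplier is used: multiplication by a central element is itself
  linear over the algebra.\<close>

lemma Alin_rho: "s g = t h \<Longrightarrow> Alin (\<rho> g h)"
  unfolding Alin_def \<rho>_def op_mult[symmetric] using sigma_central by simp

lemma rho_unit: "\<rho> (u (t g)) g = id_blinfun" "\<rho> g (u (s g)) = id_blinfun"
  unfolding \<rho>_def using sigma_unit[of "u (t g)" g] sigma_unit[of g "u (s g)"]
  by (simp_all add: op_one)

lemma rho_cocycle:
  "s g = t h \<Longrightarrow> s h = t k \<Longrightarrow> \<rho> g h o\<^sub>L \<rho> (m g h) k = \<rho> h k o\<^sub>L \<rho> g (m h k)"
  unfolding \<rho>_def op_mult[symmetric] using sigma_cocycle by simp

lemma uc_rep_iff: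
  "uc_sigma_rep s t u m \<sigma> act H Y R \<longleftrightarrow> (\<forall>g\<in>H. Alin (R g) \<and> binvertible (R g)) \<and> continuous_on H R \<and>
     (\<forall>y\<in>Y. R (u y) = id_blinfun) \<and>
     (\<forall>g\<in>H. \<forall>h\<in>H. s g = t h \<longrightarrow> \<rho> g h o\<^sub>L R (m g h) = R g o\<^sub>L R h)"
proof -
  have "\<rho> g h o\<^sub>L R (m g h) = R g o\<^sub>L R h \<longleftrightarrow> (\<forall>e. act (\<sigma> g h) (R (m g h) e) = R g (R h e))" for g h
    unfolding \<rho>_def by (metis blinfun_apply_blinfun_compose blinfun_eqI op_apply)
  then show ?thesis unfolding uc_sigma_rep_def GL_A_iff by simp
qed

text \<open>Only the inverses are bounded, not \<open>T\<close>: the restricted groupoid need not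
  have compact closure, and \<open>T (m g k)\<close> composed with \<open>binv (T k)\<close> is
  compared to \<open>T g\<close> through the defect and the inverse alone. Units are respected
  exactly.\<close>

definition near :: "'x set \<Rightarrow> real \<Rightarrow> real \<Rightarrow> ('g \<Rightarrow> ('e \<Rightarrow>\<^sub>L 'e)) \<Rightarrow> bool" where
  "near V \<beta> \<delta> T \<longleftrightarrow> continuous_on (rg V) T \<and>
     (\<forall>g\<in>rg V. Alin (T g) \<and> binvertible (T g) \<and> norm (binv (T g)) \<le> \<beta>) \<and>
     (\<forall>y\<in>V. T (u y) = id_blinfun) \<and>
     (\<forall>g\<in>rg V. \<forall>h\<in>rg V. s g = t h \<longrightarrow> norm ((T g o\<^sub>L T h) - (\<rho> g h o\<^sub>L T (m g h))) \<le> \<delta>)"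

lemma nearD:
  assumes "near V \<beta> \<delta> T"
  shows "continuous_on (rg V) T" "\<And>g. g \<in> rg V \<Longrightarrow> Alin (T g)" "\<And>g. g \<in> rg V \<Longrightarrow> binvertible (T g)"
    "\<And>g. g \<in> rg V \<Longrightarrow> norm (binv (T g)) \<le> \<beta>" "\<And>y. y \<in> V \<Longrightarrow> T (u y) = id_blinfun"
    "\<And>g h. g \<in> rg V \<Longrightarrow> h \<in> rg V \<Longrightarrow> s g = t h \<Longrightarrow> norm ((T g o\<^sub>L T h) - (\<rho> g h o\<^sub>L T (m g h))) \<le> \<delta>"
  using assms unfolding near_def by auto

end

section \<open>The averaging step and its quadratic defect\<close>

locale twisted_mean = twisted s t u m i \<mu> act \<sigma> + haar_mean s t u m i \<mu> c
  for s t :: "'g::t2_space \<Rightarrow> 'x::topological_space"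
    and u :: "'x \<Rightarrow> 'g" and m :: "'g \<Rightarrow> 'g \<Rightarrow> 'g" and i :: "'g \<Rightarrow> 'g"
    and \<mu> :: "'x \<Rightarrow> 'g measure"
    and act :: "'a::{real_normed_algebra_1, banach} \<Rightarrow> 'e::banach \<Rightarrow> 'e"
    and \<sigma> :: "'g \<Rightarrow> 'g \<Rightarrow> 'a" and c :: "'x \<Rightarrow> real"
begin

lemma adm_translate:
  assumes "adm (t h) f" shows "adm (s h) (\<lambda>k. f (m h k))"
proof -
  have sub: "(\<lambda>k. m h k) ` D (s h) \<subseteq> D (t h)" by (auto simp: D_def)
  have "continuous_on (D (s h)) (\<lambda>k. f (m h k))"
    by (rule continuous_on_compose2[of "D (t h)" f, OF _ _ sub])
      (use assms in \<open>auto simp: adm_def D_def intro!: continuous_intros\<close>)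
  moreover have "(\<lambda>k. f (m h k)) ` D (s h) \<subseteq> f ` D (t h)" using sub by auto
  ultimately show ?thesis using assms by (auto simp: adm_def intro: bounded_subset)
qed

lemma adm_compose:
  assumes "adm y f" "adm y h"
  shows "adm y (\<lambda>k. (f k :: 'e \<Rightarrow>\<^sub>L 'e) o\<^sub>L h k)"
proof -
  obtain B where B: "\<And>k. k \<in> D y \<Longrightarrow> norm (f k) \<le> B" using assms(1) by (auto simp: adm_def bounded_iff)
  obtain C where C: "\<And>k. k \<in> D y \<Longrightarrow> norm (h k) \<le> C" using assms(2) by (auto simp: adm_def bounded_iff)
  have "norm (f k o\<^sub>L h k) \<le> B * C" if "k \<in> D y" for k
  proof -
    have "0 \<le> B" using B[OF that] norm_ge_zero order_trans by blast
    then show ?thesis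
      using mult_mono[OF B[OF that] C[OF that]] norm_blinfun_compose[of "f k" "h k"] by simp
  qed
  then have "bounded ((\<lambda>k. f k o\<^sub>L h k) ` D y)" by (auto simp: bounded_iff)
  then show ?thesis using assms by (auto simp: adm_def intro!: continuous_intros)
qed

lemma mean_compose_left:
  "adm y f \<Longrightarrow> mean y (\<lambda>k. A o\<^sub>L (f k :: 'e \<Rightarrow>\<^sub>L 'e)) = (A o\<^sub>L mean y f)"
  by (rule mean_linear[OF bounded_bilinear.bounded_linear_right[OF bounded_bilinear_blinfun_compose]])

lemma mean_compose_right:
  "adm y f \<Longrightarrow> mean y (\<lambda>k. (f k :: 'e \<Rightarrow>\<^sub>L 'e) o\<^sub>L A) = (mean y f o\<^sub>L A)"
  by (rule mean_linear[OF bounded_bilinear.bounded_linear_left[OF bounded_bilinear_blinfun_compose]])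

lemma Alin_mean:
  assumes "adm y f" "\<And>k. k \<in> D y \<Longrightarrow> Alin (f k)"
  shows "Alin (mean y f)"
  unfolding Alin_def
proof
  fix a
  have "(mean y f o\<^sub>L op a) = mean y (\<lambda>k. f k o\<^sub>L op a)" by (simp add: mean_compose_right[OF assms(1)])
  also have "\<dots> = mean y (\<lambda>k. op a o\<^sub>L f k)" by (rule mean_cong) (rule AlinD[OF assms(2)])
  also have "\<dots> = (op a o\<^sub>L mean y f)" by (rule mean_compose_left[OF assms(1)])
  finally show "mean y f o\<^sub>L op a = op a o\<^sub>L mean y f" .
qed

text \<open>The set over which \<open>mass_pos\<close> applies; for a base point in it, every arrow
  seen by the weight stays in the restricted groupoid.\<close>

abbreviation V :: "'x set" where "V \<equiv> {y. c y \<noteq> 0}"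

lemma D_rg: "y \<in> V \<Longrightarrow> k \<in> D y \<Longrightarrow> k \<in> rg V"
  by (auto simp: D_def rg_iff)

lemma m_rg: "g \<in> rg V \<Longrightarrow> k \<in> D (s g) \<Longrightarrow> m g k \<in> rg V"
  by (auto simp: D_def rg_iff)

lemma s_rg: "g \<in> rg V \<Longrightarrow> s g \<in> V" by (simp add: rg_iff)

text \<open>For an exact representation this equals \<open>T g\<close> for every \<open>k\<close>,
  so its deviation from \<open>T g\<close> is the defect at the pair \<open>g\<close>,
  \<open>k\<close> composed with \<open>binv (T k)\<close>.\<close>

definition integrand :: "('g \<Rightarrow> ('e \<Rightarrow>\<^sub>L 'e)) \<Rightarrow> 'g \<Rightarrow> 'g \<Rightarrow> ('e \<Rightarrow>\<^sub>L 'e)" where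
  "integrand T g k = (\<rho> g k o\<^sub>L (T (m g k) o\<^sub>L binv (T k)))"

definition avg :: "('g \<Rightarrow> ('e \<Rightarrow>\<^sub>L 'e)) \<Rightarrow> 'g \<Rightarrow> ('e \<Rightarrow>\<^sub>L 'e)" where
  "avg T g = mean (s g) (integrand T g)"

context
  fixes T \<beta> \<delta> assumes near: "near V \<beta> \<delta> T"
begin

lemma integrand_close:
  assumes "g \<in> rg V" "k \<in> D (s g)" shows "norm (integrand T g k - T g) \<le> \<delta> * \<beta>"
proof -
  have k: "k \<in> rg V" "s g = t k" using D_rg[OF s_rg[OF assms(1)] assms(2)] assms(2) by (auto simp: D_def)
  have "integrand T g k - T g = (((\<rho> g k o\<^sub>L T (m g k)) - (T g o\<^sub>L T k)) o\<^sub>L binv (T k))"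
    by (simp add: integrand_def blinfun_ring blinfun_compose_assoc binv[OF nearD(3)[OF near k(1)]])
  then have "norm (integrand T g k - T g) \<le> norm ((\<rho> g k o\<^sub>L T (m g k)) - (T g o\<^sub>L T k)) * norm (binv (T k))"
    by (simp add: norm_blinfun_compose)
  also have "\<dots> \<le> \<delta> * \<beta>"
  proof (rule mult_mono)
    show 1: "norm ((\<rho> g k o\<^sub>L T (m g k)) - (T g o\<^sub>L T k)) \<le> \<delta>"
      using nearD(6)[OF near assms(1) k] by (simp add: norm_minus_commute)
    show "0 \<le> \<delta>" using 1 norm_ge_zero order_trans by blast
  qed (use nearD(4)[OF near k(1)] in auto)
  finally show ?thesis .
qed

lemma integrand_continuous:
  "continuous_on {(g, k). g \<in> rg V \<and> k \<in> D (s g)} (\<lambda>(g, k). integrand T g k)"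
proof -
  let ?A = "{(g, k). g \<in> rg V \<and> k \<in> D (s g)}"
  have comp: "s (fst w) = t (snd w)" and w: "fst w \<in> rg V" "snd w \<in> rg V" "m (fst w) (snd w) \<in> rg V"
    if "w \<in> ?A" for w
    using that D_rg[OF s_rg] m_rg by (auto simp: D_def)
  have c: "continuous_on ?A fst" "continuous_on ?A snd"
    by (rule continuous_on_fst[OF continuous_on_id], rule continuous_on_snd[OF continuous_on_id])
  have "continuous_on ?A (\<lambda>w. T (m (fst w) (snd w)))"
    by (rule continuous_on_compose2[OF nearD(1)[OF near] continuous_m[OF c comp]]) (use w in auto)
  moreover have "continuous_on ?A (\<lambda>w. T (snd w))"
    by (rule continuous_on_compose2[OF nearD(1)[OF near] c(2)]) (use w in auto)
  then have "continuous_on ?A (\<lambda>w. binv (T (snd w)))"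
    by (rule continuous_on_binv) (use w nearD(3)[OF near] in auto)
  ultimately have "continuous_on ?A (\<lambda>w. integrand T (fst w) (snd w))"
    unfolding integrand_def by (intro continuous_on_blinfun_compose continuous_rho c comp)
  then show ?thesis by (simp add: case_prod_unfold)
qed

lemma integrand_adm:
  assumes "g \<in> rg V" shows "adm (s g) (integrand T g)"
  unfolding adm_def
proof
  have "continuous_on (D (s g)) (\<lambda>k. (g, k))"
    by (intro continuous_on_Pair continuous_on_const continuous_on_id)
  from continuous_on_compose2[OF integrand_continuous this]
  show "continuous_on (D (s g)) (integrand T g)" using assms by auto
  have "norm (integrand T g k) \<le> norm (T g) + \<delta> * \<beta>" if "k \<in> D (s g)" for k
    using norm_triangle_sub[of "integrand T g k" "T g"] integrand_close[OF assms that] by simp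
  then show "bounded (integrand T g ` D (s g))" by (auto simp: bounded_iff)
qed

lemma integrand_Alin:
  assumes "g \<in> rg V" "k \<in> D (s g)" shows "Alin (integrand T g k)"
  unfolding integrand_def using assms D_rg[OF s_rg[OF assms(1)] assms(2)] m_rg[OF assms]
  by (intro Alin_compose Alin_rho Alin_binv nearD(2,3)[OF near]) (auto simp: D_def)

lemma avg_Alin: "g \<in> rg V \<Longrightarrow> Alin (avg T g)"
  unfolding avg_def by (rule Alin_mean[OF integrand_adm integrand_Alin])

lemma mass_s_pos: "g \<in> rg V \<Longrightarrow> mass (s g) > 0"
  using mass_pos s_rg by simp

lemma avg_close:
  assumes "g \<in> rg V" shows "norm (avg T g - T g) \<le> \<delta> * \<beta>"
proof -
  have "avg T g - T g = mean (s g) (\<lambda>k. integrand T g k - T g)"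
    unfolding avg_def
    by (simp add: mean_diff[OF integrand_adm[OF assms] adm_const] mean_const[OF mass_s_pos[OF assms]])
  then show ?thesis
    using mean_norm_le[OF mass_s_pos[OF assms] adm_diff[OF integrand_adm[OF assms] adm_const]]
      integrand_close[OF assms] by simp
qed

text \<open>At a unit the integrand is \<open>T k\<close> composed with its own inverse, so the
  normalisation survives averaging without error.\<close>

lemma avg_unit:
  assumes "y \<in> V" shows "avg T (u y) = id_blinfun"
proof -
  have "integrand T (u y) k = id_blinfun" if "k \<in> D y" for k
  proof -
    have k: "t k = y" "k \<in> rg V" using that D_rg[OF assms] by (auto simp: D_def)
    have "\<rho> (u y) k = id_blinfun" "m (u y) k = k" using rho_unit(1)[of k] m_u_left[of k] k by auto
    then show ?thesis using binv(1)[OF nearD(3)[OF near k(2)]] by (simp add: integrand_def)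
  qed
  then have "avg T (u y) = mean y (\<lambda>k. id_blinfun)"
    unfolding avg_def s_u by (rule mean_cong)
  also have "\<dots> = id_blinfun" by (rule mean_const[OF mass_pos]) (use assms in simp)
  finally show ?thesis .
qed

lemma avg_continuous: "continuous_on (rg V) (avg T)"
  unfolding avg_def[abs_def]
proof (rule mean_continuous[OF integrand_continuous _ mass_s_pos])
  show "continuous_on (rg V) s" by (intro continuous_s continuous_on_id)
  fix g assume g: "g \<in> rg V"
  obtain N where N: "open N" "g \<in> N" "\<forall>h\<in>rg V. h \<in> N \<longrightarrow> T h \<in> ball (T g) 1"
    using nearD(1)[OF near, unfolded continuous_on_topological, rule_format, OF g open_ball, of "T g" 1]
    by auto
  show "\<exists>N B. open N \<and> g \<in> N \<and> (\<forall>h\<in>rg V \<inter> N. \<forall>k\<in>D (s h). norm (integrand T h k) \<le> B)"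
  proof (intro exI[of _ N] exI[of _ "norm (T g) + 1 + \<delta> * \<beta>"] conjI ballI)
    fix h k assume h: "h \<in> rg V \<inter> N" "k \<in> D (s h)"
    then have "norm (T h - T g) < 1" using N(3) by (auto simp: dist_norm norm_minus_commute)
    then have "norm (T h) \<le> norm (T g) + 1" using norm_triangle_sub[of "T h" "T g"] by linarith
    then show "norm (integrand T h k) \<le> norm (T g) + 1 + \<delta> * \<beta>"
      using norm_triangle_sub[of "integrand T h k" "T h"] integrand_close[of h k] h by simp
  qed (use N in auto)
qed

text \<open>This holds exactly, whatever the defect of \<open>T\<close>: the inverse of
  \<open>T (m h k)\<close> in the first factor cancels \<open>T (m h k)\<close> in the second, and
  the cocycle identity collects the scalars. The shift of \<open>k\<close> to \<open>m h k\<close>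
  is absorbed by invariance of the mean.\<close>

lemma integrand_product:
  assumes "g \<in> rg V" "h \<in> rg V" "s g = t h" "k \<in> D (s h)"
  shows "integrand T g (m h k) o\<^sub>L integrand T h k = \<rho> g h o\<^sub>L integrand T (m g h) k"
proof -
  have k: "s h = t k" "k \<in> rg V" "m h k \<in> rg V" "m g h \<in> rg V"
    using assms D_rg[OF s_rg[OF assms(2)] assms(4)] m_rg[OF assms(2,4)] by (auto simp: D_def rg_iff)
  have hk: "Alin (T (m h k))" "binvertible (T (m h k))"
    using nearD(2,3)[OF near] k by auto
  have ghk: "Alin (T (m (m g h) k))"
    using nearD(2)[OF near] assms k by (simp add: rg_iff)
  have "integrand T g (m h k) o\<^sub>L integrand T h k
     = \<rho> g (m h k) o\<^sub>L T (m (m g h) k) o\<^sub>L binv (T (m h k)) o\<^sub>L (\<rho> h k o\<^sub>L T (m h k)) o\<^sub>L binv (T k)"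
    using assms k by (simp add: integrand_def blinfun_compose_assoc m_assoc)
  also have "\<dots> = \<rho> g (m h k) o\<^sub>L (T (m (m g h) k) o\<^sub>L \<rho> h k) o\<^sub>L binv (T k)"
    unfolding rho_commute[OF hk(1), symmetric] by (simp add: blinfun_compose_assoc binv_cancel[OF hk(2)])
  also have "\<dots> = (\<rho> g (m h k) o\<^sub>L \<rho> h k) o\<^sub>L T (m (m g h) k) o\<^sub>L binv (T k)"
    unfolding rho_commute[OF ghk] by (simp add: blinfun_compose_assoc)
  also have "\<rho> g (m h k) o\<^sub>L \<rho> h k = \<rho> g h o\<^sub>L \<rho> (m g h) k"
    using rho_cocycle[OF assms(3) k(1)] rho_commute[OF Alin_rho] assms k by simp
  finally show ?thesis by (simp add: integrand_def blinfun_compose_assoc)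
qed

text \<open>Since the mean of \<open>a b\<close> is \<open>\<rho> g h\<close> times the average at \<open>g h\<close>, the new defect is a covariance,
  and covariances of functions that are nearly constant are quadratically small.\<close>
lemma avg_defect:
  assumes "g \<in> rg V" "h \<in> rg V" "s g = t h"
  shows "norm ((avg T g o\<^sub>L avg T h) - (\<rho> g h o\<^sub>L avg T (m g h))) \<le> 4 * \<delta>\<^sup>2 * \<beta>\<^sup>2"
proof -
  let ?A = "avg T g" and ?B = "avg T h"
  define a where "a k = integrand T g (m h k)" for k
  define b where "b = integrand T h"
  have gh: "m g h \<in> rg V" using assms by (simp add: rg_iff)
  have adm_g: "adm (t h) (integrand T g)" using integrand_adm[OF assms(1)] assms(3) by simp
  have a: "adm (s h) a" unfolding a_def by (rule adm_translate[OF adm_g])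
  have b: "adm (s h) b" unfolding b_def by (rule integrand_adm[OF assms(2)])
  have ma: "mean (s h) a = ?A" unfolding a_def avg_def assms(3) by (rule mean_invariant[OF adm_g])
  have mb: "mean (s h) b = ?B" unfolding b_def avg_def ..
  have sgh: "s (m g h) = s h" using assms by simp
  have "mean (s h) (\<lambda>k. a k o\<^sub>L b k) = mean (s h) (\<lambda>k. \<rho> g h o\<^sub>L integrand T (m g h) k)"
    unfolding a_def b_def by (rule mean_cong) (rule integrand_product[OF assms])
  also have "\<dots> = (\<rho> g h o\<^sub>L avg T (m g h))"
    unfolding avg_def sgh by (rule mean_compose_left) (use integrand_adm[OF gh] sgh in simp)
  finally have mab: "mean (s h) (\<lambda>k. a k o\<^sub>L b k) = (\<rho> g h o\<^sub>L avg T (m g h))" .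
  note adms = adm_compose[OF a b] adm_compose[OF a adm_const[of _ ?B]] adm_compose[OF adm_const[of _ ?A] b]
    adm_const[of "s h" "?A o\<^sub>L ?B"]
  have expand: "(a k - ?A) o\<^sub>L (b k - ?B) = ((a k o\<^sub>L b k) - (a k o\<^sub>L ?B)) - ((?A o\<^sub>L b k) - (?A o\<^sub>L ?B))" for k
    by (simp add: blinfun_ring)
  have "mean (s h) (\<lambda>k. (a k - ?A) o\<^sub>L (b k - ?B))
      = (mean (s h) (\<lambda>k. a k o\<^sub>L b k) - mean (s h) (\<lambda>k. a k o\<^sub>L ?B))
        - (mean (s h) (\<lambda>k. ?A o\<^sub>L b k) - mean (s h) (\<lambda>k. ?A o\<^sub>L ?B))"
    unfolding expand using adms by (simp add: mean_diff adm_diff)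
  also have "\<dots> = (\<rho> g h o\<^sub>L avg T (m g h)) - (?A o\<^sub>L ?B)"
    unfolding mab mean_compose_right[OF a] mean_compose_left[OF b] ma mb
    using mean_const[OF mass_s_pos[OF assms(2)]] by simp
  finally have eq: "mean (s h) (\<lambda>k. (a k - ?A) o\<^sub>L (b k - ?B)) = (\<rho> g h o\<^sub>L avg T (m g h)) - (?A o\<^sub>L ?B)" .
  \<comment> \<open>Each factor lies within \<open>\<delta> * \<beta>\<close> of the old value, and
    so does its mean; hence twice that amount between integrand and mean, and the constant 4 in the
    product.\<close>
  have "norm (mean (s h) (\<lambda>k. (a k - ?A) o\<^sub>L (b k - ?B))) \<le> (2 * (\<delta> * \<beta>)) * (2 * (\<delta> * \<beta>))"
  proof (rule mean_norm_le[OF mass_s_pos[OF assms(2)]])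
    show "adm (s h) (\<lambda>k. (a k - ?A) o\<^sub>L (b k - ?B))"
      by (intro adm_compose adm_diff a b adm_const)
    fix k assume k: "k \<in> D (s h)"
    then have hk: "m h k \<in> D (s g)" using assms(3) by (auto simp: D_def)
    have 1: "norm (a k - ?A) \<le> 2 * (\<delta> * \<beta>)"
      using norm_triangle_ineq4[of "a k - T g" "?A - T g"] integrand_close[OF assms(1) hk] avg_close[OF assms(1)]
      by (simp add: a_def)
    have 2: "norm (b k - ?B) \<le> 2 * (\<delta> * \<beta>)"
      using norm_triangle_ineq4[of "b k - T h" "?B - T h"] integrand_close[OF assms(2) k] avg_close[OF assms(2)]
      by (simp add: b_def)
    have "norm (a k - ?A) * norm (b k - ?B) \<le> (2 * (\<delta> * \<beta>)) * (2 * (\<delta> * \<beta>))"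
      by (rule mult_mono[OF 1 2 order_trans[OF norm_ge_zero 1] norm_ge_zero])
    then show "norm ((a k - ?A) o\<^sub>L (b k - ?B)) \<le> (2 * (\<delta> * \<beta>)) * (2 * (\<delta> * \<beta>))"
      using norm_blinfun_compose order_trans by blast
  qed
  then show ?thesis unfolding eq by (simp add: norm_minus_commute power2_eq_square mult_ac)
qed

end

lemma near_avg:
  assumes "near V \<beta> \<delta> T" "\<And>g. g \<in> rg V \<Longrightarrow> binvertible (avg T g) \<and> norm (binv (avg T g)) \<le> \<beta>'"
    "4 * \<delta>\<^sup>2 * \<beta>\<^sup>2 \<le> \<delta>'"
  shows "near V \<beta>' \<delta>' (avg T)"
  using avg_continuous[OF assms(1)] avg_Alin[OF assms(1)] assms(2) avg_unit[OF assms(1)]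
    order_trans[OF avg_defect[OF assms(1)] assms(3)]
  unfolding near_def by blast

text \<open>The bound on inverses is relaxed once to \<open>2 * \<beta>\<close> and kept throughout.
  A defect d then becomes at most 16 d^2 \<beta>^2, which is at most d/2 because 32 \<delta>
  \<beta>^2 \<le> 1; only this halving is tracked. The n-th step moves \<open>T\<close> by at most 2
  \<delta> \<beta> / 2^n, in total 4 \<delta> \<beta>, which is at most 1 / (2 \<beta>) and so
  preserves the bound on inverses.\<close>

theorem near_rep:
  assumes near: "near V \<beta> \<delta> T0" and pos: "\<beta> > 0" "\<delta> \<ge> 0" and small: "32 * \<delta> * \<beta>\<^sup>2 \<le> 1"
  shows "\<exists>R. uc_sigma_rep s t u m \<sigma> act (rg V) V R \<and> (\<forall>g\<in>rg V. norm (R g - T0 g) \<le> 4 * \<delta> * \<beta>)"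
proof -
  define T where "T n = (avg ^^ n) T0" for n
  have T0: "T 0 = T0" and TS: "T (Suc n) = avg (T n)" for n by (simp_all add: T_def)
  have bound: "4 * \<delta> * \<beta> \<le> 1 / (2 * \<beta>)"
    using small pos by (simp add: field_simps power2_eq_square)
  have inv: "binvertible S \<and> norm (binv S) \<le> 2 * \<beta>" if "g \<in> rg V" "norm (S - T0 g) \<le> 4 * \<delta> * \<beta>" for g S
    using binvertible_perturb[OF nearD(3,4)[OF near that(1)], of S] pos(1) bound that(2) by auto
  have main: "near V (2 * \<beta>) (\<delta> / 2 ^ n) (T n) \<and> (\<forall>g\<in>rg V. norm (T n g - T0 g) \<le> 4 * \<delta> * \<beta> * (1 - 1 / 2 ^ n))" for n
  proof (induction n)
    case 0
    have "near V (2 * \<beta>) \<delta> T0"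
      using near pos(1) unfolding near_def by (auto intro: order_trans)
    then show ?case by (simp add: T0)
  next
    case (Suc n)
    note nn = conjunct1[OF Suc.IH]
    have close: "norm (T (Suc n) g - T0 g) \<le> 4 * \<delta> * \<beta> * (1 - 1 / 2 ^ Suc n)" if "g \<in> rg V" for g
    proof -
      have "norm (T (Suc n) g - T n g) \<le> \<delta> / 2 ^ n * (2 * \<beta>)"
        unfolding TS by (rule avg_close[OF nn that])
      moreover have "norm (T n g - T0 g) \<le> 4 * \<delta> * \<beta> * (1 - 1 / 2 ^ n)" using Suc.IH that by blast
      ultimately have "norm (T (Suc n) g - T0 g) \<le> \<delta> / 2 ^ n * (2 * \<beta>) + 4 * \<delta> * \<beta> * (1 - 1 / 2 ^ n)"
        using norm_triangle_ineq[of "T (Suc n) g - T n g" "T n g - T0 g"] by simp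
      also have "\<dots> = 4 * \<delta> * \<beta> * (1 - 1 / 2 ^ Suc n)" by (simp add: field_simps)
      finally show ?thesis .
    qed
    have "near V (2 * \<beta>) (\<delta> / 2 ^ Suc n) (avg (T n))"
    proof (rule near_avg[OF nn])
      fix g assume g: "g \<in> rg V"
      have "4 * \<delta> * \<beta> * (1 - 1 / 2 ^ Suc n) \<le> 4 * \<delta> * \<beta> * 1"
        using pos by (intro mult_left_mono) auto
      then show "binvertible (avg (T n) g) \<and> norm (binv (avg (T n) g)) \<le> 2 * \<beta>"
        using inv[OF g, of "avg (T n) g"] close[OF g] unfolding TS by simp
    next
      have "4 * (\<delta> / 2 ^ n)\<^sup>2 * (2 * \<beta>)\<^sup>2 = (32 * \<delta> * \<beta>\<^sup>2) * (\<delta> / 2 ^ Suc n) * (1 / 2 ^ n)"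
        by (simp add: power2_eq_square field_simps)
      also have "\<dots> \<le> 1 * (\<delta> / 2 ^ Suc n) * 1"
        using small pos by (intro mult_mono) (auto simp: divide_le_eq)
      finally show "4 * (\<delta> / 2 ^ n)\<^sup>2 * (2 * \<beta>)\<^sup>2 \<le> \<delta> / 2 ^ Suc n" by simp
    qed
    then show ?case using close by (simp add: TS)
  qed
  have step: "norm (T (Suc n) g - T n g) \<le> 2 * \<delta> * \<beta> * (1/2) ^ n" if "g \<in> rg V" for g n
    using avg_close[OF conjunct1[OF main[of n]] that] by (simp add: TS power_one_over field_simps)
  \<comment> \<open>Writing the limit as \<open>T0\<close> plus a telescoping series confines
    uniform convergence to the bounded differences, as \<open>T0\<close> itself may be
    unbounded.\<close>
  define R where "R g = T0 g + (\<Sum>n. T (Suc n) g - T n g)" for g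
  have ul: "uniform_limit (rg V) (\<lambda>n g. \<Sum>j<n. T (Suc j) g - T j g) (\<lambda>g. \<Sum>n. T (Suc n) g - T n g) sequentially"
    by (rule Weierstrass_m_test[OF step]) (auto intro!: summable_mult summable_geometric)
  have tel: "(\<Sum>j<n. T (Suc j) g - T j g) = T n g - T0 g" for n g
    by (simp add: sum_lessThan_telescope[of "\<lambda>n. T n g"] T0)
  have lim: "(\<lambda>n. T n g) \<longlonglongrightarrow> R g" if "g \<in> rg V" for g
    using tendsto_add[OF tendsto_const tendsto_uniform_limitI[OF ul that], of "T0 g"]
    unfolding tel R_def by simp
  have cont: "continuous_on (rg V) R"
  proof -
    have "continuous_on (rg V) (\<lambda>g. \<Sum>n. T (Suc n) g - T n g)"
    proof (rule uniform_limit_theorem[OF _ ul])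
      have "continuous_on (rg V) (T n)" for n using nearD(1)[OF conjunct1[OF main[of n]]] .
      then show "\<forall>\<^sub>F n in sequentially. continuous_on (rg V) (\<lambda>g. \<Sum>j<n. T (Suc j) g - T j g)"
        unfolding tel using nearD(1)[OF near] by (intro always_eventually allI continuous_intros)
    qed simp
    then show ?thesis unfolding R_def using nearD(1)[OF near] by (intro continuous_intros)
  qed
  have close: "norm (R g - T0 g) \<le> 4 * \<delta> * \<beta>" if "g \<in> rg V" for g
  proof (rule Lim_bounded[OF tendsto_norm[OF tendsto_diff[OF lim[OF that] tendsto_const]]])
    show "\<forall>n\<ge>0. norm (T n g - T0 g) \<le> 4 * \<delta> * \<beta>"
    proof (intro allI impI)
      fix n
      have "4 * \<delta> * \<beta> * (1 - 1 / 2 ^ n) \<le> 4 * \<delta> * \<beta> * 1"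
        using pos by (intro mult_left_mono) auto
      then show "norm (T n g - T0 g) \<le> 4 * \<delta> * \<beta>" using main[of n] that by fastforce
    qed
  qed
  have "uc_sigma_rep s t u m \<sigma> act (rg V) V R"
    unfolding uc_rep_iff
  proof (intro conjI ballI impI cont)
    fix g assume g: "g \<in> rg V"
    show "binvertible (R g)" using inv[OF g close[OF g]] by simp
    show "Alin (R g)"
      by (rule Alin_limit[OF lim[OF g]]) (rule nearD(2)[OF conjunct1[OF main] g])
    fix h assume h: "h \<in> rg V" "s g = t h"
    have gh: "m g h \<in> rg V" using g h by (simp add: rg_iff)
    have "(\<lambda>n. (T n g o\<^sub>L T n h) - (\<rho> g h o\<^sub>L T n (m g h))) \<longlonglongrightarrow> (R g o\<^sub>L R h) - (\<rho> g h o\<^sub>L R (m g h))"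
      by (intro tendsto_intros lim g h gh)
    moreover have "(\<lambda>n. (T n g o\<^sub>L T n h) - (\<rho> g h o\<^sub>L T n (m g h))) \<longlonglongrightarrow> 0"
    proof (rule Lim_null_comparison)
      show "\<forall>\<^sub>F n in sequentially. norm ((T n g o\<^sub>L T n h) - (\<rho> g h o\<^sub>L T n (m g h))) \<le> \<delta> * (1/2) ^ n"
        using nearD(6)[OF conjunct1[OF main] g h] by (simp add: power_one_over)
      show "(\<lambda>n. \<delta> * (1/2) ^ n) \<longlonglongrightarrow> 0"
        by (intro tendsto_mult_right_zero LIMSEQ_realpow_zero) auto
    qed
    ultimately have "(R g o\<^sub>L R h) - (\<rho> g h o\<^sub>L R (m g h)) = 0" by (rule LIMSEQ_unique)
    then show "\<rho> g h o\<^sub>L R (m g h) = R g o\<^sub>L R h" by simp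
  next
    fix y assume y: "y \<in> V"
    have "T n (u y) = id_blinfun" for n using nearD(5)[OF conjunct1[OF main] y] .
    moreover have "u y \<in> rg V" using y by (simp add: rg_iff)
    ultimately show "R (u y) = id_blinfun" using LIMSEQ_unique[OF lim, of "u y"] by simp
  qed
  then show ?thesis using close by blast
qed

end

section \<open>Shrinking to the isotropy group\<close>

locale isotropy_rep = twisted s t u m i \<mu> act \<sigma>
  for s t :: "'g::t2_space \<Rightarrow> 'x::topological_space"
    and u :: "'x \<Rightarrow> 'g" and m :: "'g \<Rightarrow> 'g \<Rightarrow> 'g" and i :: "'g \<Rightarrow> 'g"
    and \<mu> :: "'x \<Rightarrow> 'g measure"
    and act :: "'a::{real_normed_algebra_1, banach} \<Rightarrow> 'e::banach \<Rightarrow> 'e"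
    and \<sigma> :: "'g \<Rightarrow> 'g \<Rightarrow> 'a" +
  fixes x :: 'x and S :: "'g \<Rightarrow> ('e \<Rightarrow>\<^sub>L 'e)"
  assumes proper: "proper_groupoid s t"
    and S_rep: "uc_sigma_rep s t u m \<sigma> act (isotropy s t x) {x} S"
begin

abbreviation K :: "'g set" where "K \<equiv> isotropy s t x"

lemma K_iff: "k \<in> K \<longleftrightarrow> s k = x \<and> t k = x" by (auto simp: isotropy_def)

lemma K_m: "g \<in> K \<Longrightarrow> h \<in> K \<Longrightarrow> m g h \<in> K" by (simp add: K_iff)

lemma K_u: "u x \<in> K" by (simp add: K_iff)

lemma K_rg: "x \<in> V \<Longrightarrow> k \<in> K \<Longrightarrow> k \<in> rg V" by (auto simp: K_iff rg_iff)

lemma S_facts: "\<And>k. k \<in> K \<Longrightarrow> Alin (S k)" "\<And>k. k \<in> K \<Longrightarrow> binvertible (S k)" "continuous_on K S"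
    "S (u x) = id_blinfun" "\<And>g h. g \<in> K \<Longrightarrow> h \<in> K \<Longrightarrow> \<rho> g h o\<^sub>L S (m g h) = S g o\<^sub>L S h"
  using S_rep unfolding uc_rep_iff by (auto simp: K_iff)

text \<open>The cutoff may vanish at \<open>x\<close>, but some arrow \<open>h0\<close> leads from
  \<open>x\<close> to a point where it is positive. Sources of arrows \<open>h\<close> near
  \<open>h0\<close> fill a neighbourhood \<open>W\<close>, and an arrow \<open>k\<close> starting in
  \<open>W\<close> factors as (k h^-1) h, with \<open>h\<close> in a compact set and the first
  factor in the compact support of the cutoff over \<open>C\<close>.\<close>

lemma local_properness:
  "\<exists>W. open W \<and> x \<in> W \<and> (\<forall>C. compact C \<longrightarrow> (\<exists>L. compact L \<and> {k. t k \<in> C \<and> s k \<in> W} \<subseteq> L))"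
proof -
  obtain c where "cutoff_function s t c" using proper unfolding proper_groupoid_def by blast
  then have c: "continuous_on UNIV c" "\<And>C. compact C \<Longrightarrow> compact (closure {g. c (s g) \<noteq> 0} \<inter> t -` C)"
      "\<exists>g. s g = x \<and> c (t g) > 0"
    unfolding cutoff_function_def by simp_all
  obtain h0 where h0: "s h0 = x" "c (t h0) > 0" using c(3) by blast
  obtain U Q where U: "open U" "compact Q" "h0 \<in> U" "U \<subseteq> Q" using compact_nhd .
  have "continuous_on UNIV (\<lambda>h. c (t h))"
    by (rule continuous_on_compose2[OF c(1)]) (auto intro!: continuous_intros)
  then have op: "open (U \<inter> {h. c (t h) > 0})"
    using U(1) by (intro open_Int open_Collect_less continuous_intros)
  let ?W = "s ` (U \<inter> {h. c (t h) > 0})"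
  have "\<exists>L. compact L \<and> {k. t k \<in> C \<and> s k \<in> ?W} \<subseteq> L" if "compact C" for C
  proof -
    let ?M = "closure {g. c (s g) \<noteq> 0} \<inter> t -` C"
    let ?E = "(?M \<times> Q) \<inter> {w. s (fst w) = t (snd w)}"
    let ?L = "(\<lambda>w. m (fst w) (snd w)) ` ?E"
    have "closed {w. s (fst w) = t (snd w)}"
      by (intro closed_equalizer continuous_s continuous_t continuous_on_fst continuous_on_snd continuous_on_id)
    then have "compact ?E" using compact_Times[OF c(2)[OF that] U(2)] by (rule compact_Int_closed[rotated])
    then have "compact ?L"
      by (rule compact_continuous_image[rotated])
        (intro continuous_m continuous_on_fst continuous_on_snd continuous_on_id, simp)
    moreover have "k \<in> ?L" if k: "t k \<in> C" "s k \<in> ?W" for k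
    proof -
      obtain h where h: "h \<in> U" "c (t h) > 0" "s k = s h" using k by auto
      let ?a = "m k (i h)"
      have "?a \<in> ?M" using closure_subset[of "{g. c (s g) \<noteq> 0}"] k h by auto
      moreover have "m ?a h = k" using h m_assoc[of k "i h" h] m_u_right[of k] by simp
      ultimately show ?thesis using h U(4) by (intro image_eqI[of _ _ "(?a, h)"]) auto
    qed
    ultimately show ?thesis by blast
  qed
  moreover have "open ?W" using op by (rule open_map_s)
  moreover have "x \<in> ?W" using h0 U(3) by (intro image_eqI[of _ _ h0]) auto
  ultimately show ?thesis by blast
qed

text \<open>A bump at the unit arrow of \<open>x\<close>, pulled back along the unit map. Its
  support lies in the set \<open>W\<close> of \<open>local_properness\<close>, which yields the
  compactness demanded of a weight.\<close>

lemma cut: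
  assumes "open V" "x \<in> V"
  shows "\<exists>c. haar_mean s t u m i \<mu> c \<and> c x \<noteq> 0 \<and> {y. c y \<noteq> 0} \<subseteq> V"
proof -
  obtain W where W: "open W" "x \<in> W"
    "\<And>C. compact C \<Longrightarrow> \<exists>L. compact L \<and> {k. t k \<in> C \<and> s k \<in> W} \<subseteq> L"
    using local_properness by blast
  obtain \<psi> where \<psi>: "\<psi> \<in> Cc" "\<And>h. 0 \<le> \<psi> h" "\<psi> (u x) = 1" "\<And>h. h \<notin> t -` (V \<inter> W) \<Longrightarrow> \<psi> h = (0::real)"
    using bump[OF open_vimage_t[OF open_Int[OF assms(1) W(1)]], of "u x"] assms(2) W(2) by auto
  have sub: "y \<in> V \<inter> W" if "\<psi> (u y) \<noteq> 0" for y using \<psi>(4)[of "u y"] that by auto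
  have "haar_mean s t u m i \<mu> (\<lambda>y. \<psi> (u y))"
  proof
    show "continuous_on UNIV (\<lambda>y. \<psi> (u y))"
      by (rule continuous_on_compose2[OF Cc_continuous[OF \<psi>(1)]]) (auto intro!: continuous_intros)
    fix C :: "'x set" assume "compact C"
    then obtain L where "compact L" "{k. t k \<in> C \<and> s k \<in> W} \<subseteq> L" using W(3) by blast
    then show "\<exists>L. compact L \<and> {k. t k \<in> C \<and> \<psi> (u (s k)) \<noteq> 0} \<subseteq> L"
      using sub by (intro exI[of _ L]) auto
  qed (rule \<psi>(2))
  then show ?thesis using \<psi>(3) sub by (intro exI[of _ "\<lambda>y. \<psi> (u y)"]) auto
qed

text \<open>Closed by separation of objects, and contained in the compact set that
  \<open>local_properness\<close> attaches to the single point \<open>x\<close>.\<close>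

lemma compact_K: "compact K"
proof -
  obtain W where W: "open W" "x \<in> W"
    "\<And>C. compact C \<Longrightarrow> \<exists>L. compact L \<and> {k. t k \<in> C \<and> s k \<in> W} \<subseteq> L"
    using local_properness by blast
  obtain L where L: "compact L" "{k. t k \<in> {x} \<and> s k \<in> W} \<subseteq> L" using W(3)[of "{x}"] by auto
  have "closed {k. s k = x}" "closed {k. t k = x}"
    by (intro closed_equalizer continuous_s continuous_t continuous_on_id continuous_on_const)+
  then have "closed K" using closed_Int by (simp add: isotropy_def vimage_def)
  moreover have "K = L \<inter> K" using L(2) W(2) by (auto simp: K_iff)
  ultimately show ?thesis using compact_Int_closed[OF L(1)] by metis
qed

text \<open>All arrows over a small neighbourhood of \<open>x\<close> lie in one compact set
  \<open>L\<close>. A pair of arrows of \<open>K\<close> has a neighbourhood where the property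
  holds; any other pair has a component off \<open>K\<close>, and this is expelled by a smaller
  base. A finite subcover of \<open>L \<times> L\<close> makes the choice of base uniform.\<close>

lemma shrink:
  assumes V0: "open V0" "x \<in> V0"
    and P: "\<And>g h. g \<in> K \<Longrightarrow> h \<in> K \<Longrightarrow> \<exists>A B. open A \<and> open B \<and> g \<in> A \<and> h \<in> B \<and>
      (\<forall>g'\<in>A. \<forall>h'\<in>B. s g' = t h' \<longrightarrow> g' \<in> rg V0 \<longrightarrow> h' \<in> rg V0 \<longrightarrow> P g' h')"
  shows "\<exists>V. open V \<and> x \<in> V \<and> V \<subseteq> V0 \<and> (\<forall>g\<in>rg V. \<forall>h\<in>rg V. s g = t h \<longrightarrow> P g h)"
proof -
  obtain W where W: "open W" "x \<in> W"
    "\<And>C. compact C \<Longrightarrow> \<exists>L. compact L \<and> {k. t k \<in> C \<and> s k \<in> W} \<subseteq> L"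
    using local_properness by blast
  obtain U0 C where U0: "open U0" "compact C" "x \<in> U0" "U0 \<subseteq> C" using compact_nhd_X .
  obtain L where L: "compact L" "{k. t k \<in> C \<and> s k \<in> W} \<subseteq> L" using W(3)[OF U0(2)] by blast
  \<comment> \<open>Off \<open>K\<close> the source or the target differs from \<open>x\<close>, and
    separating that point from \<open>x\<close> gives both neighbourhoods.\<close>
  have away: "\<exists>A V. open A \<and> open V \<and> g \<in> A \<and> x \<in> V \<and> (\<forall>g'\<in>A. g' \<notin> rg V)" if g: "g \<notin> K" for g
  proof (cases "s g = x")
    case False
    then obtain A V where "open A" "open V" "s g \<in> A" "x \<in> V" "A \<inter> V = {}" using separation_X by metis
    then show ?thesis using open_vimage_s by (intro exI[of _ "s -` A"] exI[of _ V]) (auto simp: rg_iff)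
  next
    case True
    then have "t g \<noteq> x" using g by (simp add: K_iff)
    then obtain A V where "open A" "open V" "t g \<in> A" "x \<in> V" "A \<inter> V = {}" using separation_X by metis
    then show ?thesis using open_vimage_t by (intro exI[of _ "t -` A"] exI[of _ V]) (auto simp: rg_iff)
  qed
  have "\<exists>A B V. open A \<and> open B \<and> open V \<and> g \<in> A \<and> h \<in> B \<and> x \<in> V \<and>
      (\<forall>g'\<in>A. \<forall>h'\<in>B. s g' = t h' \<longrightarrow> g' \<in> rg (V0 \<inter> V) \<longrightarrow> h' \<in> rg (V0 \<inter> V) \<longrightarrow> P g' h')" for g h
  proof (cases "g \<in> K \<and> h \<in> K")
    case True
    then have "g \<in> K" "h \<in> K" by auto
    from P[OF this] obtain A B where AB: "open A" "open B" "g \<in> A" "h \<in> B" and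
      Q: "\<And>g' h'. g' \<in> A \<Longrightarrow> h' \<in> B \<Longrightarrow> s g' = t h' \<Longrightarrow> g' \<in> rg V0 \<Longrightarrow> h' \<in> rg V0 \<Longrightarrow> P g' h'"
      by metis
    show ?thesis
      by (intro exI[of _ A] exI[of _ B] exI[of _ UNIV]) (use AB Q in simp)
  next
    case False
    then consider "g \<notin> K" | "h \<notin> K" by blast
    then show ?thesis
    proof cases
      case 1
      then obtain A V where "open A" "open V" "g \<in> A" "x \<in> V" "\<And>g'. g' \<in> A \<Longrightarrow> g' \<notin> rg V"
        using away by metis
      then show ?thesis by (intro exI[of _ A] exI[of _ UNIV] exI[of _ V]) (auto simp: rg_iff)
    next
      case 2
      then obtain A V where "open A" "open V" "h \<in> A" "x \<in> V" "\<And>g'. g' \<in> A \<Longrightarrow> g' \<notin> rg V"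
        using away by metis
      then show ?thesis by (intro exI[of _ UNIV] exI[of _ A] exI[of _ V]) (auto simp: rg_iff)
    qed
  qed
  then obtain A B V where ABV: "\<And>g h. open (A g h)" "\<And>g h. open (B g h)" "\<And>g h. open (V g h)"
      "\<And>g h. g \<in> A g h" "\<And>g h. h \<in> B g h" "\<And>g h. x \<in> V g h"
      "\<And>g h g' h'. g' \<in> A g h \<Longrightarrow> h' \<in> B g h \<Longrightarrow> s g' = t h' \<Longrightarrow>
         g' \<in> rg (V0 \<inter> V g h) \<Longrightarrow> h' \<in> rg (V0 \<inter> V g h) \<Longrightarrow> P g' h'" by metis
  define O' where "O' w = A (fst w) (snd w) \<times> B (fst w) (snd w)" for w
  have op: "open (O' w)" for w
    unfolding O'_def by (intro open_Times ABV)
  have "w \<in> O' w" for w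
    unfolding O'_def mem_Times_iff using ABV(4,5) by simp
  then have cov: "L \<times> L \<subseteq> (\<Union>w\<in>L \<times> L. O' w)" by blast
  obtain J where J: "J \<subseteq> L \<times> L" "finite J" "L \<times> L \<subseteq> (\<Union>w\<in>J. O' w)"
    using compactE_image[OF compact_Times[OF L(1) L(1)] op cov] by metis
  \<comment> \<open>\<open>W\<close> and \<open>U0\<close> put the arrows over \<open>V1\<close>
    into \<open>L\<close>; the finite intersection makes the local statements of the cover available
    on \<open>V1\<close>.\<close>
  define V1 where "V1 = V0 \<inter> W \<inter> U0 \<inter> (\<Inter>w\<in>J. V (fst w) (snd w))"
  have "P g h" if "g \<in> rg V1" "h \<in> rg V1" "s g = t h" for g h
  proof -
    have "g \<in> L" "h \<in> L" using that L(2) U0(4) by (auto simp: rg_iff V1_def)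
    then have "(g, h) \<in> (\<Union>w\<in>J. O' w)" using J(3) by (auto simp: subset_iff)
    then obtain w where w: "w \<in> J" "(g, h) \<in> O' w" by (rule UN_E)
    show ?thesis
      by (rule ABV(7)[of g "fst w" "snd w" h]) (use w that in \<open>auto simp: O'_def rg_iff V1_def\<close>)
  qed
  moreover have "open V1" "x \<in> V1" "V1 \<subseteq> V0"
    unfolding V1_def using V0 W(1,2) U0(1,3) J(2) ABV(3,6) by (auto intro!: open_INT)
  ultimately show ?thesis by blast
qed

lemma shrink_less:
  fixes f :: "'g \<Rightarrow> 'g \<Rightarrow> real"
  assumes V0: "open V0" "x \<in> V0"
    and f: "continuous_on {(g, h). g \<in> rg V0 \<and> h \<in> rg V0 \<and> s g = t h} (\<lambda>(g, h). f g h)"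
    and less: "\<And>g h. g \<in> K \<Longrightarrow> h \<in> K \<Longrightarrow> f g h < e"
  shows "\<exists>V. open V \<and> x \<in> V \<and> V \<subseteq> V0 \<and> (\<forall>g\<in>rg V. \<forall>h\<in>rg V. s g = t h \<longrightarrow> f g h < e)"
proof (rule shrink[OF V0])
  fix g h assume gh: "g \<in> K" "h \<in> K"
  let ?D = "{(g, h). g \<in> rg V0 \<and> h \<in> rg V0 \<and> s g = t h}"
  have "(g, h) \<in> ?D" using gh K_rg[OF V0(2)] by (simp add: K_iff)
  then obtain T where T: "open T" "(g, h) \<in> T" "\<forall>w\<in>?D. w \<in> T \<longrightarrow> (\<lambda>(g, h). f g h) w \<in> {..<e}"
    using f[unfolded continuous_on_topological, rule_format, of "(g, h)" "{..<e}"] less[OF gh] by auto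
  obtain A B where "open A" "open B" "g \<in> A" "h \<in> B" "A \<times> B \<subseteq> T"
    using open_prod_elim[OF T(1,2)] by (metis mem_Sigma_iff)
  then show "\<exists>A B. open A \<and> open B \<and> g \<in> A \<and> h \<in> B \<and>
      (\<forall>g'\<in>A. \<forall>h'\<in>B. s g' = t h' \<longrightarrow> g' \<in> rg V0 \<longrightarrow> h' \<in> rg V0 \<longrightarrow> f g' h' < e)"
    using T(3) by (intro exI[of _ A] exI[of _ B]) auto
qed

text \<open>Every arrow over \<open>V\<close> is the first member of a composable pair over
  \<open>V\<close>, the second being the unit at its source.\<close>

lemma shrink_less1:
  fixes f :: "'g \<Rightarrow> real"
  assumes V0: "open V0" "x \<in> V0" and f: "continuous_on (rg V0) f" and less: "\<And>g. g \<in> K \<Longrightarrow> f g < e"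
  shows "\<exists>V. open V \<and> x \<in> V \<and> V \<subseteq> V0 \<and> (\<forall>g\<in>rg V. f g < e)"
proof -
  have "continuous_on {(g, h). g \<in> rg V0 \<and> h \<in> rg V0 \<and> s g = t h} (\<lambda>w. f (fst w))"
    by (rule continuous_on_compose2[OF f continuous_on_fst[OF continuous_on_id]]) auto
  then obtain V where V: "open V" "x \<in> V" "V \<subseteq> V0" "\<forall>g\<in>rg V. \<forall>h\<in>rg V. s g = t h \<longrightarrow> f g < e"
    using shrink_less[OF V0, of "\<lambda>g h. f g" e] less by (auto simp: case_prod_unfold)
  have "f g < e" if "g \<in> rg V" for g
    using V(4)[rule_format, OF that, of "u (s g)"] that by (simp add: rg_iff)
  then show ?thesis using V by blast
qed

text \<open>A partition of unity over the compact set \<open>K\<close> blends finitely many values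
  of \<open>S\<close>. This gives a function on all arrows, linear over the algebra like the values
  themselves, at the price of agreeing with \<open>S\<close> only approximately.\<close>

lemma approx_extension:
  assumes "e > 0"
  shows "\<exists>T. continuous_on UNIV T \<and> (\<forall>g. Alin (T g)) \<and> (\<forall>y. T (u y) = id_blinfun) \<and>
    (\<forall>k\<in>K. norm (T k - S k) < e)"
proof -
  have "\<exists>U. open U \<and> k \<in> U \<and> (\<forall>h\<in>K. h \<in> U \<longrightarrow> S h \<in> ball (S k) (e/3))" if "k \<in> K" for k
    using S_facts(3)[unfolded continuous_on_topological, rule_format, OF that open_ball, of "S k" "e/3"] assms
    by auto
  then obtain U where U: "\<And>k. k \<in> K \<Longrightarrow> open (U k) \<and> k \<in> U k"
    "\<And>k h. k \<in> K \<Longrightarrow> h \<in> K \<Longrightarrow> h \<in> U k \<Longrightarrow> S h \<in> ball (S k) (e/3)" by metis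
  obtain J :: "'g set" and \<phi> :: "'g \<Rightarrow> 'g \<Rightarrow> real" where J: "finite J" "J \<subseteq> K" "\<And>j. \<phi> j \<in> Cc"
    "\<And>j h. 0 \<le> \<phi> j h" "\<And>j h. j \<in> J \<Longrightarrow> h \<notin> U j \<Longrightarrow> \<phi> j h = 0" "\<And>h. h \<in> K \<Longrightarrow> (\<Sum>j\<in>J. \<phi> j h) = 1"
    by (rule partition_of_unity[OF compact_K U(1)]) blast+
  define T1 where "T1 g = (\<Sum>j\<in>J. \<phi> j g *\<^sub>R S j)" for g
  have T1_c: "continuous_on A T1" for A
    unfolding T1_def by (intro continuous_intros continuous_on_subset[OF Cc_continuous[OF J(3)]]) auto
  have T1_close: "norm (T1 k - S k) \<le> e/3" if k: "k \<in> K" for k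
  proof -
    have "S k = (\<Sum>j\<in>J. \<phi> j k) *\<^sub>R S k" using J(6)[OF k] by simp
    then have eq: "T1 k - S k = (\<Sum>j\<in>J. \<phi> j k *\<^sub>R (S j - S k))"
      by (simp add: T1_def scaleR_right_diff_distrib sum_subtractf scaleR_sum_left)
    have "norm (\<phi> j k *\<^sub>R (S j - S k)) \<le> \<phi> j k * (e/3)" if j: "j \<in> J" for j
    proof (cases "k \<in> U j")
      case True
      then have "norm (S j - S k) \<le> e/3" using U(2)[of j k] J(2) j k by (auto simp: dist_norm)
      from mult_left_mono[OF this J(4)[of j k]] show ?thesis using J(4)[of j k] by simp
    qed (use J(5)[OF j] in simp)
    then have "norm (T1 k - S k) \<le> (\<Sum>j\<in>J. \<phi> j k * (e/3))" unfolding eq by (rule sum_norm_le)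
    also have "\<dots> = e/3" unfolding sum_distrib_right[symmetric] J(6)[OF k] by simp
    finally show ?thesis .
  qed
  have T1_A: "Alin (T1 g)" for g
    unfolding T1_def using J(2) by (intro Alin_sum Alin_scaleR S_facts(1)) auto
  \<comment> \<open>The correction makes \<open>T\<close> the identity at every unit and depends
    only on the target. On \<open>K\<close> it costs a second error \<open>e/3\<close>, because
    \<open>S (u x)\<close> is the identity.\<close>
  define T where "T g = T1 g + (id_blinfun - T1 (u (t g)))" for g
  have "continuous_on UNIV (\<lambda>g. T1 (u (t g)))"
    by (rule continuous_on_compose2[OF T1_c[of UNIV]]) (auto intro!: continuous_intros)
  then have "continuous_on UNIV T" unfolding T_def by (intro continuous_intros T1_c)
  moreover have "Alin (T g)" for g unfolding T_def by (intro Alin_add Alin_diff T1_A Alin_id)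
  moreover have "T (u y) = id_blinfun" for y by (simp add: T_def)
  moreover have "norm (T k - S k) < e" if k: "k \<in> K" for k
  proof -
    have eq: "T k - S k = (T1 k - S k) - (T1 (u x) - S (u x))" using k S_facts(4) by (simp add: T_def K_iff)
    have "norm (T k - S k) \<le> e/3 + e/3"
      unfolding eq by (rule order_trans[OF norm_triangle_ineq4 add_mono[OF T1_close[OF k] T1_close[OF K_u]]])
    then show ?thesis using assms by simp
  qed
  ultimately show ?thesis by blast
qed

text \<open>Compactness of \<open>K\<close>; a common bound of at least 1 lets powers of
  \<open>b\<close> be compared in the constants that follow.\<close>

lemma S_bound:
  "\<exists>b\<ge>1. \<forall>k\<in>K. norm (S k) \<le> b \<and> norm (binv (S k)) \<le> b \<and> (\<forall>h\<in>K. norm (\<rho> h k) \<le> b)"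
proof -
  have "bounded (S ` K)" "bounded ((\<lambda>k. binv (S k)) ` K)" "bounded ((\<lambda>w. \<rho> (fst w) (snd w)) ` (K \<times> K))"
    by (intro compact_imp_bounded compact_continuous_image compact_Times compact_K continuous_on_binv
        S_facts continuous_rho continuous_on_fst continuous_on_snd continuous_on_id; auto simp: K_iff S_facts)+
  then obtain b1 b2 b3 where "\<And>k. k \<in> K \<Longrightarrow> norm (S k) \<le> b1" "\<And>k. k \<in> K \<Longrightarrow> norm (binv (S k)) \<le> b2"
      "\<And>h k. h \<in> K \<Longrightarrow> k \<in> K \<Longrightarrow> norm (\<rho> h k) \<le> b3"
    unfolding bounded_iff by force
  then show ?thesis by (intro exI[of _ "max 1 (max b1 (max b2 b3))"]) (auto simp: le_max_iff_disj)
qed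

end

section \<open>Extension of representations of the isotropy group\<close>

lemma norm_triangle3: "norm ((a + b) - c) \<le> norm a + norm b + norm (c :: 'b::real_normed_vector)"
  using norm_triangle_ineq4[of "a + b" c] norm_triangle_ineq[of a b] by linarith

context isotropy_rep
begin

text \<open>Near multiplicativity and invertibility of the blended extension hold on
  \<open>K\<close>, are open conditions, and so spread to the arrows over a small base, where
  \<open>near_rep\<close> takes over.\<close>

lemma rep_near_S:
  assumes e: "e > 0"
  shows "\<exists>V R. open V \<and> x \<in> V \<and> uc_sigma_rep s t u m \<sigma> act (rg V) V R \<and> (\<forall>k\<in>K. norm (R k - S k) < e)"
proof -
  obtain b where b: "b \<ge> 1" "\<And>k. k \<in> K \<Longrightarrow> norm (S k) \<le> b" "\<And>k. k \<in> K \<Longrightarrow> norm (binv (S k)) \<le> b"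
    "\<And>h k. h \<in> K \<Longrightarrow> k \<in> K \<Longrightarrow> norm (\<rho> h k) \<le> b"
    using S_bound by blast
  \<comment> \<open>With inverse bound \<open>2 * b\<close> and defect
    \<open>5 * b * \<tau>\<close>, the smallness condition of \<open>near_rep\<close> reads 640 b^3
    \<tau> \<le> 1, and the final distance to \<open>S\<close> is below 40 b^2 \<tau> + \<tau>,
    hence below \<open>e\<close>.\<close>
  define \<tau> where "\<tau> = min (1 / (1000 * b ^ 3)) (e / (100 * b\<^sup>2))"
  have b3: "b \<le> b ^ 3" "1 \<le> b ^ 3" "b\<^sup>2 \<ge> 1"
    using b(1) power_increasing[of 1 3 b] one_le_power[of b 3] one_le_power[of b 2] by auto
  have \<tau>: "\<tau> > 0" "1000 * b ^ 3 * \<tau> \<le> 1" "100 * b\<^sup>2 * \<tau> \<le> e"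
  proof -
    have p: "1000 * b ^ 3 > 0" "100 * b\<^sup>2 > 0" using b3 by linarith+
    show "\<tau> > 0" unfolding \<tau>_def using p e by simp
    have "\<tau> \<le> 1 / (1000 * b ^ 3)" "\<tau> \<le> e / (100 * b\<^sup>2)" unfolding \<tau>_def by simp_all
    then show "1000 * b ^ 3 * \<tau> \<le> 1" "100 * b\<^sup>2 * \<tau> \<le> e" using p by (simp_all add: field_simps)
  qed
  have \<tau>1: "1000 * b * \<tau> \<le> 1" "\<tau> \<le> b"
  proof -
    have "1000 * b * \<tau> \<le> 1000 * b ^ 3 * \<tau>" using b3 \<tau>(1) by (intro mult_right_mono mult_left_mono) auto
    then show 1: "1000 * b * \<tau> \<le> 1" using \<tau>(2) by linarith
    show "\<tau> \<le> b" using mult_right_mono[OF b(1), of \<tau>] 1 \<tau>(1) b(1) by linarith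
  qed
  obtain T where T: "continuous_on UNIV T" "\<And>g. Alin (T g)" "\<And>y. T (u y) = id_blinfun"
    "\<And>k. k \<in> K \<Longrightarrow> norm (T k - S k) < \<tau>"
    using approx_extension[OF \<tau>(1)] by blast
  have Tc: "continuous_on A f \<Longrightarrow> continuous_on A (\<lambda>z. T (f z))" for A :: "('g \<times> 'g) set" and f
    by (rule continuous_on_compose2[OF T(1)]) auto
  have Tb: "norm (T k) \<le> 2 * b" if "k \<in> K" for k
    using norm_triangle_sub[of "T k" "S k"] T(4)[OF that] b(2)[OF that] \<tau>1(2) by linarith
  have "\<exists>V. open V \<and> x \<in> V \<and> V \<subseteq> UNIV \<and>
      (\<forall>g\<in>rg V. \<forall>h\<in>rg V. s g = t h \<longrightarrow> binvertible (T g) \<and> norm (binv (T g)) \<le> 2 * b)"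
  proof (rule shrink)
    fix g h assume gh: "g \<in> K" "h \<in> K"
    let ?A = "{g'. norm (T g' - S g) < 1 / (2 * b)}"
    have "open ?A" by (intro open_Collect_less continuous_intros T(1))
    moreover have "g \<in> ?A"
    proof -
      have "\<tau> \<le> 1 / (2 * b)" using \<tau>1(1) b(1) \<tau>(1) by (simp add: field_simps)
      then show ?thesis using T(4)[OF gh(1)] by simp
    qed
    moreover have "binvertible (T g') \<and> norm (binv (T g')) \<le> 2 * b" if "g' \<in> ?A" for g'
      using binvertible_perturb[OF S_facts(2)[OF gh(1)] b(3)[OF gh(1)], of "T g'"] that b(1) by auto
    ultimately show "\<exists>A B. open A \<and> open B \<and> g \<in> A \<and> h \<in> B \<and> (\<forall>g'\<in>A. \<forall>h'\<in>B. s g' = t h' \<longrightarrow>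
        g' \<in> rg UNIV \<longrightarrow> h' \<in> rg UNIV \<longrightarrow> binvertible (T g') \<and> norm (binv (T g')) \<le> 2 * b)"
      by (intro exI[of _ ?A] exI[of _ UNIV]) auto
  qed auto
  then obtain V1 where V1: "open V1" "x \<in> V1"
    "\<And>g h. g \<in> rg V1 \<Longrightarrow> h \<in> rg V1 \<Longrightarrow> s g = t h \<Longrightarrow> binvertible (T g) \<and> norm (binv (T g)) \<le> 2 * b"
    by blast
  \<comment> \<open>On \<open>K\<close> the defect is at most \<open>4 * b * \<tau>\<close>: two
    terms from the first factor, where \<open>norm (T h)\<close> is at most \<open>2 * b\<close>,
    and one from each of the others. The strict gap lets it spread off \<open>K\<close>.\<close>
  define \<delta> where "\<delta> = 5 * b * \<tau>"
  have "\<exists>V. open V \<and> x \<in> V \<and> V \<subseteq> V1 \<and>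
      (\<forall>g\<in>rg V. \<forall>h\<in>rg V. s g = t h \<longrightarrow> norm ((T g o\<^sub>L T h) - (\<rho> g h o\<^sub>L T (m g h))) < \<delta>)"
  proof (rule shrink_less[OF V1(1,2)])
    show "continuous_on {(g, h). g \<in> rg V1 \<and> h \<in> rg V1 \<and> s g = t h}
        (\<lambda>(g, h). norm ((T g o\<^sub>L T h) - (\<rho> g h o\<^sub>L T (m g h))))"
      unfolding case_prod_unfold
      by (intro continuous_on_norm continuous_on_diff continuous_on_blinfun_compose Tc continuous_rho
          continuous_m continuous_on_fst continuous_on_snd continuous_on_id; simp)
    fix g h assume gh: "g \<in> K" "h \<in> K"
    have eq: "(T g o\<^sub>L T h) - (\<rho> g h o\<^sub>L T (m g h)) =
       (((T g - S g) o\<^sub>L T h) + (S g o\<^sub>L (T h - S h))) - (\<rho> g h o\<^sub>L (T (m g h) - S (m g h)))"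
      using S_facts(5)[OF gh] by (simp add: blinfun_ring)
    have "norm ((T g o\<^sub>L T h) - (\<rho> g h o\<^sub>L T (m g h))) \<le>
       norm ((T g - S g) o\<^sub>L T h) + norm (S g o\<^sub>L (T h - S h)) + norm (\<rho> g h o\<^sub>L (T (m g h) - S (m g h)))"
      unfolding eq by (rule norm_triangle3)
    also have "\<dots> \<le> \<tau> * (2 * b) + b * \<tau> + b * \<tau>"
    proof (intro add_mono order_trans[OF norm_blinfun_compose] mult_mono)
    qed (use T(4) Tb b gh \<tau> K_m[OF gh] in \<open>auto intro: less_imp_le\<close>)
    also have "\<dots> < \<delta>" unfolding \<delta>_def using \<tau>(1) b(1) by (simp add: algebra_simps)
    finally show "norm ((T g o\<^sub>L T h) - (\<rho> g h o\<^sub>L T (m g h))) < \<delta>" .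
  qed
  then obtain V2 where V2: "open V2" "x \<in> V2" "V2 \<subseteq> V1"
    "\<And>g h. g \<in> rg V2 \<Longrightarrow> h \<in> rg V2 \<Longrightarrow> s g = t h \<Longrightarrow> norm ((T g o\<^sub>L T h) - (\<rho> g h o\<^sub>L T (m g h))) < \<delta>"
    by blast
  obtain c where c: "haar_mean s t u m i \<mu> c" "c x \<noteq> 0" "{y. c y \<noteq> 0} \<subseteq> V2"
    using cut[OF V2(1,2)] by blast
  interpret haar_mean s t u m i \<mu> c by (rule c(1))
  interpret twisted_mean s t u m i \<mu> act \<sigma> c ..
  have sub: "g \<in> rg V2" "g \<in> rg V1" if "g \<in> rg V" for g using that c(3) V2(3) by (auto simp: rg_iff)
  have "near V (2 * b) \<delta> T"
    unfolding near_def
  proof (intro conjI ballI impI)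
    show "continuous_on (rg V) T" by (rule continuous_on_subset[OF T(1)]) simp
    fix g assume g: "g \<in> rg V"
    have "u (s g) \<in> rg V1" using sub(2)[OF g] by (simp add: rg_iff)
    then show "binvertible (T g)" "norm (binv (T g)) \<le> 2 * b"
      using V1(3)[OF sub(2)[OF g], of "u (s g)"] by simp_all
    show "norm ((T g o\<^sub>L T h) - (\<rho> g h o\<^sub>L T (m g h))) \<le> \<delta>" if "h \<in> rg V" "s g = t h" for h
      using V2(4)[OF sub(1)[OF g] sub(1)[OF that(1)] that(2)] by simp
  qed (use T in auto)
  moreover have "32 * \<delta> * (2 * b)\<^sup>2 \<le> 1"
  proof -
    have "32 * \<delta> * (2 * b)\<^sup>2 = 640 * b ^ 3 * \<tau>" unfolding \<delta>_def by (simp add: power2_eq_square power3_eq_cube)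
    also have "\<dots> \<le> 1000 * b ^ 3 * \<tau>" using b3 b(1) \<tau>(1) by (intro mult_right_mono) auto
    finally show ?thesis using \<tau>(2) by (rule order_trans)
  qed
  ultimately obtain R where R: "uc_sigma_rep s t u m \<sigma> act (rg V) V R"
     "\<And>g. g \<in> rg V \<Longrightarrow> norm (R g - T g) \<le> 4 * \<delta> * (2 * b)"
    using near_rep[of "2 * b" \<delta> T] b(1) \<tau>(1) unfolding \<delta>_def by auto
  have "norm (R k - S k) < e" if k: "k \<in> K" for k
  proof -
    have "norm (R k - S k) \<le> norm (R k - T k) + norm (T k - S k)"
      using norm_triangle_ineq[of "R k - T k" "T k - S k"] by simp
    also have "\<dots> < 4 * \<delta> * (2 * b) + \<tau>"
      using R(2)[OF K_rg[OF _ k]] T(4)[OF k] c(2) by (intro add_le_less_mono) auto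
    also have "\<dots> \<le> 40 * b\<^sup>2 * \<tau> + b\<^sup>2 * \<tau>"
      unfolding \<delta>_def using mult_right_mono[OF b3(3), of \<tau>] \<tau>(1) by (simp add: power2_eq_square)
    also have "\<dots> \<le> 100 * b\<^sup>2 * \<tau>" using b3(3) \<tau>(1) by simp
    also have "\<dots> \<le> e" by (rule \<tau>(3))
    finally show ?thesis .
  qed
  moreover have "open V" using open_Collect_neq[OF c_cont continuous_on_const] .
  ultimately show ?thesis using R(1) c(2) by (intro exI[of _ V] exI[of _ R]) auto
qed

text \<open>A substitute for averaging against Haar measure on the isotropy group: means over the
  fiber \<open>t = x\<close> whose weights concentrate near \<open>K\<close>.\<close>
lemma intertwiner_step:
  assumes V0: "open V0" "x \<in> V0" and R_rep: "uc_sigma_rep s t u m \<sigma> act (rg V0) V0 R"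
    and B: "Alin B" "\<And>k. k \<in> K \<Longrightarrow> norm ((S k o\<^sub>L B o\<^sub>L binv (R k)) - B) \<le> e" and \<eta>: "\<eta> > 0"
  shows "\<exists>B'. Alin B' \<and> norm (B' - B) \<le> e + \<eta> \<and> (\<forall>h\<in>K. norm ((S h o\<^sub>L B' o\<^sub>L binv (R h)) - B') \<le> \<eta>)"
proof -
  have R: "\<And>g. g \<in> rg V0 \<Longrightarrow> Alin (R g)" "\<And>g. g \<in> rg V0 \<Longrightarrow> binvertible (R g)" "continuous_on (rg V0) R"
     "\<And>g h. g \<in> rg V0 \<Longrightarrow> h \<in> rg V0 \<Longrightarrow> s g = t h \<Longrightarrow> \<rho> g h o\<^sub>L R (m g h) = R g o\<^sub>L R h"
    using R_rep unfolding uc_rep_iff by auto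
  have K0: "k \<in> rg V0" if "k \<in> K" for k using K_rg[OF V0(2) that] .
  have Ric: "continuous_on (rg V0) (\<lambda>g. binv (R g))" by (rule continuous_on_binv[OF R(3,2)])
  obtain b where b: "b \<ge> 1" "\<And>k. k \<in> K \<Longrightarrow> norm (S k) \<le> b"
    "\<And>h k. h \<in> K \<Longrightarrow> k \<in> K \<Longrightarrow> norm (\<rho> h k) \<le> b"
    using S_bound by blast
  have "bounded ((\<lambda>k. binv (R k)) ` K)"
    by (intro compact_imp_bounded compact_continuous_image compact_K continuous_on_subset[OF Ric]) (use K0 in auto)
  then obtain r0 where r0: "\<And>k. k \<in> K \<Longrightarrow> norm (binv (R k)) \<le> r0" by (auto simp: bounded_iff)
  define r where "r = max 1 r0"
  have r: "r \<ge> 1" "\<And>k. k \<in> K \<Longrightarrow> norm (binv (R k)) \<le> r"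
    unfolding r_def using r0 by (auto simp: le_max_iff_disj)
  define M where "M = max 1 (norm B)"
  have M: "M \<ge> 1" "norm B \<le> M" unfolding M_def by auto
  \<comment> \<open>On \<open>K\<close> the product of the norms of \<open>T k\<close> and
    \<open>binv (R k)\<close> is at most \<open>(b + 1) * r\<close>; the extra 1 leaves room for a
    strict inequality on nearby arrows, where the factors have no bound beforehand.\<close>
  define q where "q = (b + 1) * r + 1"
  have q: "q \<ge> 1" unfolding q_def using b(1) r(1) by simp
  \<comment> \<open>One summand for each error, each kept below \<open>\<eta> / 4\<close> by the
    choice of \<open>\<tau>\<close>: the defect of \<open>T\<close> on \<open>K\<close>, the
    replacement of \<open>S h\<close> by \<open>T h\<close>, and the replacement of
    \<open>S k\<close> by \<open>T k\<close> in the first estimate.\<close>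
  define P where "P = 4 * b * r\<^sup>2 * M + q * r * M + M * r"
  have P3: "4 * b * r\<^sup>2 * M > 0" "q * r * M > 0" "M * r > 0" using b(1) r(1) M(1) q by auto
  define \<tau> where "\<tau> = min 1 (\<eta> / (4 * P))"
  have P: "P > 0" unfolding P_def using P3 by linarith
  have \<tau>: "0 < \<tau>" "\<tau> \<le> 1" unfolding \<tau>_def using \<eta> P by auto
  have "\<tau> * P \<le> \<eta> / (4 * P) * P" using P by (intro mult_right_mono) (auto simp: \<tau>_def)
  then have \<tau>P: "\<tau> * P \<le> \<eta> / 4" using P by simp
  have "4 * b * r\<^sup>2 * M \<le> P" "q * r * M \<le> P" "M * r \<le> P" using P3 unfolding P_def by linarith+
  then have sm: "\<tau> * (4 * b * r\<^sup>2 * M) \<le> \<eta> / 4" "\<tau> * (q * r * M) \<le> \<eta> / 4" "\<tau> * (M * r) \<le> \<eta> / 4"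
    using \<tau>P mult_left_mono[of _ P \<tau>] \<tau>(1) by (meson less_imp_le order_trans)+
  obtain T where T: "continuous_on UNIV T" "\<And>g. Alin (T g)" "\<And>k. k \<in> K \<Longrightarrow> norm (T k - S k) < \<tau>"
    using approx_extension[OF \<tau>(1)] by blast
  have Tc: "continuous_on A f \<Longrightarrow> continuous_on A (\<lambda>z. T (f z))" for A :: "('g \<times> 'g) set" and f
    by (rule continuous_on_compose2[OF T(1)]) auto
  have T1: "continuous_on A T" for A by (rule continuous_on_subset[OF T(1)]) simp
  have Tb: "norm (T k) \<le> b + \<tau>" if "k \<in> K" for k
    using norm_triangle_sub[of "T k" "S k"] T(3)[OF that] b(2)[OF that] by linarith

  \<comment> \<open>\<open>S\<close> lives on \<open>K\<close> only, so \<open>T\<close> stands in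
    for it off \<open>K\<close>; this bound keeps the new intertwiner within
    \<open>e + \<eta>\<close> of the old one.\<close>
  have "\<exists>V. open V \<and> x \<in> V \<and> V \<subseteq> V0 \<and> (\<forall>k\<in>rg V. norm ((T k o\<^sub>L B o\<^sub>L binv (R k)) - B) < e + \<eta>)"
  proof (rule shrink_less1[OF V0])
    show "continuous_on (rg V0) (\<lambda>k. norm ((T k o\<^sub>L B o\<^sub>L binv (R k)) - B))"
      by (intro continuous_intros T1 R(3,2)) 
    fix k assume k: "k \<in> K"
    have eq: "(T k o\<^sub>L B o\<^sub>L binv (R k)) - B = ((T k - S k) o\<^sub>L B o\<^sub>L binv (R k)) + ((S k o\<^sub>L B o\<^sub>L binv (R k)) - B)"
      by (simp add: blinfun_ring)
    have "norm ((T k o\<^sub>L B o\<^sub>L binv (R k)) - B) \<le> norm ((T k - S k) o\<^sub>L B o\<^sub>L binv (R k)) + e"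
      unfolding eq by (rule norm_triangle_le[OF add_left_mono[OF B(2)[OF k]]])
    also have "norm ((T k - S k) o\<^sub>L B o\<^sub>L binv (R k)) \<le> (\<tau> * M) * r"
      using T(3)[OF k] M r(1) r(2)[OF k] \<tau>(1)
      by (intro order_trans[OF norm_blinfun_compose] mult_mono) auto
    also have "(\<tau> * M) * r \<le> \<eta> / 4" using sm(3) by (simp add: mult_ac)
    finally show "norm ((T k o\<^sub>L B o\<^sub>L binv (R k)) - B) < e + \<eta>" using \<eta> by simp
  qed
  then obtain V1 where V1: "open V1" "x \<in> V1" "V1 \<subseteq> V0"
    "\<And>k. k \<in> rg V1 \<Longrightarrow> norm ((T k o\<^sub>L B o\<^sub>L binv (R k)) - B) < e + \<eta>" by blast
  have V10: "k \<in> rg V0" if "k \<in> rg V1" for k using that V1(3) by (auto simp: rg_iff)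

  have "\<exists>V. open V \<and> x \<in> V \<and> V \<subseteq> V1 \<and> (\<forall>k\<in>rg V. norm (T k) * norm (binv (R k)) < q)"
  proof (rule shrink_less1[OF V1(1,2)])
    show "continuous_on (rg V1) (\<lambda>k. norm (T k) * norm (binv (R k)))"
      by (intro continuous_intros T1 continuous_on_subset[OF R(3)] R(2)) (use V10 in auto)
    fix k assume k: "k \<in> K"
    have "norm (T k) * norm (binv (R k)) \<le> (b + 1) * r"
      using Tb[OF k] r(1) r(2)[OF k] \<tau> b(1) by (intro mult_mono) auto
    then show "norm (T k) * norm (binv (R k)) < q" by (simp add: q_def)
  qed
  then obtain V2 where V2: "open V2" "x \<in> V2" "V2 \<subseteq> V1"
    "\<And>k. k \<in> rg V2 \<Longrightarrow> norm (T k) * norm (binv (R k)) < q" by blast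
  have V20: "k \<in> rg V0" "k \<in> rg V1" if "k \<in> rg V2" for k using that V1(3) V2(3) by (auto simp: rg_iff)

  \<comment> \<open>The defect of \<open>T\<close> weighted by the two inverses with which it is
    composed in the final estimate; off \<open>K\<close> only this combined quantity needs to be
    small.\<close>
  define d where "d h k = norm ((T h o\<^sub>L T k) - (\<rho> h k o\<^sub>L T (m h k))) * norm (binv (R k)) * norm (binv (R h))" for h k
  have "\<exists>V. open V \<and> x \<in> V \<and> V \<subseteq> V2 \<and> (\<forall>h\<in>rg V. \<forall>k\<in>rg V. s h = t k \<longrightarrow> d h k < \<eta> / (2 * M))"
  proof (rule shrink_less[OF V2(1,2)])
    show "continuous_on {(g, h). g \<in> rg V2 \<and> h \<in> rg V2 \<and> s g = t h} (\<lambda>(g, h). d g h)"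
      unfolding case_prod_unfold d_def
      by (intro continuous_on_mult continuous_on_norm continuous_on_diff continuous_on_blinfun_compose Tc continuous_rho
          continuous_m continuous_on_compose2[OF Ric] continuous_on_fst continuous_on_snd continuous_on_id)
        (use V20 in auto)
    fix h k assume hk: "h \<in> K" "k \<in> K"
    have eq: "(T h o\<^sub>L T k) - (\<rho> h k o\<^sub>L T (m h k)) =
       (((T h - S h) o\<^sub>L T k) + (S h o\<^sub>L (T k - S k))) - (\<rho> h k o\<^sub>L (T (m h k) - S (m h k)))"
      using S_facts(5)[OF hk] by (simp add: blinfun_ring)
    have "norm ((T h o\<^sub>L T k) - (\<rho> h k o\<^sub>L T (m h k))) \<le>
       norm ((T h - S h) o\<^sub>L T k) + norm (S h o\<^sub>L (T k - S k)) + norm (\<rho> h k o\<^sub>L (T (m h k) - S (m h k)))"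
      unfolding eq by (rule norm_triangle3)
    also have "\<dots> \<le> \<tau> * (b + \<tau>) + b * \<tau> + b * \<tau>"
    proof (intro add_mono order_trans[OF norm_blinfun_compose] mult_mono)
    qed (use T(3) Tb b hk \<tau> K_m[OF hk] in \<open>auto intro: less_imp_le\<close>)
    also have "\<dots> \<le> 4 * b * \<tau>"
    proof -
      have "\<tau> * \<tau> \<le> b * \<tau>" using \<tau> b(1) by (intro mult_right_mono) auto
      then show ?thesis by (simp add: algebra_simps)
    qed
    finally have "d h k \<le> (4 * b * \<tau>) * r * r"
      unfolding d_def using r(1) r(2)[OF hk(1)] r(2)[OF hk(2)] b(1) \<tau>(1) by (intro mult_mono) auto
    also have "\<dots> = \<tau> * (4 * b * r\<^sup>2 * M) / M" using M(1) by (simp add: power2_eq_square)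
    also have "\<dots> \<le> (\<eta> / 4) / M" using sm(1) M(1) by (intro divide_right_mono) auto
    also have "\<dots> < \<eta> / (2 * M)" using \<eta> M(1) by (simp add: field_simps)
    finally show "d h k < \<eta> / (2 * M)" .
  qed
  then obtain V3 where V3: "open V3" "x \<in> V3" "V3 \<subseteq> V2"
    "\<And>h k. h \<in> rg V3 \<Longrightarrow> k \<in> rg V3 \<Longrightarrow> s h = t k \<Longrightarrow> d h k < \<eta> / (2 * M)" by blast
  obtain c where c: "haar_mean s t u m i \<mu> c" "c x \<noteq> 0" "{y. c y \<noteq> 0} \<subseteq> V3"
    using cut[OF V3(1,2)] by blast
  interpret haar_mean s t u m i \<mu> c by (rule c(1))
  interpret twisted_mean s t u m i \<mu> act \<sigma> c ..
  have sub: "k \<in> rg V3" "k \<in> rg V2" "k \<in> rg V1" "k \<in> rg V0" if "k \<in> D x" for k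
    using D_rg[OF _ that] c(2,3) V3(3) V2(3) V1(3) by (auto simp: rg_iff)
  have mass: "mass x > 0" by (rule mass_pos[OF c(2)])
  define F where "F k = (T k o\<^sub>L B o\<^sub>L binv (R k))" for k
  have F_close: "norm (F k - B) \<le> e + \<eta>" if "k \<in> D x" for k
    using V1(4)[OF sub(3)[OF that]] by (simp add: F_def)
  have F: "adm x F"
    unfolding adm_def
  proof
    show "continuous_on (D x) F"
      unfolding F_def by (intro continuous_intros T1 continuous_on_subset[OF R(3)] R(2)) (use sub in auto)
    have "norm (F k) \<le> norm B + (e + \<eta>)" if "k \<in> D x" for k
      using norm_triangle_sub[of "F k" B] F_close[OF that] by simp
    then show "bounded (F ` D x)" by (auto simp: bounded_iff)
  qed
  have FA: "Alin (F k)" if "k \<in> D x" for k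
    unfolding F_def by (intro Alin_compose Alin_binv T(2) B(1) R(1,2) sub(4)[OF that])
  define B' where "B' = mean x F"
  have "norm (B' - B) \<le> e + \<eta>"
  proof -
    have "B' - B = mean x (\<lambda>k. F k - B)"
      unfolding B'_def by (simp add: mean_diff[OF F adm_const] mean_const[OF mass])
    then show ?thesis using mean_norm_le[OF mass adm_diff[OF F adm_const] F_close] by simp
  qed
  moreover have "Alin B'" unfolding B'_def by (rule Alin_mean[OF F FA])
  \<comment> \<open>The new error does not involve \<open>e\<close>: invariance of the mean under
    \<open>h\<close> is exact, so what remains is the failure of \<open>T\<close> to be
    multiplicative and to agree with \<open>S\<close>, which is small after shrinking.\<close>
  moreover have "norm ((S h o\<^sub>L B' o\<^sub>L binv (R h)) - B') \<le> \<eta>" if h: "h \<in> K" for h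
  proof -
    have hx: "s h = x" "t h = x" using h by (auto simp: K_iff)
    have Fh: "adm x (\<lambda>k. F (m h k))" using adm_translate[of h F] F hx by simp
    have SF: "adm x (\<lambda>k. S h o\<^sub>L F k)" by (rule adm_compose[OF adm_const F])
    have SFR: "adm x (\<lambda>k. S h o\<^sub>L F k o\<^sub>L binv (R h))" by (rule adm_compose[OF SF adm_const])
    have "B' = mean x (\<lambda>k. F (m h k))" unfolding B'_def using mean_invariant[of h F] F hx by simp
    moreover have "(S h o\<^sub>L B' o\<^sub>L binv (R h)) = mean x (\<lambda>k. S h o\<^sub>L F k o\<^sub>L binv (R h))"
      unfolding B'_def mean_compose_right[OF SF] mean_compose_left[OF F] ..
    ultimately have eq: "(S h o\<^sub>L B' o\<^sub>L binv (R h)) - B' = mean x (\<lambda>k. (S h o\<^sub>L F k o\<^sub>L binv (R h)) - F (m h k))"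
      using mean_diff[OF SFR Fh] by simp
    show ?thesis
      unfolding eq
    proof (rule mean_norm_le[OF mass adm_diff[OF SFR Fh]])
      fix k assume k: "k \<in> D x"
      have hk: "s h = t k" using k hx by (simp add: D_def)
      have h0: "h \<in> rg V0" "h \<in> rg V3" using K_rg h V0 V3 by auto
      have mhk: "m h k \<in> rg V0" using h0 sub(4)[OF k] hk by (simp add: rg_iff)
      note iR = R(2)[OF h0(1)] R(2)[OF sub(4)[OF k]] R(2)[OF mhk] rho_binvertible[OF hk]
      have "binv (R k) o\<^sub>L binv (R h) = binv (R (m h k)) o\<^sub>L binv (\<rho> h k)"
        using R(4)[OF h0(1) sub(4)[OF k] hk] binvertible_compose(2)[OF iR(1,2)] binvertible_compose(2)[OF iR(4,3)]
        by simp
      \<comment> \<open>As \<open>R\<close> is an exact representation, the inverse at the product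
        splits up to the scalar \<open>\<rho> h k\<close>, which commutes to the front and meets
        \<open>T (m h k)\<close>. The difference then contains only the defect of the pair
        \<open>S h\<close>, \<open>T k\<close>.\<close>
      then have "binv (R (m h k)) = (binv (R k) o\<^sub>L binv (R h)) o\<^sub>L \<rho> h k"
        by (simp add: blinfun_compose_assoc binv[OF iR(4)])
      then have "F (m h k) = (T (m h k) o\<^sub>L B o\<^sub>L (binv (R k) o\<^sub>L binv (R h))) o\<^sub>L \<rho> h k"
        by (simp add: F_def blinfun_compose_assoc)
      also have "\<dots> = \<rho> h k o\<^sub>L (T (m h k) o\<^sub>L B o\<^sub>L (binv (R k) o\<^sub>L binv (R h)))"
        by (rule rho_commute) (intro Alin_compose Alin_binv T(2) B(1) R(1) iR sub(4)[OF k] h0)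
      finally have "(S h o\<^sub>L F k o\<^sub>L binv (R h)) - F (m h k)
         = ((S h o\<^sub>L T k) - (\<rho> h k o\<^sub>L T (m h k))) o\<^sub>L B o\<^sub>L binv (R k) o\<^sub>L binv (R h)"
        by (simp add: F_def blinfun_ring blinfun_compose_assoc)
      also have "\<dots> = (((S h - T h) o\<^sub>L T k) + ((T h o\<^sub>L T k) - (\<rho> h k o\<^sub>L T (m h k)))) o\<^sub>L B o\<^sub>L binv (R k) o\<^sub>L binv (R h)"
        by (simp add: blinfun_ring)
      finally have "norm ((S h o\<^sub>L F k o\<^sub>L binv (R h)) - F (m h k))
         \<le> norm (((S h - T h) o\<^sub>L T k) + ((T h o\<^sub>L T k) - (\<rho> h k o\<^sub>L T (m h k)))) * norm B * norm (binv (R k)) * norm (binv (R h))"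
        by (simp only:) (intro order_trans[OF norm_blinfun_compose] mult_right_mono norm_ge_zero order_refl)
      also have "\<dots> \<le> (\<tau> * norm (T k) + norm ((T h o\<^sub>L T k) - (\<rho> h k o\<^sub>L T (m h k)))) * M * norm (binv (R k)) * norm (binv (R h))"
      proof (intro mult_right_mono mult_mono norm_triangle_le add_mono order_trans[OF norm_blinfun_compose])
        show "norm (S h - T h) \<le> \<tau>" using T(3)[OF h] by (simp add: norm_minus_commute)
      qed (use M \<tau> in auto)
      also have "\<dots> = M * (\<tau> * (norm (T k) * norm (binv (R k))) * norm (binv (R h)) + d h k)"
        by (simp add: d_def algebra_simps)
      also have "\<dots> \<le> M * (\<tau> * q * r + \<eta> / (2 * M))"
        using V2(4)[OF sub(2)[OF k]] V3(4)[OF h0(2) sub(1)[OF k] hk] r(2)[OF h] \<tau> M q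
        by (intro mult_left_mono add_mono mult_mono) auto
      also have "\<dots> = \<tau> * (q * r * M) + \<eta> / 2" using M(1) by (simp add: algebra_simps)
      also have "\<dots> \<le> \<eta>" using sm(2) \<eta> by simp
      finally show "norm ((S h o\<^sub>L F k o\<^sub>L binv (R h)) - F (m h k)) \<le> \<eta>" .
    qed
  qed
  ultimately show ?thesis by blast
qed

text \<open>With errors \<open>e n = 1/8 * (1/2) ^ n\<close>, each application of
  \<open>intertwiner_step\<close> moves the operator by at most \<open>e n + e (Suc n)\<close>,
  hence by at most \<open>2 * e n\<close>. The moves add up to at most 1/2, so the limit stays
  invertible, and the vanishing errors make it intertwine exactly. The bound 1/8 in the hypothesis
  says that the identity is an admissible start.\<close>

lemma intertwiner:
  assumes V0: "open V0" "x \<in> V0" and R_rep: "uc_sigma_rep s t u m \<sigma> act (rg V0) V0 R"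
    and close: "\<And>k. k \<in> K \<Longrightarrow> norm ((S k o\<^sub>L binv (R k)) - id_blinfun) \<le> 1/8"
  shows "\<exists>B. Alin B \<and> binvertible B \<and> (\<forall>k\<in>K. S k o\<^sub>L B = B o\<^sub>L R k)"
proof -
  define e :: "nat \<Rightarrow> real" where "e n = 1/8 * (1/2) ^ n" for n
  have e: "e n > 0" "e (Suc n) \<le> e n" for n by (simp_all add: e_def)
  define Q where "Q n B \<longleftrightarrow> Alin B \<and> (\<forall>k\<in>K. norm ((S k o\<^sub>L B o\<^sub>L binv (R k)) - B) \<le> e n)" for n B
  have "\<exists>f. f 0 = id_blinfun \<and> (\<forall>n. Q n (f n) \<and> norm (f (Suc n) - f n) \<le> 2 * e n)"
  proof -
    have "\<exists>f. \<forall>n. (Q n (f n) \<and> (n = 0 \<longrightarrow> f n = id_blinfun)) \<and> norm (f (Suc n) - f n) \<le> 2 * e n"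
    proof (rule dependent_nat_choice)
      have "Q 0 id_blinfun" unfolding Q_def using close by (simp add: e_def Alin_id)
      then show "\<exists>B. Q 0 B \<and> (0 = 0 \<longrightarrow> B = id_blinfun)" by blast
      fix B n assume "Q n B \<and> (n = 0 \<longrightarrow> B = id_blinfun)"
      then obtain B' where "Alin B'" "norm (B' - B) \<le> e n + e (Suc n)"
         "\<forall>h\<in>K. norm ((S h o\<^sub>L B' o\<^sub>L binv (R h)) - B') \<le> e (Suc n)"
        using intertwiner_step[OF V0 R_rep, of B "e n" "e (Suc n)"] e unfolding Q_def by blast
      then show "\<exists>B'. (Q (Suc n) B' \<and> (Suc n = 0 \<longrightarrow> B' = id_blinfun)) \<and> norm (B' - B) \<le> 2 * e n"
        using e(2)[of n] unfolding Q_def by (intro exI[of _ B']) auto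
    qed
    then show ?thesis by auto
  qed
  then obtain f where f: "f 0 = id_blinfun" "\<And>n. Q n (f n)" "\<And>n. norm (f (Suc n) - f n) \<le> 2 * e n" by blast
  have gs: "(\<lambda>n. 2 * e n) sums (1/2)"
    unfolding e_def using sums_mult[OF geometric_sums[of "1/2::real"], of "1/4"] by simp
  have sum: "summable (\<lambda>n. f (Suc n) - f n)"
    by (rule summable_comparison_test'[OF sums_summable[OF gs] f(3)])
  define B where "B = id_blinfun + (\<Sum>n. f (Suc n) - f n)"
  have lim: "f \<longlonglongrightarrow> B"
  proof -
    have "(\<lambda>n. \<Sum>j<n. f (Suc j) - f j) \<longlonglongrightarrow> (\<Sum>n. f (Suc n) - f n)" by (rule summable_LIMSEQ[OF sum])
    then have "(\<lambda>n. f n - id_blinfun) \<longlonglongrightarrow> (\<Sum>n. f (Suc n) - f n)"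
      by (simp add: sum_lessThan_telescope f(1))
    from tendsto_add[OF tendsto_const this, of id_blinfun] show ?thesis by (simp add: B_def)
  qed
  have "norm (B - id_blinfun) \<le> 1/2"
    using norm_suminf_le[OF f(3) sums_summable[OF gs]] sums_unique[OF gs] by (simp add: B_def)
  then have "binvertible B"
    using binvertible_perturb(1)[of id_blinfun 1 B] by (simp add: norm_blinfun_id_le)
  moreover have "Alin B" by (rule Alin_limit[OF lim]) (use f(2) in \<open>simp add: Q_def\<close>)
  moreover have "S k o\<^sub>L B = B o\<^sub>L R k" if k: "k \<in> K" for k
  proof -
    have Rk: "binvertible (R k)" using R_rep K_rg[OF V0(2) k] unfolding uc_rep_iff by blast
    have "(\<lambda>n. (S k o\<^sub>L f n o\<^sub>L binv (R k)) - f n) \<longlonglongrightarrow> (S k o\<^sub>L B o\<^sub>L binv (R k)) - B"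
      by (intro tendsto_intros lim)
    moreover have "(\<lambda>n. (S k o\<^sub>L f n o\<^sub>L binv (R k)) - f n) \<longlonglongrightarrow> 0"
    proof (rule Lim_null_comparison)
      show "\<forall>\<^sub>F n in sequentially. norm ((S k o\<^sub>L f n o\<^sub>L binv (R k)) - f n) \<le> e n"
        using f(2) k by (simp add: Q_def)
      show "e \<longlonglongrightarrow> 0" unfolding e_def by (intro tendsto_mult_right_zero LIMSEQ_realpow_zero) auto
    qed
    ultimately have "(S k o\<^sub>L B o\<^sub>L binv (R k)) - B = 0" by (rule LIMSEQ_unique)
    then have "S k o\<^sub>L B o\<^sub>L binv (R k) = B" by simp
    then have "(S k o\<^sub>L B o\<^sub>L binv (R k)) o\<^sub>L R k = B o\<^sub>L R k" by (rule arg_cong)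
    then have "B o\<^sub>L R k = S k o\<^sub>L B o\<^sub>L (binv (R k) o\<^sub>L R k)" by (simp add: blinfun_compose_assoc)
    then show ?thesis using binv(2)[OF Rk] by simp
  qed
  ultimately show ?thesis by blast
qed

text \<open>Being linear over the algebra, \<open>B\<close> commutes with the scalars of the
  multiplier, so conjugation preserves the twist.\<close>

lemma uc_rep_conjugate:
  assumes "uc_sigma_rep s t u m \<sigma> act H Y R" "Alin B" "binvertible B" "\<And>g h. g \<in> H \<Longrightarrow> h \<in> H \<Longrightarrow> s g = t h \<Longrightarrow> m g h \<in> H"
  shows "uc_sigma_rep s t u m \<sigma> act H Y (\<lambda>g. B o\<^sub>L R g o\<^sub>L binv B)"
  unfolding uc_rep_iff
proof (intro conjI ballI impI)
  note R = assms(1)[unfolded uc_rep_iff]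
  show "continuous_on H (\<lambda>g. B o\<^sub>L R g o\<^sub>L binv B)" using R by (intro continuous_intros) auto
  fix g assume g: "g \<in> H"
  show "Alin (B o\<^sub>L R g o\<^sub>L binv B)" using R g assms by (intro Alin_compose Alin_binv) auto
  show "binvertible (B o\<^sub>L R g o\<^sub>L binv B)"
    using R g assms by (intro binvertible_compose(1) binvertible_binv) auto
  fix h assume h: "h \<in> H" "s g = t h"
  have "\<rho> g h o\<^sub>L (B o\<^sub>L R (m g h) o\<^sub>L binv B) = (\<rho> g h o\<^sub>L B) o\<^sub>L R (m g h) o\<^sub>L binv B"
    by (simp add: blinfun_compose_assoc)
  also have "\<dots> = B o\<^sub>L (\<rho> g h o\<^sub>L R (m g h)) o\<^sub>L binv B"
    unfolding rho_commute[OF assms(2), symmetric] by (simp add: blinfun_compose_assoc)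
  also have "\<rho> g h o\<^sub>L R (m g h) = R g o\<^sub>L R h" using R g h by blast
  finally show "\<rho> g h o\<^sub>L (B o\<^sub>L R (m g h) o\<^sub>L binv B) = (B o\<^sub>L R g o\<^sub>L binv B) o\<^sub>L (B o\<^sub>L R h o\<^sub>L binv B)"
    by (simp add: blinfun_compose_assoc binv_cancel[OF assms(3)])
qed (use assms(1)[unfolded uc_rep_iff] binv[OF assms(3)] in simp)

theorem local_extension:
  "\<exists>V. open V \<and> x \<in> V \<and> (\<exists>R. uc_sigma_rep s t u m \<sigma> act (rg V) V R \<and> (\<forall>k\<in>K. R k = S k))"
proof -
  obtain b where b: "b \<ge> 1" "\<And>k. k \<in> K \<Longrightarrow> norm (binv (S k)) \<le> b" using S_bound by blast
  \<comment> \<open>At distance \<open>1 / (16 * b)\<close> from \<open>S k\<close> the inverse of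
    \<open>R k\<close> has norm at most \<open>2 * b\<close>, and the product of the two bounds is
    the 1/8 required by \<open>intertwiner\<close>.\<close>
  obtain V R where V: "open V" "x \<in> V" and R: "uc_sigma_rep s t u m \<sigma> act (rg V) V R"
    and close: "\<And>k. k \<in> K \<Longrightarrow> norm (R k - S k) < 1 / (16 * b)"
    using rep_near_S[of "1 / (16 * b)"] b(1) by auto
  have "norm ((S k o\<^sub>L binv (R k)) - id_blinfun) \<le> 1/8" if k: "k \<in> K" for k
  proof -
    have "1 / (16 * b) \<le> 1 / (2 * b)" using b(1) by (simp add: field_simps)
    then have "binvertible (R k)" "norm (binv (R k)) \<le> 2 * b"
      using binvertible_perturb[OF S_facts(2)[OF k] b(2)[OF k], of "R k"] close[OF k] b(1) by auto
    then have "(S k o\<^sub>L binv (R k)) - id_blinfun = (S k - R k) o\<^sub>L binv (R k)"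
      by (simp add: blinfun_ring binv)
    then have "norm ((S k o\<^sub>L binv (R k)) - id_blinfun) \<le> norm (S k - R k) * norm (binv (R k))"
      by (simp add: norm_blinfun_compose)
    also have "\<dots> \<le> (1 / (16 * b)) * (2 * b)"
      using close[OF k] \<open>norm (binv (R k)) \<le> 2 * b\<close> b(1)
      by (intro mult_mono) (auto simp: norm_minus_commute)
    also have "\<dots> = 1/8" using b(1) by simp
    finally show ?thesis .
  qed
  then obtain B where B: "Alin B" "binvertible B" "\<And>k. k \<in> K \<Longrightarrow> S k o\<^sub>L B = B o\<^sub>L R k"
    using intertwiner[OF V R] by blast
  have "uc_sigma_rep s t u m \<sigma> act (rg V) V (\<lambda>g. B o\<^sub>L R g o\<^sub>L binv B)"
    by (rule uc_rep_conjugate[OF R B(1,2)]) (simp add: rg_iff)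
  moreover have "B o\<^sub>L R k o\<^sub>L binv B = S k" if "k \<in> K" for k
    using B(3)[OF that, symmetric] by (simp add: blinfun_compose_assoc binv[OF B(2)])
  ultimately show ?thesis using V by blast
qed

end

theorem mainTheorem6:
  fixes s t :: "'g::t2_space \<Rightarrow> 'x::topological_space"
    and u :: "'x \<Rightarrow> 'g" and m :: "'g \<Rightarrow> 'g \<Rightarrow> 'g" and i :: "'g \<Rightarrow> 'g"
    and \<mu> :: "'x \<Rightarrow> 'g measure"
    and \<sigma> :: "'g \<Rightarrow> 'g \<Rightarrow> 'a::{real_normed_algebra_1, banach}"
    and act :: "'a \<Rightarrow> 'e::banach \<Rightarrow> 'e"
    and x :: 'x
    and S :: "'g \<Rightarrow> ('e \<Rightarrow>\<^sub>L 'e)"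
  assumes "locally_compact_groupoid s t u m i \<mu>"
    and "proper_groupoid s t"
    and "multiplier s t u m \<sigma>"
    and "\<forall>g h b. s g = t h \<and> \<sigma> g h * b = 1 \<and> b * \<sigma> g h = 1 \<longrightarrow> norm b = 1 / norm (\<sigma> g h)"
    and "banach_module act"
    and "uc_sigma_rep s t u m \<sigma> act (isotropy s t x) {x} S"
  shows "\<exists>V. open V \<and> x \<in> V \<and>
           (\<exists>R. uc_sigma_rep s t u m \<sigma> act (restrict_groupoid s t V) V R \<and>
                (\<forall>k \<in> isotropy s t x. R k = S k))"
proof -
  interpret isotropy_rep s t u m i \<mu> act \<sigma> x S
    by unfold_locales (fact assms)+
  show ?thesis by (rule local_extension)
qed

end
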